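(* Let $x=p/q$ with $p\in\mathbb Z$, $q\in\mathbb N$, $\gcd(p,q)=1$, and let $\theta=7/64$. Let $\{y_n\}_{n\in\mathbb N}$ be positive numbers with $y_n\asymp n^{-\alpha}$ for some fixed $\alpha\in[\tfrac{2}{1+2\theta},2)$. Then $\delta_{n,x,y_n}\to\mu_{\mathcal M}$ weakly as $n\to\infty$ along $n\in\mathbb N_q$, and $\delta^{\rm pr}_{n,x,y_n}\to\mu_{\mathcal M}$ weakly as $n\to\infty$ along $n\in\mathbb N_q^{\rm pr}$, where $\mathbb N_q=\{n\in\mathbb N:\gcd(n^2,q)\mid n\}$ and $\mathbb N_q^{\rm pr}=\{n\in\mathbb N:\gcd(n,q)=1\}$.
   Context: $\mathcal M=\mathrm{SL}_2(\mathbb Z)\backslash\mathbb H$ is the modular surface, $\Gamma=\mathrm{SL}_2(\mathbb Z)$, and $\mu_{\mathcal M}$ is the normalized hyperbolic area, $d\mu_{\mathcal M}=\frac{3}{\pi}\frac{dx\,dy}{y^2}$. For $n\in\mathbb N$, $x\in\mathbb R/\mathbb Z$, $y>0$, $\delta_{n,x,y}$ is the probability measure $\frac1n\sum_{j=0}^{n-1}\delta_{\Gamma(x+j/n+iy)}$ and $\delta^{\rm pr}_{n,x,y}=\frac{1}{\varphi(n)}\sum_{j\in(\mathbb Z/n\mathbb Z)^\times}\delta_{\Gamma(x+j/n+iy)}$ on $\mathcal M$. Weak convergence means convergence against every $\Psi\in C_c^\infty(\mathcal M)$ (equivalently $C_c(\mathcal M)$). $A\asymp B$ means $A\ll B\ll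 A$. *)

theory Defs
  imports "HOL-Analysis.Analysis" "HOL-Number_Theory.Number_Theory"
begin

definition sl2_act :: "int \<Rightarrow> int \<Rightarrow> int \<Rightarrow> int \<Rightarrow> complex \<Rightarrow> complex" where
  "sl2_act a b c d z = (of_int a * z + of_int b) / (of_int c * z + of_int d)"

definition upper_half :: "complex set" where
  "upper_half = {z. Im z > 0}"

text \<open>Functions in C_c(M), M = SL_2(Z)\H, realised as their lifts to H:
  continuous on H, SL_2(Z)-invariant, and vanishing high in the cusp
  (which is exactly compact support on the quotient).\<close>
definition Cc_modular :: "(complex \<Rightarrow> real) set" where
  "Cc_modular = {f. continuous_on upper_half f \<and>
     (\<forall>a b c d z. a * d - b * c = 1 \<and> z \<in> upper_half \<longrightarrow> f (sl2_act a b c d z) = f z) \<and>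
     (\<exists>Y. \<forall>z. Im z > Y \<longrightarrow> f z = 0)}"

definition fund_dom :: "complex set" where
  "fund_dom = {z. Im z > 0 \<and> \<bar>Re z\<bar> \<le> 1/2 \<and> cmod z \<ge> 1}"

definition mu_M_integral :: "(complex \<Rightarrow> real) \<Rightarrow> real" where
  "mu_M_integral f = 3 / pi * (LINT z : fund_dom | lborel. f z / (Im z)^2)"

definition delta_integral :: "nat \<Rightarrow> real \<Rightarrow> real \<Rightarrow> (complex \<Rightarrow> real) \<Rightarrow> real" where
  "delta_integral n x y f = (1 / real n) * (\<Sum>j<n. f (Complex (x + real j / real n) y))"

definition delta_pr_integral :: "nat \<Rightarrow> real \<Rightarrow> real \<Rightarrow> (complex \<Rightarrow> real) \<Rightarrow> real" where
  "delta_pr_integral n x y f =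
     (1 / real (totient n)) * (\<Sum>j\<in>{j. j < n \<and> coprime j n}. f (Complex (x + real j / real n) y))"

definition N_q :: "nat \<Rightarrow> nat set" where
  "N_q q = {n. n \<ge> 1 \<and> gcd (n^2) q dvd n}"

definition N_q_pr :: "nat \<Rightarrow> nat set" where
  "N_q_pr q = {n. n \<ge> 1 \<and> coprime n q}"

end

theory Submission
  imports Defs "HOL-Probability.Sinc_Integral"
begin

text \<open>
  The proof is elementary. If $\gcd(n,q)=1$, every point of the primitive set at $p/q$ is moved by a
  suitable element of $SL_2(\mathbb Z)$ to height $1/(q^2n^2y)$, and the images form the primitive set
  of some other base point; so $y \asymp n^{-\alpha}$ is exchanged for the much larger height
  $n^{\alpha-2}$, at which $n$ points are far denser than the hyperbolic scale. Uniform continuity and a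
  sieve count of integers coprime to $n$ in short intervals then reduce the primitive case to the
  equidistribution of long closed horocycles. The full set splits into primitive sets of the divisors
  $m$ of $n$, and the divisor bound makes the small $m$ negligible. For $n \in \mathbb N_q$ the part of
  $q$ sharing primes with $n$ divides $n$ and is absorbed by a shift of $j$.

  For the long horocycles, write $f$ as the sum over $SL_2(\mathbb Z)$ of its restriction to the
  standard fundamental domain and unfold: for each fixed horocycle parameter $u$ the horocycle average
  becomes a weighted sum over coprime pairs $(a, c)$ with $c^2 y$ bounded. The sum over all pairs is a
  Riemann sum, and passing to coprime pairs divides the limit by $\zeta(2)$.
\<close>

subsection \<open>Riemann sums and integrals\<close>

lemma set_integrable_lborel_bounded:
  fixes g :: "'a::euclidean_space \<Rightarrow> real"
  assumes "g \<in> borel_measurable borel" and "\<And>x. x \<in> S \<Longrightarrow> \<bar>g x\<bar> \<le> B"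
    and "S \<in> sets borel" and "emeasure lborel S < \<infinity>"
  shows "set_integrable lborel S g"
  unfolding set_integrable_def
  by (rule integrableI_bounded_set_indicator[where B = B]; use assms in simp)

lemma set_integral_shift_Ioc:
  fixes g :: "real \<Rightarrow> real"
  shows "(LINT x:{a<..b}|lborel. g (x + s)) = (LINT x:{a + s<..b + s}|lborel. g x)"
  unfolding set_lebesgue_integral_def
  by (subst (2) lborel_integral_real_affine[of 1 _ s])
     (auto intro!: Bochner_Integration.integral_cong simp: indicator_def add.commute)

lemma set_integral_periodic_shift:
  fixes g :: "real \<Rightarrow> real"
  assumes meas: "g \<in> borel_measurable borel" and bound: "\<And>x. \<bar>g x\<bar> \<le> B"
    and periodic: "\<And>x (n::int). g (x + of_int n) = g x"
  shows "(LINT x:{0<..1}|lborel. g (x + s)) = (LINT x:{0<..1}|lborel. g x)"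
proof -
  have integrable: "set_integrable lborel {a<..b} g" if "a \<le> b" for a b
    using that by (intro set_integrable_lborel_bounded[OF meas bound]) auto
  have "g (x + s) = g (x + frac s)" for x
    using periodic[of "x + frac s" "\<lfloor>s\<rfloor>"] by (simp add: frac_def)
  hence "(LINT x:{0<..1}|lborel. g (x + s)) = (LINT x:{frac s<..1 + frac s}|lborel. g x)"
    using set_integral_shift_Ioc[of 0 1 g "frac s"] by simp
  also have "\<dots> = (LINT x:{frac s<..1}|lborel. g x) + (LINT x:{1<..1 + frac s}|lborel. g x)"
    using frac_lt_1[of s]
    by (subst set_integral_Un[symmetric]) (auto intro!: integrable simp: ivl_disj_un less_imp_le)
  also have "(LINT x:{1<..1 + frac s}|lborel. g x) = (LINT x:{0<..frac s}|lborel. g x)"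
    using set_integral_shift_Ioc[of 0 "frac s" g 1] periodic[of _ 1] by (simp add: add.commute)
  also have "(LINT x:{frac s<..1}|lborel. g x) + (LINT x:{0<..frac s}|lborel. g x) =
      (LINT x:{0<..1}|lborel. g x)"
    using frac_lt_1[of s]
    by (subst add.commute, subst set_integral_Un[symmetric])
       (auto intro!: integrable simp: ivl_disj_un less_imp_le)
  finally show ?thesis .
qed

lemma integral_double_sum:
  fixes g :: "'i \<Rightarrow> 'j \<Rightarrow> 'a \<Rightarrow> real"
  assumes "\<And>i j. i \<in> A \<Longrightarrow> j \<in> B i \<Longrightarrow> integrable M (g i j)"
  shows "(LINT x|M. (\<Sum>i\<in>A. \<Sum>j\<in>B i. g i j x)) = (\<Sum>i\<in>A. \<Sum>j\<in>B i. LINT x|M. g i j x)"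
proof -
  have "(LINT x|M. (\<Sum>i\<in>A. \<Sum>j\<in>B i. g i j x)) = (\<Sum>i\<in>A. LINT x|M. (\<Sum>j\<in>B i. g i j x))"
    by (intro Bochner_Integration.integral_sum Bochner_Integration.integrable_sum assms)
  also have "\<dots> = (\<Sum>i\<in>A. \<Sum>j\<in>B i. LINT x|M. g i j x)"
    by (intro sum.cong refl Bochner_Integration.integral_sum assms)
  finally show ?thesis .
qed

lemma integral_ceiling_step:
  fixes G :: "int \<Rightarrow> real"
  assumes h_pos: "h > 0" and "finite K" and supp: "\<And>k. k \<notin> K \<Longrightarrow> G k = 0"
  shows "(LINT r|lborel. G \<lceil>r / h\<rceil>) = h * (\<Sum>k\<in>K. G k)"
proof -
  let ?I = "\<lambda>k::int. {(of_int k - 1) * h<..of_int k * h}"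
  have "indicator (?I k) r = (if k = \<lceil>r / h\<rceil> then 1 else 0 :: real)" for k r
  proof -
    have "k = \<lceil>r / h\<rceil> \<longleftrightarrow> of_int k - 1 < r / h \<and> r / h \<le> of_int k"
      by (simp only: eq_commute[of k] ceiling_eq_iff)
    thus ?thesis using h_pos by (auto simp: indicator_def field_simps)
  qed
  hence "G \<lceil>r / h\<rceil> = (\<Sum>k\<in>K. indicator (?I k) r * G k)" for r
    using \<open>finite K\<close> supp[of "\<lceil>r / h\<rceil>"] by (simp add: if_distrib[of "\<lambda>x. x * _"] cong: if_cong)
  hence "(LINT r|lborel. G \<lceil>r / h\<rceil>) = (LINT r|lborel. (\<Sum>k\<in>K. indicator (?I k) r * G k))"
    by simp
  also have "\<dots> = (\<Sum>k\<in>K. LINT r|lborel. indicator (?I k) r * G k)"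
    using h_pos by (intro Bochner_Integration.integral_sum) (auto intro!: integrable_mult_left)
  also have "\<dots> = h * (\<Sum>k\<in>K. G k)"
    using h_pos by (simp add: sum_distrib_left algebra_simps)
  finally show ?thesis .
qed

lemma ceiling_multiple_bounds:
  fixes r h :: real
  assumes "h > 0"
  shows "r \<le> of_int \<lceil>r / h\<rceil> * h" and "of_int \<lceil>r / h\<rceil> * h < r + h"
proof -
  have "r / h \<le> of_int \<lceil>r / h\<rceil>" by linarith
  thus "r \<le> of_int \<lceil>r / h\<rceil> * h" using assms by (simp only: pos_divide_le_eq)
  have "of_int \<lceil>r / h\<rceil> < (r + h) / h" using assms by (simp add: add_divide_distrib) linarith
  thus "of_int \<lceil>r / h\<rceil> * h < r + h" using assms by (simp only: pos_less_divide_eq)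
qed

text \<open>The step function whose integral is the right-endpoint Riemann sum of mesh \<open>h\<close> on \<open>{0<..R}\<close>.\<close>
definition riemann_step :: "(nat \<Rightarrow> real) \<Rightarrow> real \<Rightarrow> real \<Rightarrow> real \<Rightarrow> real" where
  "riemann_step \<phi> h R r =
    (if 0 < \<lceil>r / h\<rceil> \<and> of_int \<lceil>r / h\<rceil> * h \<le> R then \<phi> (nat \<lceil>r / h\<rceil>) else 0)"

lemma borel_measurable_riemann_step [measurable]: "riemann_step \<phi> h R \<in> borel_measurable borel"
  unfolding riemann_step_def by measurable

lemma integral_riemann_step:
  assumes h_pos: "h > 0"
  shows "integral\<^sup>L lborel (riemann_step \<phi> h R) = h * (\<Sum>k | 0 < k \<and> real k * h \<le> R. \<phi> k)"
proof -
  define G where "G = (\<lambda>k::int. if 0 < k \<and> of_int k * h \<le> R then \<phi> (nat k) else 0)"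
  let ?K = "{k. 0 < k \<and> real k * h \<le> R}"
  have "?K \<subseteq> {..nat \<lceil>R / h\<rceil>}"
    using h_pos by (auto simp: pos_le_divide_eq[symmetric]) linarith
  hence "finite ?K" by (rule finite_subset) simp
  hence "finite (int ` ?K)" by (rule finite_imageI)
  moreover have "int ` ?K = {k. 0 < k \<and> of_int k * h \<le> R}"
    by (auto simp: image_iff dest!: zero_less_imp_eq_int)
  ultimately have "(LINT r|lborel. G \<lceil>r / h\<rceil>) = h * (\<Sum>k\<in>int ` ?K. G k)"
    using h_pos by (intro integral_ceiling_step) (auto simp: G_def)
  also have "(\<Sum>k\<in>int ` ?K. G k) = (\<Sum>k\<in>?K. \<phi> k)"
    by (subst sum.reindex) (auto simp: G_def)
  finally show ?thesis by (simp add: G_def riemann_step_def[abs_def])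
qed

lemma riemann_step_bounded:
  assumes h_pos: "h > 0" and bound: "\<And>k. real k * h \<le> R \<Longrightarrow> \<bar>\<phi> k\<bar> \<le> B"
  shows "norm (riemann_step \<phi> h R r) \<le> \<bar>B\<bar> * indicator {0..R} r"
proof (cases "0 < \<lceil>r / h\<rceil> \<and> of_int \<lceil>r / h\<rceil> * h \<le> R")
  case True
  hence "r \<in> {0..R}"
    using ceiling_multiple_bounds[OF h_pos, of r] h_pos by (auto simp: zero_less_divide_iff)
  thus ?thesis using True bound[of "nat \<lceil>r / h\<rceil>"] by (simp add: riemann_step_def)
next
  case False
  hence "riemann_step \<phi> h R r = 0" unfolding riemann_step_def by (rule if_not_P)
  thus ?thesis by simp
qed

lemma riemann_step_tendsto:
  fixes h :: "nat \<Rightarrow> real" and \<phi> :: "nat \<Rightarrow> nat \<Rightarrow> real"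
  assumes h_null: "\<And>n. h n > 0" "h \<longlonglongrightarrow> 0" and r_bounds: "0 < r" "r < R"
    and lim: "\<And>K. (\<And>n. K n > 0) \<Longrightarrow> (\<lambda>n. real (K n) * h n) \<longlonglongrightarrow> r \<Longrightarrow> (\<lambda>n. \<phi> n (K n)) \<longlonglongrightarrow> l"
  shows "(\<lambda>n. riemann_step (\<phi> n) (h n) R r) \<longlonglongrightarrow> l"
proof -
  define K where "K = (\<lambda>n. nat \<lceil>r / h n\<rceil>)"
  have K_eq: "0 < \<lceil>r / h n\<rceil>" "K n > 0" "real (K n) = of_int \<lceil>r / h n\<rceil>" for n
    using r_bounds(1) h_null(1)[of n] by (simp_all add: K_def)
  have tendsto_r: "(\<lambda>n. real (K n) * h n) \<longlonglongrightarrow> r"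
  proof (rule tendsto_sandwich[of "\<lambda>_. r" _ _ "\<lambda>n. r + h n"])
    show "(\<lambda>n. r + h n) \<longlonglongrightarrow> r" using tendsto_add[OF tendsto_const h_null(2), of r] by simp
  qed (use ceiling_multiple_bounds[OF h_null(1)] in \<open>auto
      simp: K_eq intro!: always_eventually less_imp_le\<close>)
  hence "eventually (\<lambda>n. real (K n) * h n < R) sequentially"
    using r_bounds by (auto intro: order_tendstoD)
  hence "eventually (\<lambda>n. \<phi> n (K n) = riemann_step (\<phi> n) (h n) R r) sequentially"
    by eventually_elim (use K_eq in \<open>auto simp: riemann_step_def K_def\<close>)
  with lim[OF K_eq(2) tendsto_r] show ?thesis by (rule Lim_transform_eventually)
qed

lemma riemann_sum_tendsto:
  fixes h :: "nat \<Rightarrow> real" and \<phi> :: "nat \<Rightarrow> nat \<Rightarrow> real"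
  assumes h_null: "\<And>n. h n > 0" "h \<longlonglongrightarrow> 0"
    and bound: "\<And>n k. real k * h n \<le> R \<Longrightarrow> \<bar>\<phi> n k\<bar> \<le> B"
    and [measurable]: "g \<in> borel_measurable borel"
    and lim: "AE r in lborel. 0 < r \<longrightarrow> r < R \<longrightarrow>
      (\<forall>K. (\<forall>n. K n > 0) \<longrightarrow> (\<lambda>n. real (K n) * h n) \<longlonglongrightarrow> r \<longrightarrow> (\<lambda>n. \<phi> n (K n)) \<longlonglongrightarrow> g r)"
  shows "(\<lambda>n. h n * (\<Sum>k | 0 < k \<and> real k * h n \<le> R. \<phi> n k)) \<longlonglongrightarrow> (LINT r:{0<..<R}|lborel. g r)"
proof -
  define S where "S = (\<lambda>n. riemann_step (\<phi> n) (h n) R)"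
  have S_bound: "norm (S n r) \<le> \<bar>B\<bar> * indicator {0..R} r" for n r
    unfolding S_def by (rule riemann_step_bounded[OF h_null(1) bound])
  have "(\<lambda>n. integral\<^sup>L lborel (S n)) \<longlonglongrightarrow> (LINT r|lborel. indicator {0<..<R} r * g r)"
  proof (rule integral_dominated_convergence[where w = "\<lambda>r. \<bar>B\<bar> * indicator {0..R} r"])
    show "integrable lborel (\<lambda>r. \<bar>B\<bar> * indicator {0..R} r)"
      by (cases "0 \<le> R") (auto intro!: integrable_mult_right)
    show "AE r in lborel. (\<lambda>n. S n r) \<longlonglongrightarrow> indicator {0<..<R} r * g r"
      using lim AE_lborel_singleton[of 0] AE_lborel_singleton[of R]
    proof eventually_elim
      case (elim r)
      show ?case
      proof (cases "0 < r \<and> r < R")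
        case True
        hence "(\<lambda>n. S n r) \<longlonglongrightarrow> g r"
          unfolding S_def using elim by (intro riemann_step_tendsto h_null) auto
        thus ?thesis using True by simp
      next
        case False
        hence "S n r = 0" for n using S_bound[of n r] elim by (auto simp: indicator_def)
        thus ?thesis using False by simp
      qed
    qed
  qed (use S_bound in \<open>simp_all add: S_def\<close>)
  thus ?thesis by (simp add: S_def integral_riemann_step h_null(1) set_lebesgue_integral_def)
qed

lemma unit_grid_eq: "N > 0 \<Longrightarrow> {k. 0 < k \<and> real k * (1 / real N) \<le> 1} = {0<..N}"
  by (auto simp: pos_divide_le_eq)

lemma riemann_sum_error_le:
  fixes F :: "real \<Rightarrow> real"
  assumes [measurable]: "F \<in> borel_measurable borel" and bound: "\<And>t. \<bar>F t\<bar> \<le> M" and N_pos: "N > 0"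
    and osc: "\<And>t t'. \<bar>t - t'\<bar> \<le> 1 / real N \<Longrightarrow> \<bar>F t - F t'\<bar> \<le> e"
  shows "\<bar>(LINT t:{0<..1}|lborel. F t) - (\<Sum>i\<in>{0<..N}. F (real i / real N)) / real N\<bar> \<le> e"
proof -
  define h where "h = 1 / real N"
  have h_pos: "h > 0" using N_pos by (simp add: h_def)
  define S where "S = riemann_step (\<lambda>i. F (real i / real N)) h 1"
  have integral_S: "integral\<^sup>L lborel S = (\<Sum>i\<in>{0<..N}. F (real i / real N)) / real N"
    unfolding S_def integral_riemann_step[OF h_pos]
    by (simp add: h_def unit_grid_eq[OF N_pos, simplified])
  have S_eq: "S t = indicator {0<..1} t * F (of_int \<lceil>t / h\<rceil> / real N)" for t
  proof -
    have "of_int \<lceil>t / h\<rceil> * h \<le> 1 \<longleftrightarrow> real_of_int \<lceil>t / h\<rceil> \<le> real_of_int (int N)"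
      using N_pos by (simp add: h_def pos_divide_le_eq)
    also have "\<dots> \<longleftrightarrow> t / h \<le> real N" by (simp only: of_int_le_iff ceiling_le_iff) simp
    also have "\<dots> \<longleftrightarrow> t \<le> 1" using N_pos by (simp add: h_def mult_le_cancel_right2)
    finally show ?thesis
      using h_pos by (auto simp: S_def riemann_step_def indicator_def zero_less_divide_iff)
  qed
  have diff: "\<bar>indicator {0<..1} t * F t - S t\<bar> \<le> indicator {0<..1} t * e" for t
    using ceiling_multiple_bounds[OF h_pos, of t]
    by (auto simp: S_eq h_def indicator_def intro!: osc)
  have integrable_F: "integrable lborel (\<lambda>t. indicator {0<..1} t * F t)"
    using set_integrable_lborel_bounded[of F "{0<..1}" M] bound by (simp add: set_integrable_def)
  have integrable_S: "integrable lborel S"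
    using set_integrable_lborel_bounded[of "\<lambda>t. F (of_int \<lceil>t / h\<rceil> / real N)" "{0<..1}" M] bound
    by (simp add: set_integrable_def S_eq[abs_def])
  have "\<bar>(LINT t|lborel. indicator {0<..1} t * F t - S t)\<bar> \<le>
      (LINT t|lborel. indicator {0<..1::real} t * e)"
  proof (rule Bochner_Integration.integral_abs_bound_integral)
    show "integrable lborel (\<lambda>t. indicator {0<..1} t * F t - S t)"
      using integrable_F integrable_S by (rule Bochner_Integration.integrable_diff)
  qed (use diff in \<open>auto intro!: integrable_mult_left\<close>)
  thus ?thesis
    using integrable_F integrable_S by (simp add: integral_S set_lebesgue_integral_def)
qed

lemma tendsto_zero_of_contraction:
  fixes e :: "'a \<Rightarrow> real"
  assumes c_bounds: "0 < c" "c < 1" and bound: "eventually (\<lambda>x. \<bar>e x\<bar> \<le> B) F"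
    and contract: "\<And>T. T > 0 \<Longrightarrow> eventually (\<lambda>x. \<bar>e x\<bar> \<le> T) F \<Longrightarrow> eventually (\<lambda>x. \<bar>e x\<bar> \<le> c * T) F"
  shows "(e \<longlongrightarrow> 0) F"
proof -
  define T where "T = \<bar>B\<bar> + 1"
  have iterate: "eventually (\<lambda>x. \<bar>e x\<bar> \<le> c ^ k * T) F" for k
  proof (induction k)
    case 0
    show ?case using bound by eventually_elim (simp add: T_def)
  next
    case (Suc k)
    show ?case using contract[OF _ Suc.IH] c_bounds by (simp add: T_def mult.assoc)
  qed
  show ?thesis
    unfolding tendsto_iff dist_real_def
  proof (intro allI impI)
    fix \<epsilon> :: real assume "\<epsilon> > 0"
    have "(\<lambda>k. c ^ k * T) \<longlonglongrightarrow> 0 * T"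
      using c_bounds by (intro tendsto_mult LIMSEQ_power_zero tendsto_const) auto
    hence "eventually (\<lambda>k. c ^ k * T < \<epsilon>) sequentially"
      using \<open>\<epsilon> > 0\<close> by (intro order_tendstoD) simp_all
    then obtain k where "c ^ k * T < \<epsilon>" using eventually_happens by fastforce
    with iterate[of k] show "eventually (\<lambda>x. \<bar>e x - 0\<bar> < \<epsilon>) F"
      by (auto elim!: eventually_mono)
  qed
qed

lemma inverse_squares_tail_sums: "(\<lambda>d. 1 / (real d + 2)\<^sup>2) sums (pi\<^sup>2 / 6 - 1)"
  using sums_split_initial_segment[OF inverse_squares_sums, of 1] by (simp add: add.commute)

lemma inverse_squares_tail_le: "pi\<^sup>2 / 6 - 1 \<le> 3/4"
proof -
  have "(\<lambda>n. 1 / (real n + 2)) \<longlonglongrightarrow> 0" by real_asymp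
  from telescope_sums'[OF this]
  have telescope: "(\<lambda>d. 1 / (real d + 2) - 1 / (real d + 3)) sums (1/2)" by (simp add: add_ac)
  have "(\<lambda>d. 1 / (real d + 3)\<^sup>2) sums (pi\<^sup>2 / 6 - 1 - 1/4)"
    using sums_split_initial_segment[OF inverse_squares_tail_sums, of 1] by (simp add: add_ac)
  from this telescope have "pi\<^sup>2 / 6 - 1 - 1/4 \<le> 1/2"
  proof (rule sums_le[rotated])
    show "1 / (real d + 3)\<^sup>2 \<le> 1 / (real d + 2) - 1 / (real d + 3)" for d
      by (simp add: divide_simps power2_eq_square)
  qed
  thus ?thesis by simp
qed

lemma summable_inverse_squares_tail: "summable (\<lambda>d. C / (real d + 2)\<^sup>2)"
  using sums_mult[OF inverse_squares_tail_sums, of C] by (simp add: sums_iff)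

lemma dilated_far_terms_tendsto_0:
  fixes b B :: real
  assumes b_pos: "b > 0" and B_nonneg: "B \<ge> 0"
  shows "((\<lambda>y. \<Sum>d. if (real d + 2)\<^sup>2 * y < b then 0 else B / (real d + 2)\<^sup>2) \<longlongrightarrow> 0) (at_right 0)"
proof -
  let ?far = "\<lambda>d y. if (real d + 2)\<^sup>2 * y < b then 0 else B / (real d + 2)\<^sup>2"
  have "((\<lambda>y. ?far d y) \<longlongrightarrow> 0) (at_right 0)" for d
  proof (rule tendsto_eventually)
    have "((\<lambda>y. (real d + 2)\<^sup>2 * y) \<longlongrightarrow> (real d + 2)\<^sup>2 * 0) (at_right 0)" by (intro tendsto_intros)
    hence "eventually (\<lambda>y. (real d + 2)\<^sup>2 * y < b) (at_right 0)"
      using b_pos by (intro order_tendstoD) simp_all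
    thus "eventually (\<lambda>y. ?far d y = 0) (at_right 0)" by eventually_elim simp
  qed
  hence "((\<lambda>y. \<Sum>d. ?far d y) \<longlongrightarrow> (\<Sum>d. 0)) (at_right 0)"
    using B_nonneg
    by (intro tannerys_theorem[where M = "\<lambda>d. B / (real d + 2)\<^sup>2", THEN conjunct2, THEN conjunct2]
        summable_inverse_squares_tail) (auto intro!: always_eventually)
  thus ?thesis by simp
qed

lemma eventually_dilated_tail_le:
  fixes e :: "real \<Rightarrow> real"
  assumes bound: "\<And>y. y > 0 \<Longrightarrow> \<bar>e y\<bar> \<le> B" and T_nonneg: "T \<ge> 0"
    and small: "eventually (\<lambda>y. \<bar>e y\<bar> \<le> T) (at_right 0)" and \<eta>_pos: "\<eta> > 0"
  shows "eventually (\<lambda>y. \<bar>\<Sum>d. e ((real d + 2)\<^sup>2 * y) / (real d + 2)\<^sup>2\<bar> \<le>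
      3/4 * T + \<eta>) (at_right 0)"
proof -
  obtain b where near: "b > 0" "\<And>y. 0 < y \<Longrightarrow> y < b \<Longrightarrow> \<bar>e y\<bar> \<le> T"
    using small by (auto simp: eventually_at_right_field)
  define far where "far = (\<lambda>d y. if (real d + 2)\<^sup>2 * y < b then 0 else B / (real d + 2)\<^sup>2)"
  have B_nonneg: "B \<ge> 0" using bound[of 1] by simp
  have summable_far: "summable (\<lambda>d. far d y)" for y
    by (rule summable_comparison_test'[OF summable_inverse_squares_tail[of B]])
      (use B_nonneg in \<open>simp add: far_def\<close>)
  have "((\<lambda>y. suminf (\<lambda>d. far d y)) \<longlongrightarrow> 0) (at_right 0)"
    unfolding far_def by (rule dilated_far_terms_tendsto_0[OF near(1) B_nonneg])
  hence "eventually (\<lambda>y. suminf (\<lambda>d. far d y) < \<eta>) (at_right 0)"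
    using \<eta>_pos by (intro order_tendstoD) simp_all
  moreover have "eventually (\<lambda>y. 0 < y) (at_right (0::real))"
    by (simp add: eventually_at_right_less)
  ultimately show ?thesis
  proof eventually_elim
    case (elim y)
    let ?term = "\<lambda>d. e ((real d + 2)\<^sup>2 * y) / (real d + 2)\<^sup>2"
    have term_le: "norm (?term d) \<le> T / (real d + 2)\<^sup>2 + far d y" for d
      using near(2)[of "(real d + 2)\<^sup>2 * y"] bound[of "(real d + 2)\<^sup>2 * y"] elim T_nonneg
      by (auto simp: far_def abs_divide divide_right_mono add_increasing)
    have "norm (\<Sum>d. ?term d) \<le> (\<Sum>d. T / (real d + 2)\<^sup>2 + far d y)"
      by (intro norm_suminf_le term_le summable_add summable_inverse_squares_tail summable_far)
    also have "\<dots> = (\<Sum>d. T / (real d + 2)\<^sup>2) + (\<Sum>d. far d y)"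
      by (intro suminf_add[symmetric] summable_inverse_squares_tail summable_far)
    also have "(\<Sum>d. T / (real d + 2)\<^sup>2) = T * (pi\<^sup>2 / 6 - 1)"
      using sums_mult[OF inverse_squares_tail_sums, of T] by (simp add: sums_iff)
    also have "\<dots> \<le> T * (3/4)" using T_nonneg by (intro mult_left_mono inverse_squares_tail_le)
    finally show ?case using elim by simp
  qed
qed

text \<open>Inverts $A(y) = \sum_d d^{-2} Q(d^2 y)$ without the Moebius function: since $\zeta(2) - 1 < 1$,
  the limsup of $|Q - \text{limit}|$ is bounded by a proper fraction of itself.\<close>
lemma tendsto_of_dilated_sum:
  fixes Q A :: "real \<Rightarrow> real"
  assumes bound: "\<And>y. y > 0 \<Longrightarrow> \<bar>Q y\<bar> \<le> B"
    and sums: "\<And>y. y > 0 \<Longrightarrow> (\<lambda>d. Q ((real d + 1)\<^sup>2 * y) / (real d + 1)\<^sup>2) sums A y"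
    and lim: "(A \<longlongrightarrow> A0) (at_right 0)"
  shows "(Q \<longlongrightarrow> 6 / pi\<^sup>2 * A0) (at_right 0)"
proof -
  define L where "L = 6 / pi\<^sup>2 * A0"
  define e where "e = (\<lambda>y. Q y - L)"
  have e_bound: "\<bar>e y\<bar> \<le> B + \<bar>L\<bar>" if "y > 0" for y
    using bound[OF that] unfolding e_def by linarith
  have e_eq: "e y = A y - A0 - (\<Sum>d. e ((real d + 2)\<^sup>2 * y) / (real d + 2)\<^sup>2)" if "y > 0" for y
  proof -
    have "(\<lambda>d. Q ((real d + 1)\<^sup>2 * y) / (real d + 1)\<^sup>2 - L * (1 / (real d + 1)\<^sup>2)) sums
        (A y - L * (pi\<^sup>2 / 6))"
      using inverse_squares_sums by (intro sums_diff sums sums_mult that) (simp add: add.commute)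
    hence "(\<lambda>d. e ((real d + 1)\<^sup>2 * y) / (real d + 1)\<^sup>2) sums (A y - A0)"
      by (simp add: e_def L_def diff_divide_distrib)
    from sums_split_initial_segment[OF this, of 1] show ?thesis by (simp add: add_ac sums_iff)
  qed
  have "(e \<longlongrightarrow> 0) (at_right 0)"
  proof (rule tendsto_zero_of_contraction)
    show "eventually (\<lambda>y. \<bar>e y\<bar> \<le> B + \<bar>L\<bar>) (at_right 0)"
      using eventually_at_right_less[of 0] by eventually_elim (rule e_bound)
  next
    fix T :: real assume T_pos: "T > 0" and small: "eventually (\<lambda>y. \<bar>e y\<bar> \<le> T) (at_right 0)"
    have "eventually (\<lambda>y. \<bar>A y - A0\<bar> < T / 20) (at_right 0)"
      using tendstoD[OF lim, of "T / 20"] T_pos by (simp add: dist_real_def)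
    moreover have "eventually (\<lambda>y. \<bar>\<Sum>d. e ((real d + 2)\<^sup>2 * y) / (real d + 2)\<^sup>2\<bar> \<le>
        3/4 * T + T / 20) (at_right 0)"
      using e_bound small T_pos by (intro eventually_dilated_tail_le) auto
    moreover have "eventually (\<lambda>y. 0 < y) (at_right (0::real))" by (rule eventually_at_right_less)
    ultimately show "eventually (\<lambda>y. \<bar>e y\<bar> \<le> 9/10 * T) (at_right 0)"
    proof eventually_elim
      case (elim y)
      thus ?case using e_eq[of y] by linarith
    qed
  qed simp_all
  hence "((\<lambda>y. e y + L) \<longlongrightarrow> 0 + L) (at_right 0)" by (intro tendsto_intros)
  thus ?thesis by (simp add: e_def L_def)
qed

lemma lborel_complex_eq: "(lborel :: complex measure) =
    distr (lborel \<Otimes>\<^sub>M lborel) borel (\<lambda>(x, y). Complex x y)"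
proof (rule lborel_eqI)
  have meas: "(\<lambda>(x, y). Complex x y) \<in> borel_measurable (lborel \<Otimes>\<^sub>M lborel)"
    unfolding lborel_prod Complex_eq split_beta
    unfolding measurable_lborel2 by (intro borel_measurable_continuous_onI continuous_intros)
  fix l u :: complex
  assume "\<And>b. b \<in> Basis \<Longrightarrow> l \<bullet> b \<le> u \<bullet> b"
  from this[of 1] this[of \<i>] have box_nonempty: "Re l \<le> Re u" "Im l \<le> Im u"
    by (auto simp: Basis_complex_def)
  have "(\<lambda>(x, y). Complex x y) -` box l u \<inter> space (lborel \<Otimes>\<^sub>M lborel) =
      {Re l<..<Re u} \<times> {Im l<..<Im u}"
    by (auto simp: box_def Basis_complex_def space_pair_measure)
  hence "emeasure (distr (lborel \<Otimes>\<^sub>M lborel) borel (\<lambda>(x, y). Complex x y)) (box l u) =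
      emeasure (lborel \<Otimes>\<^sub>M lborel) ({Re l<..<Re u} \<times> {Im l<..<Im u})"
    using meas by (subst emeasure_distr) auto
  also have "\<dots> = ennreal (Re u - Re l) * ennreal (Im u - Im l)"
    using box_nonempty by (simp add: lborel.emeasure_pair_measure_Times)
  also have "\<dots> = (\<Prod>b\<in>Basis. (u - l) \<bullet> b)"
    using box_nonempty by (simp add: Basis_complex_def ennreal_mult' mult.commute)
  finally show "emeasure (distr (lborel \<Otimes>\<^sub>M lborel) borel (\<lambda>(x, y). Complex x y)) (box l u) =
    ennreal (\<Prod>b\<in>Basis. (u - l) \<bullet> b)" .
qed simp

lemma borel_measurable_Complex [measurable (raw)]:
  assumes "g \<in> borel_measurable M" "h \<in> borel_measurable M"
  shows "(\<lambda>x. Complex (g x) (h x)) \<in> borel_measurable M"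
  unfolding Complex_eq using assms by measurable

lemma lborel_integral_complex_iterated:
  fixes g :: "complex \<Rightarrow> real"
  assumes "integrable lborel g"
  shows "(LINT z|lborel. g z) = (LINT \<eta>|lborel. LINT x|lborel. g (Complex x \<eta>))"
proof -
  have Complex: "(\<lambda>(x, \<eta>). Complex x \<eta>) \<in> lborel \<Otimes>\<^sub>M lborel \<rightarrow>\<^sub>M borel" by measurable
  have g_measurable: "g \<in> borel_measurable borel" using assms by auto
  have "integrable (lborel \<Otimes>\<^sub>M lborel) (\<lambda>p. g (case p of (x, \<eta>) \<Rightarrow> Complex x \<eta>))"
    using assms
    by (subst (asm) lborel_complex_eq) (simp only: integrable_distr_eq[OF Complex g_measurable])
  hence "integrable (lborel \<Otimes>\<^sub>M lborel) (\<lambda>(x, \<eta>). g (Complex x \<eta>))"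
    by (simp add: case_prod_unfold)
  moreover have "(LINT z|lborel. g z) =
      (LINT p|(lborel \<Otimes>\<^sub>M lborel). (case p of (x, \<eta>) \<Rightarrow> g (Complex x \<eta>)))"
    by (subst lborel_complex_eq, subst integral_distr[OF Complex g_measurable])
      (simp add: case_prod_unfold)
  ultimately show ?thesis by (simp only: lborel_pair.integral_snd)
qed

lemma integral_inverse_square_substitution:
  fixes \<kappa> :: "real \<Rightarrow> real"
  assumes [measurable]: "\<kappa> \<in> borel_measurable borel" and bound: "\<And>x. \<bar>\<kappa> x\<bar> \<le> B"
    and bounds: "0 < a" "a \<le> b"
  shows "(LINT r:{a..b}|lborel. r * \<kappa> (1 / r\<^sup>2)) = (LINT \<eta>:{1/b\<^sup>2..1/a\<^sup>2}|lborel. \<kappa> \<eta> / \<eta>\<^sup>2) / 2"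
proof -
  let ?g = "\<lambda>r::real. - (1 / r\<^sup>2)" and ?g' = "\<lambda>r::real. 2 / r^3" and ?f = "\<lambda>x. \<kappa> (-x) / x\<^sup>2"
  have "(LBINT x. ?f x * indicator {?g a..?g b} x) =
      (LBINT x. ?f (?g x) * ?g' x * indicator {a..b} x)"
  proof (rule integral_substitution(2)[where g = ?g and g' = ?g' and f = ?f])
    fix x assume "x \<in> {a..b}"
    hence "x > 0" using bounds by auto
    thus "(?g has_real_derivative ?g' x) (at x)" and "?g' x \<ge> 0"
      by (auto intro!: derivative_eq_intros simp: divide_simps power2_eq_square power3_eq_cube)
  next
    have "\<bar>?f x\<bar> \<le> B * (b\<^sup>2)\<^sup>2" if "x \<in> {?g a..?g b}" for x
    proof -
      have "1 / b\<^sup>2 \<le> -x" using that by simp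
      hence "(1 / b\<^sup>2)\<^sup>2 \<le> x\<^sup>2" using power_mono[of "1 / b\<^sup>2" "-x" 2] by simp
      moreover have "(1 / b\<^sup>2)\<^sup>2 > 0" "x \<noteq> 0" using that bounds by auto
      ultimately have "1 / x\<^sup>2 \<le> 1 / (1 / b\<^sup>2)\<^sup>2" by (intro divide_left_mono) auto
      hence "\<bar>\<kappa> (-x)\<bar> * (1 / x\<^sup>2) \<le> B * (b\<^sup>2)\<^sup>2"
        using bound[of "-x"] by (intro mult_mono) (auto simp: power_divide)
      thus ?thesis by (simp add: abs_divide)
    qed
    thus "set_integrable lborel {?g a..?g b} ?f"
      by (intro set_integrable_lborel_bounded) (auto simp: emeasure_lborel_Icc_eq)
    show "continuous_on {a..b} ?g'" using bounds by (intro continuous_intros) auto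
  qed (use bounds in auto)
  also have "(LBINT x. ?f (?g x) * ?g' x * indicator {a..b} x) =
      2 * (LINT r:{a..b}|lborel. r * \<kappa> (1 / r\<^sup>2))"
    unfolding set_lebesgue_integral_def
    by (subst integral_mult_right_zero[symmetric], intro Bochner_Integration.integral_cong refl)
       (auto simp: indicator_def field_simps power2_eq_square power3_eq_cube)
  also have "(LBINT x. ?f x * indicator {?g a..?g b} x) =
      (LINT \<eta>:{1/b\<^sup>2..1/a\<^sup>2}|lborel. \<kappa> \<eta> / \<eta>\<^sup>2)"
    unfolding set_lebesgue_integral_def
    by (subst lborel_integral_real_affine[of "-1" _ 0])
       (auto intro!: Bochner_Integration.integral_cong simp: indicator_def)
  finally show ?thesis by simp
qed

lemma integral_inverse_1_plus_square_real:
  "integrable lborel (\<lambda>u::real. 1 / (1 + u\<^sup>2))" "(LINT u|lborel. 1 / (1 + u\<^sup>2)) = pi"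
proof -
  have "einterval (-\<infinity>) \<infinity> = UNIV" by (auto simp: einterval_iff)
  thus "integrable lborel (\<lambda>u::real. 1 / (1 + u\<^sup>2))" "(LINT u|lborel. 1 / (1 + u\<^sup>2)) = pi"
    using integrable_inverse_1_plus_square LBINT_inverse_1_plus_square
    by (simp_all add: set_integrable_def interval_lebesgue_integral_def
        set_lebesgue_integral_def inverse_eq_divide)
qed

subsection \<open>Divisors and coprime integers\<close>

definition divisor_count :: "nat \<Rightarrow> nat" where
  "divisor_count n = card {d. d dvd n}"

lemma divisor_count_le_prod:
  assumes "n > 0"
  shows "divisor_count n \<le> (\<Prod>p\<in>prime_factors n. multiplicity p n + 1)"
proof -
  let ?g = "\<lambda>d. restrict (\<lambda>p. multiplicity p d) (prime_factors n)"
  have "card {d. d dvd n} \<le> card (\<Pi>\<^sub>E p\<in>prime_factors n. {..multiplicity p n})"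
  proof (rule card_inj_on_le[of ?g])
    show "inj_on ?g {d. d dvd n}"
    proof (rule inj_onI, clarsimp)
      fix a b assume divisors: "a dvd n" "b dvd n" and multiplicities_eq: "?g a = ?g b"
      have "multiplicity p a = multiplicity p b" if "prime p" for p
      proof (cases "p \<in> prime_factors n")
        case True
        thus ?thesis using fun_cong[OF multiplicities_eq, of p] by simp
      next
        case False
        hence "\<not> p dvd n" using that assms by (auto simp: prime_factors_dvd)
        hence "\<not> p dvd a" "\<not> p dvd b" using divisors by (auto dest: dvd_trans)
        thus ?thesis by (simp add: not_dvd_imp_multiplicity_0)
      qed
      moreover have "a \<noteq> 0" "b \<noteq> 0" using divisors assms by (auto intro!: Nat.gr0I)
      ultimately show "a = b" using multiplicity_eq_nat[of a b] by auto
    qed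
    show "?g ` {d. d dvd n} \<subseteq> (\<Pi>\<^sub>E p\<in>prime_factors n. {..multiplicity p n})"
      using assms by (auto intro!: dvd_imp_multiplicity_le)
    show "finite (\<Pi>\<^sub>E p\<in>prime_factors n. {..multiplicity p n})"
      by (intro finite_PiE) auto
  qed
  thus ?thesis by (simp add: divisor_count_def card_PiE)
qed

lemma two_power_le_divisor_count:
  assumes "n > 0"
  shows "2 ^ card (prime_factors n) \<le> divisor_count n"
proof -
  have "card (Pow (prime_factors n)) \<le> card {d. d dvd n}"
  proof (rule card_inj_on_le)
    have prime_factors_prod_eq: "prime_factors (\<Prod>S) = S" if "S \<subseteq> prime_factors n" for S
    proof -
      have prime: "prime p" if "p \<in> S" for p using \<open>S \<subseteq> prime_factors n\<close> that by auto
      have "0 \<notin> S" using prime[of 0] by auto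
      moreover have "\<forall>p\<in>S. prime_factors p = {p}" using prime by (simp add: prime_prime_factors)
      moreover have "finite S" using that by (rule finite_subset) simp
      ultimately show ?thesis by (subst prime_factors_prod) auto
    qed
    show "inj_on (\<lambda>S. \<Prod>S) (Pow (prime_factors n))"
    proof (rule inj_onI)
      fix S T assume "S \<in> Pow (prime_factors n)" "T \<in> Pow (prime_factors n)" "\<Prod>S = \<Prod>T"
      thus "S = T" using prime_factors_prod_eq by (metis (no_types) PowD)
    qed
    have "\<Prod>(prime_factors n) dvd (\<Prod>p\<in>prime_factors n. p ^ multiplicity p n)"
      by (intro prod_dvd_prod) (auto simp: prime_factors_multiplicity)
    also have "\<dots> = n" using prime_factorization_nat[of n] assms by simp
    finally have "\<Prod>(prime_factors n) dvd n" .
    moreover have "\<Prod>S dvd \<Prod>(prime_factors n)" if "S \<subseteq> prime_factors n" for S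
      using that by (intro prod_dvd_prod_subset) auto
    ultimately show "(\<lambda>S. \<Prod>S) ` Pow (prime_factors n) \<subseteq> {d. d dvd n}"
      by (blast intro: dvd_trans)
  qed (use assms in simp)
  thus ?thesis by (simp add: divisor_count_def card_Pow)
qed

lemma le_divisor_count_mult_totient:
  assumes "n > 0"
  shows "n \<le> divisor_count n * totient n"
proof -
  have "n = (\<Sum>d | d dvd n. totient d)" by (simp add: totient_divisor_sum)
  also have "\<dots> \<le> (\<Sum>d | d dvd n. totient n)"
    using assms by (intro sum_mono totient_dvd_mono) auto
  finally show ?thesis by (simp add: divisor_count_def)
qed

lemma Suc_le_powr:
  fixes p a :: nat and e :: real
  assumes e_pos: "e > 0" and p_ge: "p \<ge> 2"
  shows "real (a + 1) \<le>
    (if real p < 2 powr (1 / e) then 1 + 1 / (e * ln 2) else 1) * real p powr (e * a)"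
proof (cases "real p < 2 powr (1 / e)")
  case True
  have "1 + e * a * ln 2 \<le> exp (e * a * ln 2)" by (rule exp_ge_add_one_self)
  also have "\<dots> = 2 powr (e * a)" by (simp add: powr_def)
  also have "\<dots> \<le> real p powr (e * a)" using e_pos p_ge by (intro powr_mono2) auto
  finally have "(1 + 1 / (e * ln 2)) * (1 + e * a * ln 2) \<le>
      (1 + 1 / (e * ln 2)) * real p powr (e * a)"
    using e_pos by (intro mult_left_mono) auto
  moreover have "real (a + 1) \<le> (1 + 1 / (e * ln 2)) * (1 + e * a * ln 2)"
    using e_pos by (simp add: field_simps)
  ultimately show ?thesis using True by simp
next
  case False
  have "a + 1 \<le> 2 ^ a" by (induction a) auto
  hence "real (a + 1) \<le> real (2 ^ a)" by (simp only: of_nat_le_iff)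
  also have "\<dots> = (2 powr (1 / e)) powr (e * a)" using e_pos by (simp add: powr_powr powr_realpow)
  also have "\<dots> \<le> real p powr (e * a)" using False e_pos by (intro powr_mono2) auto
  finally show ?thesis using False by simp
qed

lemma divisor_count_le_powr:
  fixes e :: real
  assumes e_pos: "e > 0"
  obtains C where "C > 0" "\<And>n. n > 0 \<Longrightarrow> real (divisor_count n) \<le> C * real n powr e"
proof -
  define P where "P = {p::nat. real p < 2 powr (1 / e)}"
  define D where "D = 1 + 1 / (e * ln 2)"
  have "P \<subseteq> {..nat \<lceil>2 powr (1 / e)\<rceil>}" by (auto simp: P_def) linarith
  hence "finite P" by (rule finite_subset) simp
  have D_ge: "D \<ge> 1" using e_pos by (simp add: D_def)
  have bound: "real (divisor_count n) \<le> D ^ card P * real n powr e" if n_pos: "n > 0" for n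
  proof -
    have "real (divisor_count n) \<le> (\<Prod>p\<in>prime_factors n. real (multiplicity p n + 1))"
      using divisor_count_le_prod[OF n_pos] by (simp only: of_nat_prod[symmetric] of_nat_le_iff)
    also have "\<dots> \<le> (\<Prod>p\<in>prime_factors n.
        (if p \<in> P then D else 1) * real p powr (e * multiplicity p n))"
    proof (intro prod_mono conjI)
      fix p assume "p \<in> prime_factors n"
      hence "p \<ge> 2" using prime_ge_2_nat by auto
      thus "real (multiplicity p n + 1) \<le>
          (if p \<in> P then D else 1) * real p powr (e * multiplicity p n)"
        unfolding P_def D_def mem_Collect_eq by (rule Suc_le_powr[OF e_pos])
    qed simp
    also have "\<dots> = D ^ card (prime_factors n \<inter> P) *
        (\<Prod>p\<in>prime_factors n. real p powr (e * multiplicity p n))"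
      by (simp add: prod.distrib prod.If_cases)
    also have "(\<Prod>p\<in>prime_factors n. real p powr (e * multiplicity p n)) =
        (\<Prod>p\<in>prime_factors n. real (p ^ multiplicity p n) powr e)"
      by (intro prod.cong refl)
        (auto simp: powr_powr mult.commute prime_gt_0_nat in_prime_factors_iff
          simp flip: powr_realpow)
    also have "\<dots> = real (\<Prod>p\<in>prime_factors n. p ^ multiplicity p n) powr e"
      by (simp add: prod_powr_distrib prod_nonneg)
    also have "(\<Prod>p\<in>prime_factors n. p ^ multiplicity p n) = n"
      using n_pos prime_factorization_nat[of n] by simp
    also have "D ^ card (prime_factors n \<inter> P) * real n powr e \<le> D ^ card P * real n powr e"
      using D_ge \<open>finite P\<close> by (intro mult_right_mono power_increasing card_mono) auto
    finally show ?thesis .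
  qed
  have "D ^ card P > 0" using D_ge by simp
  from that[OF this bound] show thesis .
qed

lemma powr_mult_divisor_count_over_totient_tendsto_0:
  fixes a :: real
  assumes a_less: "a < 1"
  shows "(\<lambda>n. real n powr a * real (divisor_count n) / real (totient n)) \<longlonglongrightarrow> 0"
proof -
  define e where "e = (1 - a) / 4"
  have "e > 0" using a_less by (simp add: e_def)
  then obtain C where divisor_bound: "C > 0"
    "\<And>n. n > 0 \<Longrightarrow> real (divisor_count n) \<le> C * real n powr e"
    using divisor_count_le_powr by blast
  have ratio_le: "real n powr a * real (divisor_count n) / real (totient n) \<le>
      C\<^sup>2 * real n powr (-(2 * e))"
    if n_pos: "n > 0" for n
  proof -
    have "real n \<le> real (divisor_count n * totient n)"
      using le_divisor_count_mult_totient[OF n_pos] by (simp only: of_nat_le_iff)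
    hence "1 / real (totient n) \<le> real (divisor_count n) / real n"
      using n_pos by (simp add: field_simps)
    hence "real n powr a * real (divisor_count n) * (1 / real (totient n))
        \<le> real n powr a * real (divisor_count n) * (real (divisor_count n) / real n)"
      by (intro mult_left_mono) auto
    also have "\<dots> \<le> real n powr a * (C * real n powr e) * (C * real n powr e / real n)"
      using divisor_bound n_pos by (intro mult_mono divide_right_mono) auto
    also have "\<dots> = C\<^sup>2 * (real n powr a * real n powr e * real n powr e * real n powr (-1))"
      using n_pos by (simp add: powr_minus power2_eq_square divide_simps)
    also have "\<dots> = C\<^sup>2 * real n powr (-(2 * e))"
      unfolding powr_add[symmetric]
      by (rule arg_cong[of _ _ "\<lambda>b. C\<^sup>2 * real n powr b"]) (simp add: e_def field_simps)
    finally show ?thesis by simp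
  qed
  have "(\<lambda>n. real n powr (-(2 * e))) \<longlonglongrightarrow> 0"
    using \<open>e > 0\<close> by (intro tendsto_neg_powr filterlim_real_sequentially) auto
  hence "(\<lambda>n. C\<^sup>2 * real n powr (-(2 * e))) \<longlonglongrightarrow> C\<^sup>2 * 0" by (intro tendsto_mult tendsto_const)
  hence "(\<lambda>n. C\<^sup>2 * real n powr (-(2 * e))) \<longlonglongrightarrow> 0" by simp
  moreover have "\<forall>\<^sub>F n in sequentially.
      norm (real n powr a * real (divisor_count n) / real (totient n))
      \<le> C\<^sup>2 * real n powr (-(2 * e))"
    using eventually_gt_at_top[of 0] by eventually_elim (use ratio_le in simp)
  ultimately show ?thesis by (rule Lim_null_comparison[rotated])
qed

definition sifted_interval :: "nat set \<Rightarrow> real \<Rightarrow> real \<Rightarrow> int set" where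
  "sifted_interval P A B = {j. A < of_int j \<and> of_int j \<le> B \<and> (\<forall>p\<in>P. \<not> int p dvd j)}"

lemma finite_sifted_interval: "finite (sifted_interval P A B)"
  by (rule finite_subset[of _ "{\<lfloor>A\<rfloor>..\<lfloor>B\<rfloor>}"])
    (auto simp: sifted_interval_def le_floor_iff floor_le_iff)

lemma card_sifted_interval_insert:
  assumes new_prime: "prime p" "p \<notin> P" and primes: "\<And>l. l \<in> P \<Longrightarrow> prime l"
  shows "card (sifted_interval P A B) =
    card (sifted_interval (insert p P) A B) + card (sifted_interval P (A / real p) (B / real p))"
proof -
  have p_pos: "real p > 0" using new_prime prime_gt_0_nat by simp
  have dvd: "int l dvd int p * j \<longleftrightarrow> int l dvd j" if "l \<in> P" for l j
  proof -
    have "coprime l p" using primes[OF that] new_prime that by (intro primes_coprime) auto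
    hence "coprime (int l) (int p)" by simp
    thus ?thesis by (rule coprime_dvd_mult_right_iff)
  qed
  have "j \<in> sifted_interval P A B \<and> int p dvd j \<longleftrightarrow>
      j \<in> (\<lambda>k. int p * k) ` sifted_interval P (A / real p) (B / real p)" for j
  proof
    assume j_mem: "j \<in> sifted_interval P A B \<and> int p dvd j"
    then obtain k where "j = int p * k" by (auto simp: dvd_def)
    moreover from this have "k \<in> sifted_interval P (A / real p) (B / real p)"
      using j_mem p_pos dvd by (auto simp: sifted_interval_def field_simps)
    ultimately show "j \<in> (\<lambda>k. int p * k) ` sifted_interval P (A / real p) (B / real p)" by blast
  qed (use p_pos dvd in \<open>auto simp: sifted_interval_def field_simps\<close>)
  hence "sifted_interval P A B =
      sifted_interval (insert p P) A B \<union>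
          (\<lambda>k. int p * k) ` sifted_interval P (A / real p) (B / real p)"
    by (auto simp: sifted_interval_def)
  moreover have "sifted_interval (insert p P) A B \<inter>
      (\<lambda>k. int p * k) ` sifted_interval P (A / real p) (B / real p) = {}"
    by (auto simp: sifted_interval_def)
  moreover have "inj_on (\<lambda>k. int p * k) S" for S using p_pos by (auto simp: inj_on_def)
  ultimately show ?thesis
    by (simp add: card_Un_disjoint finite_sifted_interval card_image)
qed

lemma card_sifted_interval:
  assumes "finite P" "\<And>p. p \<in> P \<Longrightarrow> prime p" "A \<le> B"
  shows "\<bar>real (card (sifted_interval P A B)) - (B - A) * (\<Prod>p\<in>P. 1 - 1 / real p)\<bar> \<le> 2 ^ card P"
  using assms
proof (induction P arbitrary: A B rule: finite_induct)
  case empty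
  have "sifted_interval {} A B = {\<lfloor>A\<rfloor><..\<lfloor>B\<rfloor>}"
    by (auto simp: sifted_interval_def le_floor_iff floor_less_iff)
  moreover have "\<lfloor>A\<rfloor> \<le> \<lfloor>B\<rfloor>" using empty by (simp add: floor_mono)
  ultimately show ?case by (simp, linarith)
next
  case (insert p P)
  define Z where "Z = (\<Prod>p\<in>P. 1 - 1 / real p)"
  have p_pos: "real p > 0" using insert.prems(1)[of p] prime_gt_0_nat by simp
  have "\<bar>real (card (sifted_interval P A B)) - (B - A) * Z\<bar> \<le> 2 ^ card P"
    unfolding Z_def using insert.prems by (intro insert.IH) auto
  moreover have "\<bar>real (card (sifted_interval P (A / p) (B / p))) - (B / p - A / p) * Z\<bar> \<le>
      2 ^ card P"
    unfolding Z_def using insert.prems p_pos by (intro insert.IH) (auto simp: divide_right_mono)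
  moreover have "real (card (sifted_interval (insert p P) A B)) - (B - A) * ((1 - 1 / p) * Z) =
      (real (card (sifted_interval P A B)) - (B - A) * Z) -
      (real (card (sifted_interval P (A / p) (B / p))) - (B / p - A / p) * Z)"
    using card_sifted_interval_insert[of p P A B] insert
    by (simp add: algebra_simps diff_divide_distrib)
  ultimately have "\<bar>real (card (sifted_interval (insert p P) A B)) -
      (B - A) * ((1 - 1 / p) * Z)\<bar> \<le> 2 * 2 ^ card P"
    by linarith
  thus ?case using insert by (simp add: Z_def)
qed

lemma coprime_iff_no_prime_factor:
  fixes j n :: nat
  assumes "n > 0"
  shows "coprime j n \<longleftrightarrow> (\<forall>p\<in>prime_factors n. \<not> p dvd j)"
proof
  assume "coprime j n"
  thus "\<forall>p\<in>prime_factors n. \<not> p dvd j"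
    by (metis coprime_common_divisor in_prime_factors_iff not_prime_unit)
next
  assume no_factor: "\<forall>p\<in>prime_factors n. \<not> p dvd j"
  show "coprime j n"
  proof (rule ccontr)
    assume "\<not> coprime j n"
    hence "gcd j n \<noteq> 1" by (metis coprime_iff_gcd_eq_1)
    then obtain p where "prime p" "p dvd gcd j n" using prime_factor_nat by blast
    thus False using no_factor assms by (auto simp: prime_factors_dvd)
  qed
qed

definition grid_block :: "nat \<Rightarrow> nat \<Rightarrow> nat \<Rightarrow> nat" where
  "grid_block m N j = nat \<lceil>real j * real N / real m\<rceil>"

lemma grid_block_mem:
  assumes "j \<in> totatives m" "N > 0"
  shows "grid_block m N j \<in> {0<..N}"
proof -
  have "0 < real j * real N / real m" and "real j * real N / real m \<le> real N"
    using assms by (auto simp: in_totatives_iff pos_divide_le_eq mult.commute)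
  thus ?thesis by (auto simp: grid_block_def nat_le_iff ceiling_le_iff)
qed

lemma grid_block_dist_le:
  assumes "m > 0" "N > 0"
  shows "\<bar>real j / real m - real (grid_block m N j) / real N\<bar> \<le> 1 / real N"
proof -
  define x where "x = real j * real N / real m"
  have "\<bar>x - real (grid_block m N j)\<bar> \<le> 1"
    unfolding grid_block_def x_def[symmetric] by (simp add: x_def) linarith
  moreover have "real j / real m = x / real N" using assms by (simp add: x_def)
  ultimately show ?thesis
    using assms(2) by (simp add: diff_divide_distrib[symmetric] abs_divide divide_right_mono)
qed

lemma grid_block_eq_iff:
  assumes "m > 0" "i \<in> {0<..N}"
  shows "grid_block m N j = i \<longleftrightarrow>
      (real i - 1) * real m / real N < real j \<and> real j \<le> real i * real m / real N"
proof -
  have "grid_block m N j = i \<longleftrightarrow> \<lceil>real j * real N / real m\<rceil> = int i"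
    using assms(2) by (auto simp: grid_block_def)
  also have "\<dots> \<longleftrightarrow> (real i - 1) * real m / real N < real j \<and> real j \<le> real i * real m / real N"
    using assms by (simp add: ceiling_eq_iff field_simps)
  finally show ?thesis .
qed

lemma sifted_interval_eq_totatives_block:
  assumes m_pos: "m > 0" and i_mem: "i \<in> {0<..N}"
  shows
    "sifted_interval (prime_factors m) ((real i - 1) * real m / real N) (real i * real m / real N) =
      int ` {j\<in>totatives m. grid_block m N j = i}"
proof -
  let ?A = "(real i - 1) * real m / real N" and ?B = "real i * real m / real N"
  have "?A \<ge> 0" using i_mem by simp
  have "?B \<le> real m" using i_mem by (simp add: pos_divide_le_eq mult.commute mult_right_mono)
  show ?thesis
  proof (intro equalityI subsetI)
    fix j assume j_mem: "j \<in> sifted_interval (prime_factors m) ?A ?B"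
    hence "0 < real_of_int j"
      using \<open>?A \<ge> 0\<close> unfolding sifted_interval_def by (auto intro: le_less_trans)
    then obtain k where "k > 0" "j = int k" by (auto dest: zero_less_imp_eq_int)
    thus "j \<in> int ` {j\<in>totatives m. grid_block m N j = i}"
      using j_mem \<open>?B \<le> real m\<close> m_pos unfolding grid_block_eq_iff[OF m_pos i_mem]
      by (auto simp: sifted_interval_def in_totatives_iff coprime_iff_no_prime_factor)
  next
    fix j assume "j \<in> int ` {j\<in>totatives m. grid_block m N j = i}"
    thus "j \<in> sifted_interval (prime_factors m) ?A ?B"
      using m_pos unfolding grid_block_eq_iff[OF m_pos i_mem]
      by (auto simp: sifted_interval_def in_totatives_iff coprime_iff_no_prime_factor)
  qed
qed

lemma card_totatives_block:
  assumes m_pos: "m > 0" and i_mem: "i \<in> {0<..N}"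
  shows "\<bar>real (card {j\<in>totatives m. grid_block m N j = i}) - real (totient m) / real N\<bar> \<le>
      real (divisor_count m)"
proof -
  let ?A = "(real i - 1) * real m / real N" and ?B = "real i * real m / real N"
  have "real (card {j\<in>totatives m. grid_block m N j = i}) =
      real (card (sifted_interval (prime_factors m) ?A ?B))"
    by (simp add: sifted_interval_eq_totatives_block[OF m_pos i_mem] card_image)
  moreover have "real (totient m) / real N = (?B - ?A) * (\<Prod>p\<in>prime_factors m. 1 - 1 / real p)"
    using i_mem by (simp add: totient_formula2 field_simps)
  moreover have "?A \<le> ?B" by (intro divide_right_mono mult_right_mono) auto
  ultimately have "\<bar>real (card {j\<in>totatives m. grid_block m N j = i}) - real (totient m) / real N\<bar>
      \<le> 2 ^ card (prime_factors m)"
    using card_sifted_interval[of "prime_factors m" ?A ?B] by (simp add: in_prime_factors_iff)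
  also have "\<dots> = real (2 ^ card (prime_factors m))" by simp
  also have "\<dots> \<le> real (divisor_count m)"
    using two_power_le_divisor_count[OF m_pos] by (simp only: of_nat_le_iff)
  finally show ?thesis .
qed

lemma sum_grid_block_error_le:
  fixes F :: "real \<Rightarrow> real"
  assumes bound: "\<And>t. \<bar>F t\<bar> \<le> M" and m_pos: "m > 0" and N_pos: "N > 0"
  shows "\<bar>(\<Sum>j\<in>totatives m. F (real (grid_block m N j) / real N)) -
      real (totient m) * ((\<Sum>i\<in>{0<..N}. F (real i / real N)) / real N)\<bar> \<le>
          real N * real (divisor_count m) * M"
proof -
  define w where "w = real (totient m) / real N"
  define count where "count = (\<lambda>i. real (card {j\<in>totatives m. grid_block m N j = i}))"
  have "(\<Sum>j\<in>totatives m. F (real (grid_block m N j) / real N)) =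
      (\<Sum>i\<in>{0<..N}. \<Sum>j | j \<in> totatives m \<and> grid_block m N j = i.
        F (real (grid_block m N j) / real N))"
    using grid_block_mem[OF _ N_pos] by (intro sum.group[symmetric]) auto
  also have "\<dots> = (\<Sum>i\<in>{0<..N}. count i * F (real i / real N))"
    unfolding count_def by (intro sum.cong refl) simp
  finally have "(\<Sum>j\<in>totatives m. F (real (grid_block m N j) / real N)) -
      real (totient m) * ((\<Sum>i\<in>{0<..N}. F (real i / real N)) / real N) =
      (\<Sum>i\<in>{0<..N}. (count i - w) * F (real i / real N))"
    by (simp add: w_def left_diff_distrib sum_subtractf sum_distrib_left sum_divide_distrib)
  also have "\<bar>\<dots>\<bar> \<le> (\<Sum>i\<in>{0<..N}. real (divisor_count m) * M)"
    unfolding count_def w_def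
    using card_totatives_block[OF m_pos] bound order_trans[OF abs_ge_zero bound]
    by (intro order_trans[OF sum_abs] sum_mono) (auto simp: abs_mult intro!: mult_mono)
  finally show ?thesis by simp
qed

lemma sum_totatives_error_le:
  fixes F :: "real \<Rightarrow> real"
  assumes F_bounded: "F \<in> borel_measurable borel" "\<And>t. \<bar>F t\<bar> \<le> M" and m_pos: "m > 0"
    and N_pos: "N > 0"
    and osc: "\<And>t t'. \<bar>t - t'\<bar> \<le> 1 / real N \<Longrightarrow> \<bar>F t - F t'\<bar> \<le> e"
  shows "\<bar>(\<Sum>j\<in>totatives m. F (real j / real m)) - real (totient m) * (LINT t:{0<..1}|lborel. F t)\<bar>
           \<le> 2 * e * real (totient m) + real N * real (divisor_count m) * M"
proof -
  define w where "w = real (totient m)"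
  define S where "S = (\<Sum>i\<in>{0<..N}. F (real i / real N)) / real N"
  have "\<bar>\<Sum>j\<in>totatives m. F (real j / real m) - F (real (grid_block m N j) / real N)\<bar> \<le>
      (\<Sum>j\<in>totatives m. e)"
    by (intro order_trans[OF sum_abs] sum_mono osc grid_block_dist_le m_pos N_pos)
  hence to_grid: "\<bar>(\<Sum>j\<in>totatives m. F (real j / real m)) -
      (\<Sum>j\<in>totatives m. F (real (grid_block m N j) / real N))\<bar> \<le> w * e"
    by (simp add: sum_subtractf w_def totient_def)
  have "\<bar>(LINT t:{0<..1}|lborel. F t) - S\<bar> \<le> e"
    unfolding S_def by (rule riemann_sum_error_le[OF F_bounded N_pos osc])
  hence "w * \<bar>(LINT t:{0<..1}|lborel. F t) - S\<bar> \<le> w * e"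
    by (intro mult_left_mono) (simp_all add: w_def)
  hence "\<bar>w * (LINT t:{0<..1}|lborel. F t) - w * S\<bar> \<le> w * e"
    unfolding right_diff_distrib[symmetric] abs_mult by (simp add: w_def)
  with to_grid sum_grid_block_error_le[of F M m N, OF F_bounded(2) m_pos N_pos] show ?thesis
    by (simp add: w_def[symmetric] S_def[symmetric] algebra_simps)
qed

subsection \<open>Sums over residue classes\<close>

lemma pos_residue_unique:
  fixes i j m :: nat
  assumes "i \<in> {0<..m}" "j \<in> {0<..m}" "[int i = int j] (mod int m)"
  shows "i = j"
proof -
  have "int m dvd int i - int j" using assms(3) by (simp only: cong_iff_dvd_diff)
  moreover have "\<bar>int i - int j\<bar> < \<bar>int m\<bar>" using assms(1,2) by auto
  ultimately have "int i - int j = 0" by (metis dvd_imp_le_int not_less)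
  thus ?thesis by simp
qed

lemma exists_pos_residue:
  assumes "m > 0"
  obtains i where "i \<in> {0<..m}" "[x = int i] (mod int m)"
proof
  let ?i = "nat ((x - 1) mod int m) + 1"
  have int_residue: "int ?i = (x - 1) mod int m + 1" using assms by simp
  show "?i \<in> {0<..m}"
    using assms pos_mod_bound[of "int m" "x - 1"] by (simp add: nat_less_iff Suc_le_eq)
  have "[int ?i = (x - 1) + 1] (mod int m)"
    unfolding int_residue by (intro cong_add) (simp_all add: cong_def)
  thus "[x = int ?i] (mod int m)" by (simp add: cong_sym)
qed

lemma sum_periodic_reindex:
  fixes h :: "int \<Rightarrow> real" and T :: "nat \<Rightarrow> int"
  assumes residues: "A \<subseteq> {0<..m}"
    and periodic: "\<And>k l. [k = l] (mod int m) \<Longrightarrow> h k = h l"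
    and maps: "\<And>j. j \<in> A \<Longrightarrow> \<exists>i\<in>A. [T j = int i] (mod int m)"
    and inj: "\<And>i j. i \<in> A \<Longrightarrow> j \<in> A \<Longrightarrow> [T i = T j] (mod int m) \<Longrightarrow> i = j"
  shows "(\<Sum>j\<in>A. h (T j)) = (\<Sum>j\<in>A. h (int j))"
proof -
  obtain S where residue: "\<And>j. j \<in> A \<Longrightarrow> S j \<in> A \<and> [T j = int (S j)] (mod int m)"
    using maps by metis
  have "inj_on S A"
  proof (rule inj_onI)
    fix i j assume same_residue: "i \<in> A" "j \<in> A" "S i = S j"
    hence "[T i = T j] (mod int m)" using residue cong_sym cong_trans by metis
    thus "i = j" using same_residue by (intro inj)
  qed
  moreover have "S ` A \<subseteq> A" using residue by blast
  moreover have "finite A" using residues by (rule finite_subset) simp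
  ultimately have "bij_betw S A A" by (simp add: bij_betw_def endo_inj_surj)
  have "(\<Sum>j\<in>A. h (T j)) = (\<Sum>j\<in>A. h (int (S j)))"
    using residue by (intro sum.cong refl periodic) auto
  also have "\<dots> = (\<Sum>j\<in>A. h (int j))"
    by (rule sum.reindex_bij_betw[OF \<open>bij_betw S A A\<close>])
  finally show ?thesis .
qed

lemma sum_totatives_inverse:
  fixes h :: "int \<Rightarrow> real"
  assumes m_pos: "m > 0" and u_coprime: "coprime u (int m)"
    and periodic: "\<And>k l. [k = l] (mod int m) \<Longrightarrow> h k = h l"
  shows "(\<Sum>j\<in>totatives m. h (u * modular_inverse (int m) (int j))) = (\<Sum>j\<in>totatives m. h (int j))"
proof (rule sum_periodic_reindex)
  let ?inv = "\<lambda>j. modular_inverse (int m) (int j)"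
  have coprime: "coprime (int j) (int m)" if "j \<in> totatives m" for j
    using that by (simp add: in_totatives_iff)
  fix j assume j_mem: "j \<in> totatives m"
  obtain i where residue: "i \<in> {0<..m}" "[u * ?inv j = int i] (mod int m)"
    using exists_pos_residue[OF m_pos] by blast
  have "coprime (u * ?inv j) (int m)" using u_coprime coprime[OF j_mem] by simp
  hence "coprime (int i) (int m)" by (rule cong_imp_coprime[OF residue(2)])
  thus "\<exists>i\<in>totatives m. [u * ?inv j = int i] (mod int m)"
    using residue by (auto simp: in_totatives_iff)
  fix i assume i_mem: "i \<in> totatives m" and "[u * ?inv i = u * ?inv j] (mod int m)"
  hence "[?inv i = ?inv j] (mod int m)" using u_coprime by (simp add: cong_mult_lcancel)
  hence "[int j * (?inv i * int i) = int i * (?inv j * int j)] (mod int m)"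
    using cong_scalar_left[of "?inv i" "?inv j" "int m" "int i * int j"] by (simp add: mult_ac)
  moreover have "[int j * (?inv i * int i) = int j * 1] (mod int m)"
    "[int i * (?inv j * int j) = int i * 1] (mod int m)"
    by (intro cong_scalar_left cong_modular_inverse2 coprime i_mem j_mem)+
  ultimately have "[int i = int j] (mod int m)" by (metis cong_sym cong_trans mult.right_neutral)
  thus "i = j" using i_mem j_mem by (intro pos_residue_unique) (auto simp: in_totatives_iff)
next
  show "totatives m \<subseteq> {0<..m}" by (rule totatives_subset)
qed (rule periodic)

lemma sum_residues_zero_to_modulus:
  fixes h :: "nat \<Rightarrow> real"
  assumes m_pos: "m > 0" and h_periodic: "h 0 = h m" and P_periodic: "P 0 \<longleftrightarrow> P m"
  shows "(\<Sum>j | j < m \<and> P j. h j) = (\<Sum>j | j \<in> {0<..m} \<and> P j. h j)"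
  by (rule sum.reindex_bij_witness[where i = "\<lambda>j. if j = m then 0 else j"
    and j = "\<lambda>j. if j = 0 then m else j"])
     (use m_pos h_periodic P_periodic in auto)

lemma sum_by_gcd:
  fixes g :: "nat \<Rightarrow> real"
  assumes n_pos: "n > 0"
  shows "(\<Sum>a\<in>{0<..n}. g a) = (\<Sum>d | d dvd n. \<Sum>k\<in>totatives (n div d). g (k * d))"
proof -
  have "(\<Sum>a\<in>{0<..n}. g a) = (\<Sum>d | d dvd n. \<Sum>a | a \<in> {0<..n} \<and> gcd a n = d. g a)"
    using n_pos by (intro sum.group[symmetric]) auto
  also have "\<dots> = (\<Sum>d | d dvd n. \<Sum>k\<in>totatives (n div d). g (k * d))"
    using n_pos
    by (intro sum.cong refl sum.reindex_bij_betw[symmetric] bij_betw_totatives_gcd_eq) auto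
  finally show ?thesis .
qed

lemma sum_gcd_decomposition:
  fixes G :: "nat \<Rightarrow> nat \<Rightarrow> real"
  assumes fin: "finite C" and pos: "\<And>c. c \<in> C \<Longrightarrow> c > 0"
    and dvd_closed: "\<And>c d. c \<in> C \<Longrightarrow> d dvd c \<Longrightarrow> d \<in> C"
  shows "(\<Sum>c\<in>C. \<Sum>a\<in>{0<..c}. G c a) = (\<Sum>d\<in>C. \<Sum>c | d * c \<in> C. \<Sum>a\<in>totatives c. G (d * c) (a * d))"
proof -
  have "(\<Sum>c\<in>C. \<Sum>a\<in>{0<..c}. G c a) =
      (\<Sum>c\<in>C. \<Sum>d | d \<in> C \<and> d dvd c. \<Sum>k\<in>totatives (c div d). G c (k * d))"
  proof (rule sum.cong[OF refl])
    fix c assume c_mem: "c \<in> C"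
    hence "{d. d dvd c} = {d \<in> C. d dvd c}" using dvd_closed by blast
    thus "(\<Sum>a\<in>{0<..c}. G c a) = (\<Sum>d | d \<in> C \<and> d dvd c. \<Sum>k\<in>totatives (c div d). G c (k * d))"
      using sum_by_gcd[OF pos[OF c_mem], of "G c"] by simp
  qed
  also have "\<dots> = (\<Sum>d\<in>C. \<Sum>c | c \<in> C \<and> d dvd c. \<Sum>k\<in>totatives (c div d). G c (k * d))"
    by (rule sum.swap_restrict[OF fin fin])
  also have "\<dots> = (\<Sum>d\<in>C. \<Sum>c | d * c \<in> C. \<Sum>a\<in>totatives c. G (d * c) (a * d))"
  proof (rule sum.cong[OF refl])
    fix d assume "d \<in> C"
    hence "d > 0" by (rule pos)
    thus "(\<Sum>c | c \<in> C \<and> d dvd c. \<Sum>k\<in>totatives (c div d). G c (k * d)) =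
        (\<Sum>c | d * c \<in> C. \<Sum>a\<in>totatives c. G (d * c) (a * d))"
      by (rule_tac sum.reindex_bij_witness[where i = "\<lambda>c. d * c" and j = "\<lambda>c. c div d"]) auto
  qed
  finally show ?thesis .
qed

lemma coprime_period_eq_image:
  "{D. k * int c < D \<and> D \<le> (k + 1) * int c \<and> coprime D (int c)} =
      (\<lambda>d. int d + k * int c) ` totatives c"
proof -
  have coprime_shift: "coprime (D + k * int c) (int c) \<longleftrightarrow> coprime D (int c)" for D k
    by (metis add.commute coprime_commute coprime_iff_gcd_eq_1 gcd_add_mult)
  show ?thesis
  proof (intro equalityI subsetI)
    fix D assume D_mem: "D \<in> {D. k * int c < D \<and> D \<le> (k + 1) * int c \<and> coprime D (int c)}"
    define d where "d = nat (D - k * int c)"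
    have d_bounds: "int d = D - k * int c" "0 < d" "d \<le> c"
      using D_mem by (auto simp: d_def distrib_right)
    hence "coprime (int d) (int c)" using D_mem coprime_shift[of D "- k"] by simp
    hence "coprime d c" by (simp only: coprime_int_iff)
    thus "D \<in> (\<lambda>d. int d + k * int c) ` totatives c"
      using d_bounds by (intro image_eqI[of _ _ d]) (auto simp: in_totatives_iff)
  qed (auto simp: in_totatives_iff coprime_shift distrib_right)
qed

lemma sum_coprime_periods:
  fixes h :: "int \<Rightarrow> real" and c K :: nat
  shows "(\<Sum>D | (1 - int K) * int c < D \<and> D \<le> int c \<and> coprime D (int c). h D) =
    (\<Sum>k<K. \<Sum>d\<in>totatives c. h (int d - int k * int c))"
proof (induction K)
  case 0
  have empty: "{D. (1 - int 0) * int c < D \<and> D \<le> int c \<and> coprime D (int c)} = {}" by auto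
  show ?case unfolding empty by simp
next
  case (Suc K)
  let ?S = "\<lambda>a b. {D. a * int c < D \<and> D \<le> b * int c \<and> coprime D (int c)}"
  have split: "{D. x < D \<and> D \<le> z \<and> P D} = {D. x < D \<and> D \<le> y \<and> P D} \<union> {D. y < D \<and> D \<le> z \<and> P D}"
    if "x \<le> y" "y \<le> z" for x y z :: int and P
    using that by auto
  have finite: "finite (?S a b)" for a b
    by (rule finite_subset[of _ "{a * int c..b * int c}"]) auto
  have "- int K * int c \<le> (- int K + 1) * int c" "(- int K + 1) * int c \<le> 1 * int c"
    by (intro mult_right_mono; simp)+
  hence "?S (- int K) 1 = ?S (- int K) (- int K + 1) \<union> ?S (- int K + 1) 1" by (rule split)
  hence "sum h (?S (- int K) 1) = sum h (?S (- int K) (- int K + 1) \<union> ?S (- int K + 1) 1)"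
    by (rule arg_cong)
  also have "\<dots> = sum h (?S (- int K) (- int K + 1)) + sum h (?S (- int K + 1) 1)"
    by (intro sum.union_disjoint finite) auto
  also have "sum h (?S (- int K) (- int K + 1)) = (\<Sum>d\<in>totatives c. h (int d - int K * int c))"
    unfolding coprime_period_eq_image by (subst sum.reindex) (auto simp: inj_on_def)
  finally show ?case using Suc.IH by (simp add: add.commute)
qed

subsection \<open>Reduction to the fundamental domain\<close>

text \<open>The union of the integer translates of the standard fundamental domain. Its boundary is
  where the distance to the integers is exactly 1, so \<^term>\<open>infdist\<close> makes continuity off the
  boundary immediate.\<close>
definition cusp_region :: "complex set" where
  "cusp_region = {w. Im w > 0 \<and> infdist w \<int> \<ge> 1}"

definition cusp_part :: "(complex \<Rightarrow> real) \<Rightarrow> complex \<Rightarrow> real" where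
  "cusp_part f w = (if w \<in> cusp_region then f w else 0)"

lemma mem_cusp_region: "w \<in> cusp_region \<longleftrightarrow> Im w > 0 \<and> (\<forall>n::int. 1 \<le> cmod (w + of_int n))"
proof -
  have dist_eq: "dist w (of_int (- n)) = cmod (w + of_int n)" for n by (simp add: dist_norm)
  have "infdist w \<int> \<ge> 1 \<longleftrightarrow> (\<forall>n::int. 1 \<le> cmod (w + of_int n))"
  proof
    assume "infdist w \<int> \<ge> 1"
    moreover have "infdist w \<int> \<le> dist w (of_int (- n))" for n by (intro infdist_le) simp
    ultimately show "\<forall>n::int. 1 \<le> cmod (w + of_int n)"
      unfolding dist_eq by (blast intro: order_trans)
  next
    assume far: "\<forall>n::int. 1 \<le> cmod (w + of_int n)"
    have "(\<int> :: complex set) \<noteq> {}" using Ints_0 by blast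
    then obtain a where "a \<in> \<int>" "infdist w \<int> = dist w a"
      by (rule infdist_attains_inf[OF closed_Ints])
    then obtain n where "infdist w \<int> = dist w (of_int n)" by (auto elim: Ints_cases)
    thus "infdist w \<int> \<ge> 1" using far[rule_format, of "- n"] by (simp add: dist_norm)
  qed
  thus ?thesis by (auto simp: cusp_region_def)
qed

lemma cusp_region_add_int [simp]: "w + of_int n \<in> cusp_region \<longleftrightarrow> w \<in> cusp_region"
proof -
  have "w + of_int n \<in> cusp_region" if "w \<in> cusp_region" for w n
    unfolding mem_cusp_region
  proof (intro conjI allI)
    show "Im (w + of_int n) > 0" using that by (simp add: mem_cusp_region)
    have "1 \<le> cmod (w + of_int (n + m))" for m using that unfolding mem_cusp_region by blast
    thus "1 \<le> cmod (w + of_int n + of_int m)" for m by (simp add: add.assoc)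
  qed
  from this[of w n] this[of "w + of_int n" "-n"] show ?thesis by auto
qed

lemma cusp_region_Im_gt:
  assumes "w \<in> cusp_region"
  shows "Im w > 4/5"
proof (rule ccontr)
  assume "\<not> Im w > 4/5"
  moreover have "Im w > 0" using assms by (simp add: mem_cusp_region)
  ultimately have "(Im w)\<^sup>2 \<le> (4/5)\<^sup>2" by (intro power_mono) auto
  define n where "n = round (Re w)"
  have "1 \<le> cmod (w + of_int (- n))" using assms by (simp only: mem_cusp_region)
  hence "1 \<le> (cmod (w + of_int (- n)))\<^sup>2" by (simp only: one_le_power)
  also have "\<dots> = (Re w - of_int n)\<^sup>2 + (Im w)\<^sup>2" by (simp add: cmod_power2)
  also have "\<bar>Re w - of_int n\<bar> \<le> 1/2"
    using of_int_round_abs_le[of "Re w"] by (simp add: n_def abs_minus_commute)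
  hence "(Re w - of_int n)\<^sup>2 \<le> (1/2)\<^sup>2" by (rule power2_le_iff_abs_le[THEN iffD2, rotated]) simp
  finally show False using \<open>(Im w)\<^sup>2 \<le> (4/5)\<^sup>2\<close> by (simp add: power2_eq_square)
qed

lemma cusp_region_norm_ge:
  fixes e g :: int
  assumes region: "w \<in> cusp_region" and nonzero: "(e, g) \<noteq> (0, 0)"
  shows "1 \<le> cmod (of_int e * w + of_int g)"
proof -
  consider "e = 0" | "e = 1" | "e = -1" | "\<bar>e\<bar> \<ge> 2" by linarith
  thus ?thesis
  proof cases
    assume "e = 0"
    thus ?thesis using nonzero by auto
  next
    assume "e = 1"
    thus ?thesis using region by (simp add: mem_cusp_region)
  next
    assume "e = -1"
    have "1 \<le> cmod (w + of_int (-g))" using region by (simp only: mem_cusp_region)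
    also have "\<dots> = cmod (of_int e * w + of_int g)"
      using \<open>e = -1\<close> norm_minus_cancel[of "w - of_int g"] by simp
    finally show ?thesis .
  next
    assume "\<bar>e\<bar> \<ge> 2"
    hence "real_of_int \<bar>e\<bar> \<ge> 2" by linarith
    hence "2 * (4/5) \<le> \<bar>real_of_int e\<bar> * Im w"
      using cusp_region_Im_gt[OF region] by (intro mult_mono) auto
    also have "\<dots> = \<bar>Im (of_int e * w + of_int g)\<bar>"
      using cusp_region_Im_gt[OF region] by (simp add: abs_mult)
    also have "\<dots> \<le> cmod (of_int e * w + of_int g)" by (rule abs_Im_le_cmod)
    finally show ?thesis by simp
  qed
qed

lemma sl2_denominator_nonzero:
  fixes c d :: int
  assumes "Im z > 0" "(c, d) \<noteq> (0, 0)"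
  shows "of_int c * z + of_int d \<noteq> 0"
proof
  assume "of_int c * z + of_int d = 0"
  hence "Im (of_int c * z + of_int d) = 0" "Re (of_int c * z + of_int d) = 0" by simp_all
  thus False using assms by auto
qed

lemma sl2_act_denominator_nonzero:
  assumes "a * d - b * c = 1" "Im z > 0"
  shows "of_int c * z + of_int d \<noteq> 0"
  using assms by (intro sl2_denominator_nonzero) auto

lemma Im_sl2_act:
  assumes "a * d - b * c = 1"
  shows "Im (sl2_act a b c d z) = Im z / (cmod (of_int c * z + of_int d))\<^sup>2"
proof -
  have "real_of_int (a * d - b * c) = 1" using assms by simp
  moreover have "Im (sl2_act a b c d z) =
      real_of_int (a * d - b * c) * Im z / (cmod (of_int c * z + of_int d))\<^sup>2"
    unfolding sl2_act_def by (simp add: Im_divide cmod_power2 algebra_simps)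
  ultimately show ?thesis by (simp only: mult_1)
qed

lemma Im_sl2_act_pos:
  assumes "a * d - b * c = 1" "Im z > 0"
  shows "Im (sl2_act a b c d z) > 0"
  using assms sl2_act_denominator_nonzero[OF assms] by (simp add: Im_sl2_act)

lemma sl2_act_diff:
  assumes det: "a * d - b * c = 1"
    and nonzero: "of_int c * z + of_int d \<noteq> 0" "of_int c * z' + of_int d \<noteq> 0"
  shows "sl2_act a b c d z - sl2_act a b c d z' =
      (z - z') / ((of_int c * z + of_int d) * (of_int c * z' + of_int d))"
proof -
  have "complex_of_int (a * d - b * c) = 1" using det by simp
  moreover have "sl2_act a b c d z - sl2_act a b c d z' =
      complex_of_int (a * d - b * c) * (z - z') /
        ((of_int c * z + of_int d) * (of_int c * z' + of_int d))"
    unfolding sl2_act_def diff_frac_eq[OF nonzero] by (simp add: algebra_simps)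
  ultimately show ?thesis by (simp only: mult_1)
qed

lemma sl2_act_dist_le:
  assumes det: "a * d - b * c = 1" and Im_pos: "Im z > 0" "Im z' > 0"
    and close: "cmod (z - z') \<le> \<delta> * Im z" and \<delta>_le: "\<delta> \<le> 1/2"
  shows "cmod (sl2_act a b c d z - sl2_act a b c d z') \<le> 2 * \<delta> * Im (sl2_act a b c d z)"
proof -
  define D D' where "D = of_int c * z + of_int d" and "D' = of_int c * z' + of_int d"
  have nonzero: "D \<noteq> 0" "D' \<noteq> 0"
    unfolding D_def D'_def using sl2_act_denominator_nonzero[OF det] Im_pos by auto
  have half: "\<delta> * Im z \<le> 1/2 * Im z" using \<delta>_le Im_pos by (intro mult_right_mono) auto
  have "cmod (D - D') = \<bar>real_of_int c\<bar> * cmod (z - z')"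
    by (simp add: D_def D'_def norm_mult flip: right_diff_distrib)
  also have "\<dots> \<le> \<bar>real_of_int c\<bar> * (1/2 * Im z)"
    using order_trans[OF close half] by (rule mult_left_mono) simp
  also have "\<dots> = \<bar>Im D\<bar> / 2" using Im_pos by (simp add: D_def abs_mult)
  also have "\<dots> \<le> cmod D / 2" using abs_Im_le_cmod[of D] by simp
  finally have D'_ge: "cmod D / 2 \<le> cmod D'" using norm_triangle_ineq2[of D "D - D'"] by simp
  have "cmod (sl2_act a b c d z - sl2_act a b c d z') = cmod (z - z') / (cmod D * cmod D')"
    using sl2_act_diff[OF det, of z z'] nonzero by (simp add: D_def D'_def norm_divide norm_mult)
  also have "\<dots> \<le> (\<delta> * Im z) / (cmod D * (cmod D / 2))"
    using close order_trans[OF norm_ge_zero close] D'_ge nonzero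
    by (intro frac_le mult_left_mono) auto
  also have "\<dots> = 2 * \<delta> * Im (sl2_act a b c d z)"
    by (simp add: Im_sl2_act[OF det] D_def power2_eq_square)
  finally show ?thesis .
qed

lemma cusp_region_minimal:
  assumes det: "a * d - b * c = 1" and Im_pos: "Im z > 0"
    and region: "sl2_act a b c d z \<in> cusp_region"
    and nonzero: "(c', d') \<noteq> (0, 0)"
  shows "cmod (of_int c * z + of_int d) \<le> cmod (of_int c' * z + of_int d')"
proof -
  define e where "e = c' * d - d' * c"
  define g where "g = d' * a - c' * b"
  have "e * a + g * c = c' * (a * d - b * c)" "e * b + g * d = d' * (a * d - b * c)"
    by (simp_all add: e_def g_def algebra_simps)
  hence row_eq: "c' = e * a + g * c" "d' = e * b + g * d" by (simp_all add: det)
  have "of_int c' * z + of_int d' =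
      of_int e * (of_int a * z + of_int b) + of_int g * (of_int c * z + of_int d)"
    unfolding row_eq by (simp add: algebra_simps)
  also have "\<dots> = (of_int e * sl2_act a b c d z + of_int g) * (of_int c * z + of_int d)"
    using sl2_act_denominator_nonzero[OF det Im_pos] by (simp add: sl2_act_def distrib_right)
  finally have "cmod (of_int c' * z + of_int d') =
      cmod (of_int e * sl2_act a b c d z + of_int g) * cmod (of_int c * z + of_int d)"
        by (simp add: norm_mult)
  moreover have "1 \<le> cmod (of_int e * sl2_act a b c d z + of_int g)"
    using nonzero row_eq by (intro cusp_region_norm_ge region) auto
  ultimately show ?thesis by (simp add: mult_le_cancel_right1)
qed

lemma finite_small_denominators:
  assumes Im_pos: "Im z > 0"
  shows "finite {(c::int, d::int). cmod (of_int c * z + of_int d) \<le> r}"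
proof -
  define m where "m = \<lceil>r / Im z\<rceil>"
  define m' where "m' = \<lceil>r + real_of_int m * cmod z\<rceil>"
  have "(c, d) \<in> {-m..m} \<times> {-m'..m'}"
    if small: "cmod (of_int c * z + of_int d) \<le> r" for c d :: int
  proof -
    have "\<bar>real_of_int c\<bar> * Im z \<le> r"
      using abs_Im_le_cmod[of "of_int c * z + of_int d"] small Im_pos by (simp add: abs_mult)
    hence "\<bar>real_of_int c\<bar> \<le> r / Im z" using Im_pos by (simp add: field_simps)
    hence c_le: "\<bar>real_of_int c\<bar> \<le> real_of_int m" unfolding m_def by linarith
    have "\<bar>real_of_int d\<bar> = cmod ((of_int c * z + of_int d) - of_int c * z)" by simp
    also have "\<dots> \<le> cmod (of_int c * z + of_int d) + cmod (of_int c * z)"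
      by (rule norm_triangle_ineq4)
    also have "\<dots> \<le> r + real_of_int m * cmod z"
      using small c_le by (auto simp: norm_mult intro!: add_mono mult_right_mono)
    finally have "\<bar>real_of_int d\<bar> \<le> real_of_int m'" unfolding m'_def by linarith
    moreover have "\<bar>c\<bar> \<le> m" using c_le by linarith
    ultimately have "\<bar>c\<bar> \<le> m" "\<bar>d\<bar> \<le> m'" by linarith+
    thus ?thesis by auto
  qed
  hence "{(c, d). cmod (of_int c * z + of_int d) \<le> r} \<subseteq> {-m..m} \<times> {-m'..m'}" by blast
  thus ?thesis by (rule finite_subset) simp
qed

lemma exists_minimal_denominator:
  assumes Im_pos: "Im z > 0"
  obtains c d :: int where "coprime c d"
    "\<And>c' d'. coprime c' d' \<Longrightarrow> cmod (of_int c * z + of_int d) \<le> cmod (of_int c' * z + of_int d')"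
proof -
  define F where "F = (\<lambda>(c::int, d::int). cmod (of_int c * z + of_int d))"
  define S where "S = {(c, d). coprime c d \<and> F (c, d) \<le> 1}"
  have "finite S"
    by (rule finite_subset[OF _ finite_small_denominators[OF Im_pos, of 1]])
      (auto simp: S_def F_def)
  moreover have "(0, 1) \<in> S" by (simp add: S_def F_def)
  ultimately obtain x where minimizer: "x \<in> S" "\<And>x'. x' \<in> S \<Longrightarrow> F x \<le> F x'"
    by (metis arg_min_if_finite empty_iff not_less)
  obtain c d where x_eq: "x = (c, d)" by force
  show thesis
  proof (rule that)
    show "coprime c d" using minimizer(1) by (simp add: x_eq S_def)
    fix c' d' :: int assume "coprime c' d'"
    show "cmod (of_int c * z + of_int d) \<le> cmod (of_int c' * z + of_int d')"
    proof (cases "(c', d') \<in> S")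
      case True
      from minimizer(2)[OF this] show ?thesis by (simp add: F_def x_eq)
    next
      case False
      thus ?thesis using minimizer(1) \<open>coprime c' d'\<close> by (simp add: x_eq S_def F_def)
    qed
  qed
qed

lemma exists_act_in_cusp_region:
  assumes Im_pos: "Im z > 0"
  obtains a b c d where "a * d - b * c = 1" "sl2_act a b c d z \<in> cusp_region"
proof -
  obtain c d :: int where coprime_row: "coprime c d"
    and min: "\<And>c' d'. coprime c' d' \<Longrightarrow>
        cmod (of_int c * z + of_int d) \<le> cmod (of_int c' * z + of_int d')"
    using exists_minimal_denominator[OF Im_pos] by blast
  obtain u v where "u * c + v * d = 1" using coprime_row bezout_int[of c d] by auto
  hence det: "v * d - (-u) * c = 1" by simp
  define w where "w = sl2_act v (-u) c d z"
  have nonzero: "of_int c * z + of_int d \<noteq> 0" by (rule sl2_act_denominator_nonzero[OF det Im_pos])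
  have "1 \<le> cmod (w + of_int n)" for n :: int
  proof -
    have "coprime (v + n * c) (-u + n * d)"
    proof (rule coprimeI)
      fix l assume "l dvd v + n * c" "l dvd -u + n * d"
      hence "l dvd (v + n * c) * d - (-u + n * d) * c" by simp
      also have "\<dots> = 1" using det by (simp add: algebra_simps)
      finally show "is_unit l" .
    qed
    hence "cmod (of_int c * z + of_int d) \<le> cmod (of_int (v + n * c) * z + of_int (-u + n * d))"
      by (rule min)
    also have "of_int (v + n * c) * z + of_int (-u + n * d) =
        (w + of_int n) * (of_int c * z + of_int d)"
      using nonzero by (simp add: w_def sl2_act_def field_simps)
    finally show ?thesis using nonzero by (simp add: norm_mult mult_le_cancel_right1)
  qed
  hence "w \<in> cusp_region" using Im_sl2_act_pos[OF det Im_pos] by (simp add: mem_cusp_region w_def)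
  thus thesis using that[OF det] by (simp add: w_def)
qed

lemma exists_act_in_strip:
  assumes Im_pos: "Im z > 0"
  obtains a b c d where "a * d - b * c = 1" "sl2_act a b c d z \<in> cusp_region"
    "\<bar>Re (sl2_act a b c d z)\<bar> \<le> 1/2"
proof -
  obtain a b c d where det: "a * d - b * c = 1" and region: "sl2_act a b c d z \<in> cusp_region"
    by (rule exists_act_in_cusp_region[OF Im_pos])
  define n where "n = - round (Re (sl2_act a b c d z))"
  have translate: "sl2_act (a + n * c) (b + n * d) c d z = sl2_act a b c d z + of_int n"
    using sl2_act_denominator_nonzero[OF det Im_pos] by (simp add: sl2_act_def field_simps)
  show thesis
  proof (rule that[of "a + n * c" d "b + n * d" c])
    show "(a + n * c) * d - (b + n * d) * c = 1" using det by (simp add: algebra_simps)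
    show "sl2_act (a + n * c) (b + n * d) c d z \<in> cusp_region"
      using region by (simp add: translate)
    show "\<bar>Re (sl2_act (a + n * c) (b + n * d) c d z)\<bar> \<le> 1/2"
      unfolding translate using of_int_round_abs_le[of "Re (sl2_act a b c d z)"]
      by (simp add: n_def abs_minus_commute)
  qed
qed

subsection \<open>Functions on the modular surface\<close>

lemma Cc_modular_act: "f \<in> Cc_modular \<Longrightarrow> a * d - b * c = 1 \<Longrightarrow> Im z > 0 \<Longrightarrow>
    f (sl2_act a b c d z) = f z"
  by (auto simp: Cc_modular_def upper_half_def)

lemma Cc_modular_add_int: "f \<in> Cc_modular \<Longrightarrow> Im z > 0 \<Longrightarrow> f (z + of_int n) = f z"
  using Cc_modular_act[of f 1 1 n 0 z] by (simp add: sl2_act_def)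

lemma Cc_modular_Complex_add_int:
  assumes "f \<in> Cc_modular" "y > 0"
  shows "f (Complex (x + of_int n) y) = f (Complex x y)"
proof -
  have "Complex (x + of_int n) y = Complex x y + of_int n" by (simp add: complex_eq_iff)
  thus ?thesis using Cc_modular_add_int[OF assms(1), of "Complex x y" n] assms(2) by simp
qed

lemma Cc_modular_cutoff:
  assumes "f \<in> Cc_modular"
  obtains Y where "Y \<ge> 1" "\<And>z. Im z > Y \<Longrightarrow> f z = 0"
proof -
  obtain Y where "\<And>z. Im z > Y \<Longrightarrow> f z = 0" using assms by (auto simp: Cc_modular_def)
  thus thesis using that[of "max Y 1"] by auto
qed

lemma Cc_modular_continuous_on:
  assumes "f \<in> Cc_modular" "\<And>z. z \<in> S \<Longrightarrow> Im z > 0"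
  shows "continuous_on S f"
  using assms by (auto simp: Cc_modular_def upper_half_def intro: continuous_on_subset)

lemma Cc_modular_horocycle_measurable:
  assumes modular: "f \<in> Cc_modular" and y_pos: "y > 0"
  shows "(\<lambda>t. f (Complex (x + t) y)) \<in> borel_measurable borel"
proof (intro borel_measurable_continuous_onI
    continuous_on_compose2[of upper_half f UNIV "\<lambda>t. Complex (x + t) y"])
  show "continuous_on upper_half f" using modular by (simp add: Cc_modular_def)
  show "continuous_on UNIV (\<lambda>t. Complex (x + t) y)"
    unfolding Complex_eq by (intro continuous_intros)
qed (use y_pos in \<open>auto simp: upper_half_def\<close>)

lemma Cc_modular_bounded:
  assumes modular: "f \<in> Cc_modular"
  obtains M where "M > 0" "\<And>z. Im z > 0 \<Longrightarrow> \<bar>f z\<bar> \<le> M"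
proof -
  obtain Y where cutoff: "Y \<ge> 1" "\<And>z. Im z > Y \<Longrightarrow> f z = 0"
    using Cc_modular_cutoff[OF modular] by blast
  define C where "C = cbox (Complex (-1) (1/4)) (Complex 1 Y)"
  have "continuous_on C f"
    by (intro Cc_modular_continuous_on modular) (auto simp: C_def in_cbox_complex_iff)
  hence "bounded (f ` C)"
    unfolding C_def by (intro compact_imp_bounded compact_continuous_image compact_cbox)
  then obtain M where bound: "M > 0" "\<And>w. w \<in> C \<Longrightarrow> \<bar>f w\<bar> \<le> M" by (auto simp: bounded_pos)
  show thesis
  proof (rule that[OF bound(1)])
    fix z assume Im_pos: "Im z > 0"
    obtain a b c d where det: "a * d - b * c = 1" and region: "sl2_act a b c d z \<in> cusp_region"
      and strip: "\<bar>Re (sl2_act a b c d z)\<bar> \<le> 1/2"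
      by (rule exists_act_in_strip[OF Im_pos])
    have "\<bar>f (sl2_act a b c d z)\<bar> \<le> M"
    proof (cases "Im (sl2_act a b c d z) > Y")
      case True
      thus ?thesis using cutoff(2) bound(1) by simp
    next
      case False
      thus ?thesis using cusp_region_Im_gt[OF region] strip
        by (intro bound) (auto simp: C_def in_cbox_complex_iff)
    qed
    thus "\<bar>f z\<bar> \<le> M" using Cc_modular_act[OF modular det Im_pos] by simp
  qed
qed

lemma Cc_modular_uniformly_continuous_strip:
  assumes modular: "f \<in> Cc_modular"
  shows "uniformly_continuous_on {w. \<bar>Re w\<bar> \<le> 1 \<and> 1/4 \<le> Im w} f"
  unfolding uniformly_continuous_on_def
proof (intro allI impI)
  fix \<epsilon> :: real assume \<epsilon>_pos: "\<epsilon> > 0"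
  obtain Y where cutoff: "Y \<ge> 1" "\<And>z. Im z > Y \<Longrightarrow> f z = 0"
    using Cc_modular_cutoff[OF modular] by blast
  define C where "C = cbox (Complex (-1) (1/4)) (Complex 1 (Y + 1))"
  have "continuous_on C f"
    by (intro Cc_modular_continuous_on modular) (auto simp: C_def in_cbox_complex_iff)
  hence "uniformly_continuous_on C f"
    unfolding C_def by (intro compact_uniformly_continuous compact_cbox)
  then obtain \<delta> where modulus: "\<delta> > 0"
    "\<And>w w'. w \<in> C \<Longrightarrow> w' \<in> C \<Longrightarrow> dist w' w < \<delta> \<Longrightarrow> dist (f w') (f w) < \<epsilon>"
    unfolding uniformly_continuous_on_def using \<epsilon>_pos by metis
  have "dist (f w') (f w) < \<epsilon>"
    if in_strip: "\<bar>Re w\<bar> \<le> 1" "1/4 \<le> Im w" "\<bar>Re w'\<bar> \<le> 1" "1/4 \<le> Im w'"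
      and close: "dist w' w < min \<delta> 1" for w w'
  proof (cases "Im w \<le> Y + 1 \<and> Im w' \<le> Y + 1")
    case True
    thus ?thesis using in_strip close by (intro modulus(2)) (auto simp: C_def in_cbox_complex_iff)
  next
    case False
    have "\<bar>Im w' - Im w\<bar> < 1" using abs_Im_le_cmod[of "w' - w"] close by (simp add: dist_norm)
    hence "f w = 0" "f w' = 0" using False by (auto intro!: cutoff)
    thus ?thesis using \<epsilon>_pos by simp
  qed
  thus "\<exists>\<delta>>0. \<forall>w\<in>{w. \<bar>Re w\<bar> \<le> 1 \<and> 1/4 \<le> Im w}. \<forall>w'\<in>{w. \<bar>Re w\<bar> \<le> 1 \<and> 1/4 \<le> Im w}.
      dist w' w < \<delta> \<longrightarrow> dist (f w') (f w) < \<epsilon>"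
    using modulus(1) by (intro exI[of _ "min \<delta> 1"] conjI ballI impI) simp_all
qed

lemma Cc_modular_uniformly_continuous_relative:
  assumes modular: "f \<in> Cc_modular" and \<epsilon>_pos: "\<epsilon> > 0"
  obtains \<delta> where "0 < \<delta>" "\<delta> \<le> 1/16"
    "\<And>w w'. \<bar>Re w\<bar> \<le> 1/2 \<Longrightarrow> 4/5 < Im w \<Longrightarrow> cmod (w - w') \<le> 2 * \<delta> * Im w \<Longrightarrow> \<bar>f w - f w'\<bar> < \<epsilon>"
proof -
  obtain Y where cutoff: "Y \<ge> 1" "\<And>z. Im z > Y \<Longrightarrow> f z = 0"
    using Cc_modular_cutoff[OF modular] by blast
  obtain \<delta>' where modulus: "\<delta>' > 0" "\<And>w w'. \<bar>Re w\<bar> \<le> 1 \<Longrightarrow> 1/4 \<le> Im w \<Longrightarrow> \<bar>Re w'\<bar> \<le> 1 \<Longrightarrow> 1/4 \<le> Im w' \<Longrightarrow>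
      dist w' w < \<delta>' \<Longrightarrow> dist (f w') (f w) < \<epsilon>"
    using Cc_modular_uniformly_continuous_strip[OF modular] \<epsilon>_pos
    unfolding uniformly_continuous_on_def
    by (metis (no_types, lifting) mem_Collect_eq)
  define \<delta> where "\<delta> = min (1/16) (\<delta>' / 8) / Y"
  have \<delta>_bounds: "\<delta> > 0" "\<delta> * Y \<le> 1/16" "\<delta> * Y \<le> \<delta>' / 8"
    using cutoff(1) modulus(1) by (simp_all add: \<delta>_def)
  have "\<delta> * 1 \<le> \<delta> * Y" using cutoff(1) \<delta>_bounds(1) by (intro mult_left_mono) auto
  hence \<delta>_le: "\<delta> \<le> 1/16" using \<delta>_bounds(2) by linarith
  show thesis
  proof (rule that[OF \<delta>_bounds(1) \<delta>_le])
    fix w w' assume Re_w: "\<bar>Re w\<bar> \<le> 1/2" and Im_w: "4/5 < Im w"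
      and close: "cmod (w - w') \<le> 2 * \<delta> * Im w"
    have coordinates: "\<bar>Re w - Re w'\<bar> \<le> cmod (w - w')" "\<bar>Im w - Im w'\<bar> \<le> cmod (w - w')"
      using abs_Re_le_cmod[of "w - w'"] abs_Im_le_cmod[of "w - w'"] by simp_all
    show "\<bar>f w - f w'\<bar> < \<epsilon>"
    proof (cases "Im w > 2 * Y")
      case True
      have "2 * \<delta> * Im w \<le> 2 * (1/16) * Im w"
        using Im_w \<delta>_le by (intro mult_right_mono mult_left_mono) auto
      hence "Im w' > Y" using close coordinates(2) True cutoff(1) by linarith
      thus ?thesis using cutoff True \<epsilon>_pos by simp
    next
      case False
      hence "2 * \<delta> * Im w \<le> 2 * \<delta> * (2 * Y)" using \<delta>_bounds(1) by (intro mult_left_mono) auto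
      hence "cmod (w - w') \<le> 1/4" "cmod (w - w') < \<delta>'"
        using close \<delta>_bounds(2,3) modulus(1) by linarith+
      hence "dist (f w) (f w') < \<epsilon>"
        using coordinates Im_w Re_w by (intro modulus(2)) (auto simp: dist_norm)
      thus ?thesis by (simp add: dist_real_def)
    qed
  qed
qed

lemma Cc_modular_horocycle_uniformly_continuous:
  assumes modular: "f \<in> Cc_modular" and \<epsilon>_pos: "\<epsilon> > 0"
  obtains \<delta> where "\<delta> > 0"
    "\<And>t t' y. y > 0 \<Longrightarrow> \<bar>t - t'\<bar> \<le> \<delta> * y \<Longrightarrow> \<bar>f (Complex t y) - f (Complex t' y)\<bar> < \<epsilon>"
proof -
  obtain \<delta> where modulus: "0 < \<delta>" "\<delta> \<le> 1/16"
    "\<And>w w'. \<bar>Re w\<bar> \<le> 1/2 \<Longrightarrow> 4/5 < Im w \<Longrightarrow> cmod (w - w') \<le> 2 * \<delta> * Im w \<Longrightarrow> \<bar>f w - f w'\<bar> < \<epsilon>"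
    by (rule Cc_modular_uniformly_continuous_relative[OF modular \<epsilon>_pos]) blast
  show thesis
  proof (rule that[OF modulus(1)])
    fix t t' y :: real assume y_pos: "y > 0" and close: "\<bar>t - t'\<bar> \<le> \<delta> * y"
    define z z' where "z = Complex t y" and "z' = Complex t' y"
    have Im_pos: "Im z > 0" "Im z' > 0" using y_pos by (simp_all add: z_def z'_def)
    obtain a b c d where det: "a * d - b * c = 1" and region: "sl2_act a b c d z \<in> cusp_region"
      and strip: "\<bar>Re (sl2_act a b c d z)\<bar> \<le> 1/2"
      by (rule exists_act_in_strip[OF Im_pos(1)])
    have "z - z' = of_real (t - t')" by (simp add: z_def z'_def complex_eq_iff)
    hence "cmod (z - z') \<le> \<delta> * Im z" using close by (simp add: z_def del: of_real_diff)
    hence "cmod (sl2_act a b c d z - sl2_act a b c d z') \<le> 2 * \<delta> * Im (sl2_act a b c d z)"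
      using modulus(2) by (intro sl2_act_dist_le det Im_pos) simp_all
    hence "\<bar>f (sl2_act a b c d z) - f (sl2_act a b c d z')\<bar> < \<epsilon>"
      by (intro modulus(3) strip cusp_region_Im_gt region)
    thus "\<bar>f (Complex t y) - f (Complex t' y)\<bar> < \<epsilon>"
      using Cc_modular_act[OF modular det] Im_pos by (simp add: z_def z'_def)
  qed
qed

lemma cusp_part_add_int:
  assumes "f \<in> Cc_modular"
  shows "cusp_part f (w + of_int n) = cusp_part f w"
proof (cases "w \<in> cusp_region")
  case True
  hence "Im w > 0" by (simp add: mem_cusp_region)
  thus ?thesis using Cc_modular_add_int[OF assms, of w n] by (simp add: cusp_part_def)
qed (simp add: cusp_part_def)

lemma cusp_part_eq_0_low: "Im w \<le> 4/5 \<Longrightarrow> cusp_part f w = 0"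
  using cusp_region_Im_gt[of w] by (auto simp: cusp_part_def)

lemma cusp_part_bounded:
  assumes "f \<in> Cc_modular"
  obtains M where "M > 0" "\<And>w. \<bar>cusp_part f w\<bar> \<le> M"
proof -
  obtain M where bound: "M > 0" "\<And>z. Im z > 0 \<Longrightarrow> \<bar>f z\<bar> \<le> M"
    using Cc_modular_bounded[OF assms] by blast
  have "\<bar>cusp_part f w\<bar> \<le> M" for w using bound by (simp add: cusp_part_def mem_cusp_region)
  thus thesis by (rule that[OF bound(1)])
qed

lemma open_upper_half: "open upper_half"
  unfolding upper_half_def by (intro open_Collect_less continuous_intros)

lemma cusp_region_borel [measurable]: "cusp_region \<in> sets borel"
proof -
  have "cusp_region = upper_half \<inter> {w. infdist w \<int> \<ge> 1}"
    by (auto simp: cusp_region_def upper_half_def)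
  moreover have "closed {w::complex. infdist w \<int> \<ge> 1}"
    by (intro closed_Collect_le continuous_intros)
  ultimately show ?thesis using open_upper_half
    by (metis (no_types, lifting) sets.Int borel_open borel_closed)
qed

lemma cusp_part_measurable:
  assumes "f \<in> Cc_modular"
  shows "cusp_part f \<in> borel_measurable borel"
proof -
  have "continuous_on upper_half f" using assms by (simp add: Cc_modular_def)
  hence [measurable]: "(\<lambda>w. indicator upper_half w *\<^sub>R f w) \<in> borel_measurable borel"
    using open_upper_half by (intro borel_measurable_continuous_on_indicator) auto
  have "cusp_part f = (\<lambda>w. indicator cusp_region w * (indicator upper_half w *\<^sub>R f w))"
    by (auto simp: cusp_part_def cusp_region_def upper_half_def indicator_def fun_eq_iff)
  also have "\<dots> \<in> borel_measurable borel" by measurable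
  finally show ?thesis .
qed

lemma cusp_part_isCont:
  assumes modular: "f \<in> Cc_modular" and off_boundary: "Im w > 0" "infdist w \<int> \<noteq> 1"
  shows "isCont (cusp_part f) w"
proof (cases "infdist w \<int> > 1")
  case True
  define U where "U = upper_half \<inter> {w. infdist w \<int> > 1}"
  have "open U"
    unfolding U_def by (intro open_Int open_upper_half open_Collect_less continuous_intros)
  moreover have "w \<in> U" using off_boundary True by (simp add: U_def upper_half_def)
  moreover have "continuous_on U (cusp_part f)"
  proof (rule continuous_on_eq)
    show "continuous_on U f"
      by (intro Cc_modular_continuous_on modular) (simp add: U_def upper_half_def)
  qed (simp add: U_def cusp_part_def cusp_region_def upper_half_def)
  ultimately show ?thesis by (simp add: continuous_on_eq_continuous_at)
next
  case False
  define U where "U = {w::complex. infdist w \<int> < 1}"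
  have "open U" unfolding U_def by (intro open_Collect_less continuous_intros)
  moreover have "w \<in> U" using off_boundary False by (simp add: U_def)
  moreover have "continuous_on U (cusp_part f)"
    by (rule continuous_on_eq[OF continuous_on_const[of _ 0]])
      (simp add: U_def cusp_part_def cusp_region_def)
  ultimately show ?thesis by (simp add: continuous_on_eq_continuous_at)
qed

lemma countable_infdist_Ints_eq_1: "countable {x. infdist (Complex x \<eta>) \<int> = 1}"
proof (rule countable_subset)
  show "{x. infdist (Complex x \<eta>) \<int> = 1} \<subseteq>
      (\<Union>n::int. {of_int n + sqrt (1 - \<eta>\<^sup>2), of_int n - sqrt (1 - \<eta>\<^sup>2)})"
  proof
    fix x assume "x \<in> {x. infdist (Complex x \<eta>) \<int> = 1}"
    moreover have "(\<int> :: complex set) \<noteq> {}" using Ints_0 by blast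
    then obtain a where "a \<in> \<int>" "infdist (Complex x \<eta>) \<int> = dist (Complex x \<eta>) a"
      by (rule infdist_attains_inf[OF closed_Ints])
    ultimately obtain n where "cmod (Complex x \<eta> - of_int n) = 1"
      by (auto simp: dist_norm elim: Ints_cases)
    hence "(cmod (Complex x \<eta> - of_int n))\<^sup>2 = 1" by simp
    hence "(x - of_int n)\<^sup>2 = 1 - \<eta>\<^sup>2" by (simp add: cmod_power2)
    hence "\<bar>x - of_int n\<bar> = sqrt (1 - \<eta>\<^sup>2)" by (metis real_sqrt_abs)
    thus "x \<in> (\<Union>n::int. {of_int n + sqrt (1 - \<eta>\<^sup>2), of_int n - sqrt (1 - \<eta>\<^sup>2)})"
      by (intro UN_I[of n]) auto
  qed
qed auto

lemma AE_isCont_cusp_part: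
  assumes modular: "f \<in> Cc_modular" and \<eta>_pos: "\<eta> > 0"
  shows "AE x in lborel. isCont (cusp_part f) (Complex (x - s) \<eta>)"
proof -
  let ?B = "(\<lambda>x. x + s) ` {x. infdist (Complex x \<eta>) \<int> = 1}"
  have "AE x in lborel. x \<notin> ?B"
    by (intro AE_not_in countable_imp_null_set_lborel countable_image countable_infdist_Ints_eq_1)
  thus ?thesis
  proof eventually_elim
    case (elim x)
    hence "infdist (Complex (x - s) \<eta>) \<int> \<noteq> 1" by (auto simp: image_iff dest: spec[of _ "x - s"])
    thus ?case using \<eta>_pos by (intro cusp_part_isCont modular) simp_all
  qed
qed

subsection \<open>Unfolding a horocycle\<close>

definition cusp_map :: "nat \<Rightarrow> int \<Rightarrow> complex \<Rightarrow> complex" where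
  "cusp_map c a z = of_int a / of_nat c - 1 / (of_nat c ^ 2 * z)"

lemma cusp_map_Complex:
  assumes c_pos: "c > 0" and y_pos: "y > 0"
  shows "cusp_map c a (Complex s y) =
    Complex (of_int a / real c - s / ((real c)\<^sup>2 * (s\<^sup>2 + y\<^sup>2))) (y / ((real c)\<^sup>2 * (s\<^sup>2 + y\<^sup>2)))"
proof -
  define q where "q = (real c)\<^sup>2"
  have q_pos: "q > 0" using c_pos by (simp add: q_def)
  have "s\<^sup>2 + y\<^sup>2 > 0" using y_pos by (simp add: add_nonneg_pos)
  moreover have "(q * s)\<^sup>2 + (q * y)\<^sup>2 = q * (q * (s\<^sup>2 + y\<^sup>2))"
    by (simp add: power2_eq_square algebra_simps)
  ultimately have "1 / (of_real q * Complex s y) =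
      Complex (s / (q * (s\<^sup>2 + y\<^sup>2))) (- (y / (q * (s\<^sup>2 + y\<^sup>2))))"
    using q_pos by (simp add: complex_eq_iff Re_divide Im_divide)
  moreover have "cusp_map c a (Complex s y) =
      of_real (of_int a / real c) - 1 / (of_real q * Complex s y)"
    by (simp add: cusp_map_def q_def)
  ultimately show ?thesis by (simp add: complex_eq_iff q_def)
qed

lemma cusp_map_add_mult: "c > 0 \<Longrightarrow> cusp_map c (a + int c * n) z = cusp_map c a z + of_int n"
  by (simp add: cusp_map_def add_divide_distrib)

lemma cusp_part_cusp_map_cong:
  assumes modular: "f \<in> Cc_modular" and c_pos: "c > 0" and cong: "[a = a'] (mod int c)"
  shows "cusp_part f (cusp_map c a z) = cusp_part f (cusp_map c a' z)"
proof -
  obtain n where "a = a' + int c * n" using cong_sym[OF cong] unfolding cong_iff_lin by (elim exE)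
  thus ?thesis using c_pos by (simp add: cusp_map_add_mult cusp_part_add_int[OF modular])
qed

lemma sl2_act_eq_cusp_map:
  assumes c_pos: "c > 0" and Im_pos: "Im z > 0" and det: "a * D - b * int c = 1"
  shows "sl2_act a b (int c) D z = cusp_map c a (z + of_int D / of_nat c)"
proof -
  let ?E = "of_nat c * z + of_int D"
  have nonzero: "?E \<noteq> 0" using sl2_act_denominator_nonzero[OF det Im_pos] by simp
  have "a * D = b * int c + 1" using det by simp
  hence "(of_int (a * D) :: complex) = of_int (b * int c + 1)" by (simp only:)
  hence numerator: "of_int a * ?E - 1 = of_nat c * (of_int a * z + of_int b)"
    by (simp add: algebra_simps)
  have "of_nat c ^ 2 * (z + of_int D / of_nat c) = of_nat c * ?E"
    using c_pos by (simp add: power2_eq_square field_simps)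
  hence "cusp_map c a (z + of_int D / of_nat c) = of_int a / of_nat c - 1 / (of_nat c * ?E)"
    by (simp add: cusp_map_def)
  also have "\<dots> = (of_int a * ?E - 1) / (of_nat c * ?E)"
    using c_pos nonzero by (simp add: diff_divide_distrib)
  also have "\<dots> = sl2_act a b (int c) D z"
    unfolding numerator using c_pos by (simp add: sl2_act_def)
  finally show ?thesis by (rule sym)
qed

lemma exists_cusp_map_eq_sl2_act:
  assumes c_pos: "c > 0" and Im_pos: "Im z > 0" and D_coprime: "coprime D (int c)"
  obtains b where "modular_inverse (int c) D * D - b * int c = 1"
    "cusp_map c (modular_inverse (int c) D) (z + of_int D / of_nat c) =
      sl2_act (modular_inverse (int c) D) b (int c) D z"
proof -
  have "int c dvd modular_inverse (int c) D * D - 1"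
    using cong_modular_inverse2[OF D_coprime] by (simp only: cong_iff_dvd_diff)
  then obtain b where "modular_inverse (int c) D * D - 1 = int c * b" by (rule dvdE)
  hence "modular_inverse (int c) D * D - b * int c = 1" by (simp add: mult.commute)
  with sl2_act_eq_cusp_map[OF c_pos Im_pos this] show thesis by (intro that) auto
qed

lemma exists_positive_bottom_row:
  assumes low: "0 < Im z" "Im z \<le> 4/5"
  obtains a b D :: int and c :: nat
  where "c > 0" "a * D - b * int c = 1" "sl2_act a b (int c) D z \<in> cusp_region"
proof -
  obtain a b C D where det: "a * D - b * C = 1" and region: "sl2_act a b C D z \<in> cusp_region"
    by (rule exists_act_in_cusp_region[OF low(1)])
  have "C \<noteq> 0"
  proof
    assume "C = 0"
    hence "a * D = 1" using det by simp
    hence "D = 1 \<or> D = -1" by (auto simp: zmult_eq_1_iff)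
    hence "Im (sl2_act a b C D z) = Im z" using \<open>C = 0\<close> unfolding Im_sl2_act[OF det] by auto
    thus False using cusp_region_Im_gt[OF region] low by simp
  qed
  then consider "C > 0" | "C < 0" by linarith
  thus thesis
  proof cases
    assume "C > 0"
    thus thesis using det region by (intro that[of "nat C" a D b]) auto
  next
    assume "C < 0"
    have "sl2_act (- a) (- b) (- C) (- D) z =
        (- (of_int a * z + of_int b)) / (- (of_int C * z + of_int D))"
      by (simp add: sl2_act_def)
    hence "sl2_act (- a) (- b) (- C) (- D) z = sl2_act a b C D z"
      by (simp only: minus_divide_divide sl2_act_def)
    thus thesis using det region \<open>C < 0\<close> by (intro that[of "nat (- C)" "- a" "- D" "- b"]) auto
  qed
qed

lemma cusp_region_bottom_row_bounds:
  assumes y_bounds: "0 < y" "y < 1/5" and c_pos: "c > 0" and det: "a * D - b * int c = 1"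
    and region: "sl2_act a b (int c) D (Complex t y) \<in> cusp_region"
  shows "(real c)\<^sup>2 * y \<le> 4" and "\<bar>real c * t + of_int D\<bar> < 1/2"
proof -
  have pos: "(real c * t + of_int D)\<^sup>2 + (real c * y)\<^sup>2 > 0"
    using c_pos y_bounds by (intro add_nonneg_pos) auto
  have "Im (sl2_act a b (int c) D (Complex t y)) =
      y / ((real c * t + of_int D)\<^sup>2 + (real c * y)\<^sup>2)"
    by (simp add: Im_sl2_act[OF det] cmod_power2)
  hence "4/5 < y / ((real c * t + of_int D)\<^sup>2 + (real c * y)\<^sup>2)"
    using cusp_region_Im_gt[OF region] by simp
  hence denominator_less: "(real c * t + of_int D)\<^sup>2 + (real c * y)\<^sup>2 < 5/4 * y"
    using pos by (simp add: field_simps)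
  have "(real c * y)\<^sup>2 < 5/4 * y"
    using denominator_less zero_le_power2[of "real c * t + of_int D"] by linarith
  hence "((real c)\<^sup>2 * y) * y < 5/4 * y" by (simp add: power2_eq_square algebra_simps)
  thus "(real c)\<^sup>2 * y \<le> 4" using y_bounds by simp
  have "(real c * t + of_int D)\<^sup>2 < 1/4"
    using denominator_less y_bounds zero_le_power2[of "real c * y"] by linarith
  hence "\<bar>real c * t + of_int D\<bar>\<^sup>2 < (1/2)\<^sup>2" by (simp add: power_divide)
  thus "\<bar>real c * t + of_int D\<bar> < 1/2" by (rule power2_less_imp_less) simp
qed

text \<open>Off this countable set a point of the horocycle has only one bottom row of maximal height.\<close>
definition horocycle_ties :: "real \<Rightarrow> real set" where
  "horocycle_ties y = {t. \<exists>(c::nat) (D::int) (c'::nat) (D'::int). 0 < c \<and> 0 < c' \<and>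
      (c, D) \<noteq> (c', D') \<and>
      cmod (of_nat c * Complex t y + of_int D) = cmod (of_nat c' * Complex t y + of_int D')}"

lemma finite_equal_denominators:
  assumes "0 < c" "0 < c'" "(c, D) \<noteq> (c', D')"
  shows "finite {t. cmod (of_nat c * Complex t y + of_int D) =
      cmod (of_nat c' * Complex t y + of_int D')}"
proof (rule finite_subset)
  define p :: "real poly" where "p =
      [: (of_int D)\<^sup>2 - (of_int D')\<^sup>2 + ((real c)\<^sup>2 - (real c')\<^sup>2) * y\<^sup>2,
    2 * (real c * of_int D - real c' * of_int D'), (real c)\<^sup>2 - (real c')\<^sup>2 :]"
  show "{t. cmod (of_nat c * Complex t y + of_int D) =
      cmod (of_nat c' * Complex t y + of_int D')} \<subseteq> {t. poly p t = 0}"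
  proof clarify
    fix t assume "cmod (of_nat c * Complex t y + of_int D) =
        cmod (of_nat c' * Complex t y + of_int D')"
    hence "(cmod (of_nat c * Complex t y + of_int D))\<^sup>2 =
        (cmod (of_nat c' * Complex t y + of_int D'))\<^sup>2"
      by simp
    hence "(real c * t + of_int D)\<^sup>2 + (real c * y)\<^sup>2 =
        (real c' * t + of_int D')\<^sup>2 + (real c' * y)\<^sup>2"
      unfolding cmod_power2 by simp
    thus "poly p t = 0" by (simp add: p_def power2_eq_square algebra_simps)
  qed
  have "p \<noteq> 0"
  proof
    assume "p = 0"
    hence "(real c)\<^sup>2 = (real c')\<^sup>2" "real c * of_int D = real c' * of_int D'"
      by (auto simp: p_def)
    thus False using assms by auto
  qed
  thus "finite {t. poly p t = 0}" by (rule poly_roots_finite)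
qed

lemma countable_horocycle_ties: "countable (horocycle_ties y)"
proof -
  have "horocycle_ties y = (\<Union>c. \<Union>D. \<Union>c'. \<Union>D'. {t. 0 < c \<and> 0 < c' \<and> (c, D) \<noteq> (c', D') \<and>
      cmod (of_nat c * Complex t y + of_int D) = cmod (of_nat c' * Complex t y + of_int D')})"
    by (simp add: horocycle_ties_def set_eq_iff)
  moreover have "countable {t. 0 < c \<and> 0 < c' \<and> (c, D) \<noteq> (c', D') \<and>
      cmod (of_nat c * Complex t y + of_int D) = cmod (of_nat c' * Complex t y + of_int D')}"
        for c c' D D'
    using finite_equal_denominators[of c c' D D' y]
    by (cases "0 < c \<and> 0 < c' \<and> (c, D) \<noteq> (c', D')") (auto intro: countable_finite)
  ultimately show ?thesis by auto
qed

lemma cusp_region_bottom_row_unique: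
  assumes y_pos: "y > 0" and no_tie: "t \<notin> horocycle_ties y" and c_pos: "c > 0" "c' > 0"
    and det: "a * D - b * int c = 1" "a' * D' - b' * int c' = 1"
    and region: "sl2_act a b (int c) D (Complex t y) \<in> cusp_region"
      "sl2_act a' b' (int c') D' (Complex t y) \<in> cusp_region"
  shows "(c, D) = (c', D')"
proof (rule ccontr)
  assume rows_differ: "(c, D) \<noteq> (c', D')"
  have Im_pos: "Im (Complex t y) > 0" using y_pos by simp
  have "cmod (of_int (int c) * Complex t y + of_int D) =
      cmod (of_int (int c') * Complex t y + of_int D')"
    using c_pos cusp_region_minimal[OF det(1) Im_pos region(1), of "int c'" D']
        cusp_region_minimal[OF det(2) Im_pos region(2), of "int c" D]
    by (intro antisym) auto
  hence "t \<in> horocycle_ties y" using c_pos rows_differ by (auto simp: horocycle_ties_def)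
  thus False using no_tie by simp
qed

definition cusp_denominators :: "real \<Rightarrow> nat set" where
  "cusp_denominators y = {c. 0 < c \<and> (real c)\<^sup>2 * y \<le> 4}"

lemma mem_cusp_denominators_sqrt:
  assumes "y > 0"
  shows "c \<in> cusp_denominators y \<longleftrightarrow> 0 < c \<and> real c * sqrt y \<le> 2"
proof -
  have "(real c)\<^sup>2 * y \<le> 4 \<longleftrightarrow> (real c * sqrt y)\<^sup>2 \<le> 2\<^sup>2"
    using assms by (simp add: power_mult_distrib)
  also have "\<dots> \<longleftrightarrow> real c * sqrt y \<le> 2"
    using assms by (simp only: power2_le_iff_abs_le) (simp add: abs_mult)
  finally show ?thesis by (simp add: cusp_denominators_def)
qed

lemma finite_cusp_denominators:
  assumes "y > 0"
  shows "finite (cusp_denominators y)"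
proof (rule finite_subset)
  show "cusp_denominators y \<subseteq> {..nat \<lceil>2 / sqrt y\<rceil>}"
    using assms by (auto simp: mem_cusp_denominators_sqrt pos_le_divide_eq[symmetric]) linarith
qed simp

lemma coprime_bottom_row:
  fixes a b c D :: int
  assumes "a * D - b * c = 1"
  shows "coprime D c"
proof (rule coprimeI)
  fix l assume "l dvd D" "l dvd c"
  hence "l dvd a * D - b * c" by simp
  thus "is_unit l" using assms by simp
qed

lemma cusp_part_cusp_map_inverse:
  assumes modular: "f \<in> Cc_modular" and Im_pos: "Im z > 0" and c_pos: "c > 0"
    and det: "a * D - b * int c = 1"
    and region: "sl2_act a b (int c) D z \<in> cusp_region"
  shows "cusp_part f (cusp_map c (modular_inverse (int c) D) (z + of_int D / of_nat c)) = f z"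
proof -
  have coprime: "coprime D (int c)" by (rule coprime_bottom_row[OF det])
  have "[modular_inverse (int c) D * D = 1] (mod int c)"
    by (rule cong_modular_inverse2[OF coprime])
  also have "[1 = a * D] (mod int c)" using det by (simp add: cong_iff_dvd_diff flip: det)
  finally have "[modular_inverse (int c) D = a] (mod int c)"
    using coprime by (simp add: cong_mult_rcancel)
  hence "cusp_part f (cusp_map c (modular_inverse (int c) D) (z + of_int D / of_nat c)) =
      cusp_part f (cusp_map c a (z + of_int D / of_nat c))"
    by (rule cusp_part_cusp_map_cong[OF modular c_pos])
  also have "\<dots> = f (sl2_act a b (int c) D z)"
    using region by (simp add: sl2_act_eq_cusp_map[OF c_pos Im_pos det, symmetric] cusp_part_def)
  also have "\<dots> = f z" by (rule Cc_modular_act[OF modular det Im_pos])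
  finally show ?thesis .
qed

lemma cusp_part_cusp_map_other:
  assumes y_pos: "y > 0" and no_tie: "t \<notin> horocycle_ties y" and c_pos: "c > 0"
    and det: "a * D - b * int c = 1"
    and region: "sl2_act a b (int c) D (Complex t y) \<in> cusp_region"
    and c'_pos: "c' > 0" and D'_coprime: "coprime D' (int c')"
    and rows_differ: "(c', D') \<noteq> (c, D)"
  shows "cusp_part f
    (cusp_map c' (modular_inverse (int c') D') (Complex t y + of_int D' / of_nat c')) = 0"
proof -
  have Im_pos: "Im (Complex t y) > 0" using y_pos by simp
  obtain b' where det': "modular_inverse (int c') D' * D' - b' * int c' = 1"
    and map_eq: "cusp_map c' (modular_inverse (int c') D') (Complex t y + of_int D' / of_nat c') =
      sl2_act (modular_inverse (int c') D') b' (int c') D' (Complex t y)"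
    by (rule exists_cusp_map_eq_sl2_act[OF c'_pos Im_pos D'_coprime])
  have "sl2_act (modular_inverse (int c') D') b' (int c') D' (Complex t y) \<notin> cusp_region"
    using cusp_region_bottom_row_unique[OF y_pos no_tie c_pos c'_pos det det' region] rows_differ
    by metis
  thus ?thesis by (simp add: map_eq cusp_part_def)
qed

text \<open>For \<open>0 < t \<le> 1\<close> the bound \<open>\<bar>c t + D\<bar> < 1/2\<close> confines \<open>D\<close> to these three periods modulo \<open>c\<close>.\<close>
definition bottom_rows :: "nat \<Rightarrow> int set" where
  "bottom_rows c = {D. (1 - int 3) * int c < D \<and> D \<le> int c \<and> coprime D (int c)}"

lemma finite_bottom_rows: "finite (bottom_rows c)"
  by (rule finite_subset[of _ "{(1 - int 3) * int c..int c}"]) (auto simp: bottom_rows_def)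

lemma exists_bottom_row_of_maximal_height:
  assumes y_bounds: "0 < y" "y < 1/5" and t_bounds: "0 < t" "t \<le> 1"
  obtains a b c D where "a * D - b * int c = 1"
    "sl2_act a b (int c) D (Complex t y) \<in> cusp_region"
    "c \<in> cusp_denominators y" "D \<in> bottom_rows c"
proof -
  have low: "Im (Complex t y) > 0" "Im (Complex t y) \<le> 4/5" using y_bounds by simp_all
  obtain a b D :: int and c :: nat where c_pos: "c > 0" and det: "a * D - b * int c = 1"
    and region: "sl2_act a b (int c) D (Complex t y) \<in> cusp_region"
    by (rule exists_positive_bottom_row[OF low])
  note bounds = cusp_region_bottom_row_bounds[OF y_bounds c_pos det region]
  have "0 < real c * t" "real c * t \<le> real c" using c_pos t_bounds by (simp_all add: mult_left_le)
  hence "real_of_int D < 1" "real_of_int D > - 1 - real c" using bounds(2) by linarith+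
  hence "D \<le> 0" "D > - 1 - int c" by linarith+
  hence "D \<in> bottom_rows c" using c_pos coprime_bottom_row[OF det] by (simp add: bottom_rows_def)
  moreover have "c \<in> cusp_denominators y"
    using c_pos bounds(1) by (simp add: cusp_denominators_def)
  ultimately show thesis using that det region by blast
qed

lemma Complex_add_of_int_divide:
  "Complex t y + of_int D / of_nat c = Complex (t + of_int D / real c) y"
proof -
  have "Complex t y + of_int D / of_nat c = Complex t y + of_real (of_int D / real c)" by simp
  also have "\<dots> = Complex (t + of_int D / real c) y" by (simp only: complex_eq_iff) simp
  finally show ?thesis .
qed

lemma horocycle_unfolding:
  fixes t y :: real
  assumes modular: "f \<in> Cc_modular" and y_bounds: "0 < y" "y < 1/5"
    and t_generic: "0 < t" "t \<le> 1" "t \<notin> horocycle_ties y"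
  shows "f (Complex t y) = (\<Sum>c\<in>cusp_denominators y.
    \<Sum>D\<in>bottom_rows c.
      cusp_part f (cusp_map c (modular_inverse (int c) D) (Complex (t + of_int D / real c) y)))"
proof -
  define w where "w = (\<lambda>(c, D).
    cusp_map c (modular_inverse (int c) D) (Complex t y + of_int D / of_nat c))"
  obtain a b c D where det: "a * D - b * int c = 1"
    and region: "sl2_act a b (int c) D (Complex t y) \<in> cusp_region"
    and index: "c \<in> cusp_denominators y" "D \<in> bottom_rows c"
    by (rule exists_bottom_row_of_maximal_height[OF y_bounds t_generic(1,2)])
  have Im_pos: "Im (Complex t y) > 0" using y_bounds by simp
  have c_pos: "c > 0" using index(1) by (simp add: cusp_denominators_def)
  have "f (Complex t y) = (\<Sum>i\<in>{(c, D)}. cusp_part f (w i))"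
    by (simp add: w_def cusp_part_cusp_map_inverse[OF modular Im_pos c_pos det region])
  also have "\<dots> = (\<Sum>i\<in>Sigma (cusp_denominators y) bottom_rows. cusp_part f (w i))"
  proof (rule sum.mono_neutral_left)
    show "finite (Sigma (cusp_denominators y) bottom_rows)"
      by (intro finite_SigmaI finite_cusp_denominators y_bounds(1) finite_bottom_rows)
    show "\<forall>i\<in>Sigma (cusp_denominators y) bottom_rows - {(c, D)}. cusp_part f (w i) = 0"
    proof
      fix i assume other: "i \<in> Sigma (cusp_denominators y) bottom_rows - {(c, D)}"
      obtain c' D' where "i = (c', D')" by force
      thus "cusp_part f (w i) = 0"
        using other
          cusp_part_cusp_map_other[OF y_bounds(1) t_generic(3) c_pos det region, of c' D' f]
        by (simp add: w_def bottom_rows_def cusp_denominators_def)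
    qed
  qed (use index in simp)
  also have "\<dots> = (\<Sum>c\<in>cusp_denominators y. \<Sum>D\<in>bottom_rows c. cusp_part f (w (c, D)))"
    by (subst sum.Sigma)
      (simp_all add: finite_cusp_denominators[OF y_bounds(1)] finite_bottom_rows)
  finally show ?thesis by (simp add: w_def Complex_add_of_int_divide)
qed

subsection \<open>Means over horocycles\<close>

definition horocycle_mean :: "(complex \<Rightarrow> real) \<Rightarrow> real \<Rightarrow> real" where
  "horocycle_mean F y = (LINT t:{0<..1}|lborel. F (Complex t y))"

lemma horocycle_mean_shift:
  assumes "(\<lambda>t. F (Complex t y)) \<in> borel_measurable borel" "\<And>t. \<bar>F (Complex t y)\<bar> \<le> B"
    and "\<And>t (n::int). F (Complex (t + of_int n) y) = F (Complex t y)"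
  shows "(LINT t:{0<..1}|lborel. F (Complex (t + s) y)) = horocycle_mean F y"
  unfolding horocycle_mean_def by (rule set_integral_periodic_shift[OF assms])

lemma horocycle_mean_shift_Cc_modular:
  assumes modular: "f \<in> Cc_modular" and y_pos: "y > 0"
  shows "(LINT t:{0<..1}|lborel. f (Complex (t + s) y)) = horocycle_mean f y"
proof -
  obtain M where "\<And>z. Im z > 0 \<Longrightarrow> \<bar>f z\<bar> \<le> M" by (rule Cc_modular_bounded[OF modular]) blast
  thus ?thesis
    using Cc_modular_horocycle_measurable[OF modular y_pos, of 0]
      Cc_modular_Complex_add_int[OF modular y_pos] y_pos
    by (intro horocycle_mean_shift[where B = M]) auto
qed

lemma horocycle_mean_shift_cusp_part:
  assumes modular: "f \<in> Cc_modular"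
  shows "(LINT t:{0<..1}|lborel. cusp_part f (Complex (t - s) \<eta>)) =
      horocycle_mean (cusp_part f) \<eta>"
proof -
  note [measurable] = cusp_part_measurable[OF modular]
  obtain M where "\<And>w. \<bar>cusp_part f w\<bar> \<le> M" by (rule cusp_part_bounded[OF modular]) blast
  moreover have "cusp_part f (Complex (t + of_int n) \<eta>) = cusp_part f (Complex t \<eta>)" for t n
  proof -
    have "Complex (t + of_int n) \<eta> = Complex t \<eta> + of_int n" by (simp add: complex_eq_iff)
    thus ?thesis by (simp only: cusp_part_add_int[OF modular])
  qed
  ultimately show ?thesis
    using horocycle_mean_shift[of "cusp_part f" \<eta> M "- s"] by simp
qed

lemma horocycle_mean_bounded:
  assumes bound: "\<And>w. \<bar>F w\<bar> \<le> M"
  shows "\<bar>horocycle_mean F y\<bar> \<le> M"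
proof -
  have "norm (LINT t|lborel. indicator {0<..1} t *\<^sub>R F (Complex t y)) \<le>
      (LINT t|lborel. norm (indicator {0<..1} t *\<^sub>R F (Complex t y)))"
    by (rule integral_norm_bound)
  also have "\<dots> \<le> (LINT t|lborel. indicator {0<..1::real} t * M)"
  proof (rule integral_mono_AE')
    show "integrable lborel (\<lambda>t. indicator {0<..1::real} t * M)"
      by (intro integrable_mult_left) simp
  qed (use bound order_trans[OF abs_ge_zero bound] in \<open>auto simp: indicator_def\<close>)
  finally show ?thesis by (simp add: horocycle_mean_def set_lebesgue_integral_def)
qed

lemma borel_measurable_horocycle_mean [measurable]:
  assumes [measurable]: "F \<in> borel_measurable borel"
  shows "horocycle_mean F \<in> borel_measurable borel"
  unfolding horocycle_mean_def[abs_def] set_lebesgue_integral_def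
  by (intro lborel.borel_measurable_lebesgue_integral) measurable

lemma horocycle_mean_cusp_part_eq_0:
  assumes "\<eta> \<le> 4/5 \<or> (\<forall>z. Im z = \<eta> \<longrightarrow> f z = 0)"
  shows "horocycle_mean (cusp_part f) \<eta> = 0"
proof -
  have "cusp_part f (Complex t \<eta>) = 0" for t
    using assms cusp_part_eq_0_low[of "Complex t \<eta>" f] by (auto simp: cusp_part_def)
  thus ?thesis by (simp add: horocycle_mean_def)
qed

lemma fund_dom_iff_cusp_region:
  assumes "\<bar>x\<bar> \<le> 1/2"
  shows "Complex x \<eta> \<in> fund_dom \<longleftrightarrow> Complex x \<eta> \<in> cusp_region"
proof
  assume "Complex x \<eta> \<in> cusp_region"
  hence "Im (Complex x \<eta>) > 0" "1 \<le> cmod (Complex x \<eta> + of_int 0)"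
    by (simp_all only: mem_cusp_region)
  thus "Complex x \<eta> \<in> fund_dom" using assms by (simp add: fund_dom_def)
next
  assume fund: "Complex x \<eta> \<in> fund_dom"
  have "1 \<le> cmod (Complex x \<eta> + of_int n)" for n :: int
  proof -
    have "\<bar>x\<bar> \<le> \<bar>x + of_int n\<bar>"
    proof (cases "n = 0")
      case False
      hence "\<bar>real_of_int n\<bar> \<ge> 1" by linarith
      thus ?thesis using assms by linarith
    qed simp
    hence "x\<^sup>2 \<le> (x + of_int n)\<^sup>2" by (simp only: abs_le_square_iff)
    moreover have "1 \<le> (cmod (Complex x \<eta>))\<^sup>2" using fund by (simp add: fund_dom_def one_le_power)
    ultimately have "1\<^sup>2 \<le> (cmod (Complex x \<eta> + of_int n))\<^sup>2" by (simp add: cmod_power2)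
    thus ?thesis by (rule power2_le_imp_le) simp
  qed
  thus "Complex x \<eta> \<in> cusp_region" using fund by (simp add: mem_cusp_region fund_dom_def)
qed

lemma fund_dom_integrand_eq:
  "indicator fund_dom z *\<^sub>R (f z / (Im z)\<^sup>2) =
      indicator {-1/2..1/2} (Re z) * (cusp_part f z / (Im z)\<^sup>2)"
  using fund_dom_iff_cusp_region[of "Re z" "Im z"]
  by (auto simp: cusp_part_def indicator_def fund_dom_def)

lemma set_integrable_fund_dom:
  assumes modular: "f \<in> Cc_modular"
  shows "set_integrable lborel fund_dom (\<lambda>z. f z / (Im z)\<^sup>2)"
proof -
  note [measurable] = cusp_part_measurable[OF modular]
  have [measurable]: "Re \<in> borel_measurable borel" "Im \<in> borel_measurable borel"
    by (intro borel_measurable_continuous_onI continuous_intros)+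
  obtain M where bound: "M > 0" "\<And>w. \<bar>cusp_part f w\<bar> \<le> M"
    by (rule cusp_part_bounded[OF modular]) blast
  obtain Y where cutoff: "\<And>z. Im z > Y \<Longrightarrow> f z = 0" by (rule Cc_modular_cutoff[OF modular]) blast
  define C where "C = cbox (Complex (- 1/2) (1/4)) (Complex (1/2) Y)"
  define g where "g = (\<lambda>z. indicator {-1/2..1/2} (Re z) * (cusp_part f z / (Im z)\<^sup>2))"
  have "set_integrable lborel C g"
  proof (rule set_integrable_lborel_bounded[where B = "M * 16"])
    show "g \<in> borel_measurable borel" unfolding g_def by measurable
    fix z assume "z \<in> C"
    hence Im_ge: "1/4 \<le> Im z" by (simp add: C_def in_cbox_complex_iff)
    hence "(1/4)\<^sup>2 \<le> (Im z)\<^sup>2" by (intro power_mono) auto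
    hence "1 / (Im z)\<^sup>2 \<le> 1 / (1/4)\<^sup>2" using Im_ge by (intro divide_left_mono mult_pos_pos) auto
    hence "\<bar>cusp_part f z\<bar> * (1 / (Im z)\<^sup>2) \<le> M * 16"
      using bound by (intro mult_mono) (auto simp: power2_eq_square)
    thus "\<bar>g z\<bar> \<le> M * 16" using bound(1) by (simp add: g_def indicator_def)
  qed (simp_all add: C_def emeasure_bounded_finite[simplified])
  moreover have "indicator C z *\<^sub>R g z = g z" for z
  proof (cases "Im z \<in> {1/4..Y}")
    case True
    thus ?thesis by (simp add: C_def indicator_def g_def in_cbox_complex_iff)
  next
    case False
    hence "cusp_part f z = 0"
      using cusp_part_eq_0_low[of z f] cutoff[of z] by (auto simp: cusp_part_def)
    thus ?thesis by (simp add: g_def)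
  qed
  ultimately show ?thesis by (simp only: set_integrable_def fund_dom_integrand_eq g_def)
qed

lemma integral_cusp_part_centered:
  assumes modular: "f \<in> Cc_modular"
  shows "(LINT x:{-1/2..1/2}|lborel. cusp_part f (Complex x \<eta>)) = horocycle_mean (cusp_part f) \<eta>"
proof -
  note [measurable] = cusp_part_measurable[OF modular]
  have "(LINT x:{-1/2..1/2}|lborel. cusp_part f (Complex x \<eta>)) =
      (LINT x:{-1/2<..1/2}|lborel. cusp_part f (Complex x \<eta>))"
    unfolding set_lebesgue_integral_def
  proof (rule integral_cong_AE)
    show "AE x in lborel. indicator {-1/2..1/2} x *\<^sub>R cusp_part f (Complex x \<eta>) =
        indicator {-1/2<..1/2} x *\<^sub>R cusp_part f (Complex x \<eta>)"
      using AE_lborel_singleton[of "-1/2"] by eventually_elim (auto simp: indicator_def)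
  qed measurable
  also have "\<dots> = horocycle_mean (cusp_part f) \<eta>"
    using set_integral_shift_Ioc[of 0 1 "\<lambda>x. cusp_part f (Complex x \<eta>)" "-1/2"]
      horocycle_mean_shift_cusp_part[OF modular, of "1/2" \<eta>] by simp
  finally show ?thesis .
qed

lemma integral_fund_dom:
  assumes modular: "f \<in> Cc_modular" and cutoff: "\<And>z. Im z > Y \<Longrightarrow> f z = 0"
  shows "(LINT z:fund_dom|lborel. f z / (Im z)\<^sup>2) =
      (LINT \<eta>:{1/4..Y}|lborel. horocycle_mean (cusp_part f) \<eta> / \<eta>\<^sup>2)"
proof -
  have "(LINT z:fund_dom|lborel. f z / (Im z)\<^sup>2) =
      (LINT \<eta>|lborel. LINT x|lborel. indicator {-1/2..1/2} x * (cusp_part f (Complex x \<eta>) / \<eta>\<^sup>2))"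
    using lborel_integral_complex_iterated set_integrable_fund_dom[OF modular]
    by (simp only: set_integrable_def set_lebesgue_integral_def fund_dom_integrand_eq complex.sel)
  also have "\<dots> = (LINT \<eta>|lborel. indicator {1/4..Y} \<eta> * (horocycle_mean (cusp_part f) \<eta> / \<eta>\<^sup>2))"
  proof (rule Bochner_Integration.integral_cong[OF refl])
    fix \<eta> :: real
    have "(LINT x|lborel. indicator {-1/2..1/2} x * (cusp_part f (Complex x \<eta>) / \<eta>\<^sup>2)) =
        (LINT x:{-1/2..1/2}|lborel. cusp_part f (Complex x \<eta>)) / \<eta>\<^sup>2"
      unfolding set_lebesgue_integral_def by (subst integral_divide_zero[symmetric]) simp
    also have "\<dots> = horocycle_mean (cusp_part f) \<eta> / \<eta>\<^sup>2"
      by (simp only: integral_cusp_part_centered[OF modular])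
    finally show "(LINT x|lborel. indicator {-1/2..1/2} x * (cusp_part f (Complex x \<eta>) / \<eta>\<^sup>2)) =
        indicator {1/4..Y} \<eta> * (horocycle_mean (cusp_part f) \<eta> / \<eta>\<^sup>2)"
      using horocycle_mean_cusp_part_eq_0[of \<eta> f] cutoff by (auto simp: indicator_def)
  qed
  finally show ?thesis by (simp add: set_lebesgue_integral_def)
qed

lemma integral_horocycle_mean_cusp_part:
  assumes modular: "f \<in> Cc_modular"
  shows "(LINT r:{0<..<2}|lborel. r * horocycle_mean (cusp_part f) (1 / r\<^sup>2)) =
    (LINT z:fund_dom|lborel. f z / (Im z)\<^sup>2) / 2"
proof -
  let ?mean = "horocycle_mean (cusp_part f)"
  note [measurable] = cusp_part_measurable[OF modular]
  obtain Y where cutoff: "Y \<ge> 1" "\<And>z. Im z > Y \<Longrightarrow> f z = 0"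
    by (rule Cc_modular_cutoff[OF modular]) blast
  obtain M where bound: "\<And>w. \<bar>cusp_part f w\<bar> \<le> M" by (rule cusp_part_bounded[OF modular]) blast
  define a where "a = 1 / sqrt Y"
  have a_bounds: "0 < a" "a \<le> 1" "1 / a\<^sup>2 = Y" using cutoff(1) by (auto simp: a_def power_divide)
  have high: "?mean (1 / r\<^sup>2) = 0" if "0 < r" "r < a" for r
  proof -
    have "r\<^sup>2 < a\<^sup>2" using that by (intro power_strict_mono) auto
    hence "1 / a\<^sup>2 < 1 / r\<^sup>2" using that a_bounds(1) by (intro divide_strict_left_mono) auto
    thus ?thesis using cutoff(2) a_bounds(3) by (intro horocycle_mean_cusp_part_eq_0) auto
  qed
  have "(LINT r:{0<..<2}|lborel. r * ?mean (1 / r\<^sup>2)) =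
      (LINT r:{a..2}|lborel. r * ?mean (1 / r\<^sup>2))"
    unfolding set_lebesgue_integral_def
  proof (rule integral_cong_AE)
    show "AE r in lborel. indicator {0<..<2} r *\<^sub>R (r * ?mean (1 / r\<^sup>2)) =
        indicator {a..2} r *\<^sub>R (r * ?mean (1 / r\<^sup>2))"
      using AE_lborel_singleton[of 2]
      by eventually_elim (use high a_bounds in \<open>auto simp: indicator_def not_le\<close>)
  qed measurable
  also have "\<dots> = (LINT \<eta>:{1/2\<^sup>2..1/a\<^sup>2}|lborel. ?mean \<eta> / \<eta>\<^sup>2) / 2"
    using a_bounds horocycle_mean_bounded[OF bound]
    by (intro integral_inverse_square_substitution[where B = M]) auto
  also have "\<dots> = (LINT z:fund_dom|lborel. f z / (Im z)\<^sup>2) / 2"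
    using integral_fund_dom[OF modular cutoff(2)] a_bounds(3) by simp
  finally show ?thesis .
qed

subsection \<open>Sums over lattice points\<close>

definition orbit_point :: "real \<Rightarrow> real \<Rightarrow> real \<Rightarrow> complex" where
  "orbit_point v \<xi> s = Complex (\<xi> - v / s) (1 / s)"

lemma borel_measurable_orbit_point [measurable]:
  "(\<lambda>\<xi>. orbit_point v \<xi> s) \<in> borel_measurable borel"
  unfolding orbit_point_def by measurable

text \<open>For \<open>R = totatives\<close> and after rescaling \<open>y\<close> by \<open>1 + v\<^sup>2\<close>, this is the integrand at parameter \<open>v\<close>
  of the unfolded horocycle average. The constraint \<open>c\<^sup>2 y \<le> 4\<close> only discards vanishing terms.\<close>
definition lattice_sum :: "(complex \<Rightarrow> real) \<Rightarrow> (nat \<Rightarrow> nat set) \<Rightarrow> real \<Rightarrow> real \<Rightarrow> real" where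
  "lattice_sum f R v y = y * (\<Sum>c\<in>cusp_denominators y. \<Sum>a\<in>R c.
     cusp_part f (orbit_point v (real a / real c) ((real c)\<^sup>2 * y)))"

definition row_mean :: "(complex \<Rightarrow> real) \<Rightarrow> real \<Rightarrow> nat \<Rightarrow> real \<Rightarrow> real" where
  "row_mean f v c r =
    1 / real c * (\<Sum>a\<in>{0<..c}. cusp_part f (orbit_point v (real a / real c) (r\<^sup>2)))"

lemma row_mean_bounded:
  assumes bound: "\<And>w. \<bar>cusp_part f w\<bar> \<le> M"
  shows "\<bar>row_mean f v c r\<bar> \<le> M"
proof (cases "c = 0")
  case True
  thus ?thesis using bound[of 0] by (simp add: row_mean_def)
next
  case False
  have "\<bar>\<Sum>a\<in>{0<..c}. cusp_part f (orbit_point v (real a / real c) (r\<^sup>2))\<bar> \<le>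
      (\<Sum>a\<in>{0<..c}. M)"
    by (intro order_trans[OF sum_abs] sum_mono bound)
  thus ?thesis using False by (simp add: row_mean_def abs_mult pos_divide_le_eq mult.commute)
qed

lemma row_mean_tendsto:
  assumes modular: "f \<in> Cc_modular"
    and c_unbounded: "\<And>n. c n > 0" "filterlim c at_top sequentially"
    and r_tendsto: "r \<longlonglongrightarrow> \<rho>" "\<rho> > 0"
  shows "(\<lambda>n. row_mean f v (c n) (r n)) \<longlonglongrightarrow> horocycle_mean (cusp_part f) (1 / \<rho>\<^sup>2)"
proof -
  note [measurable] = cusp_part_measurable[OF modular]
  obtain M where bound: "\<And>w. \<bar>cusp_part f w\<bar> \<le> M" by (rule cusp_part_bounded[OF modular]) blast
  define \<phi> where "\<phi> = (\<lambda>n k. cusp_part f (orbit_point v (real k * (1 / real (c n))) ((r n)\<^sup>2)))"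
  let ?g = "\<lambda>\<xi>. cusp_part f (orbit_point v \<xi> (\<rho>\<^sup>2))"
  have "(\<lambda>n. 1 / real (c n) * (\<Sum>k | 0 < k \<and> real k * (1 / real (c n)) \<le> 1. \<phi> n k)) \<longlonglongrightarrow>
      (LINT \<xi>:{0<..<1}|lborel. ?g \<xi>)"
  proof (rule riemann_sum_tendsto[where B = M])
    have "filterlim (\<lambda>n. real (c n)) at_top sequentially"
      by (rule filterlim_compose[OF filterlim_real_sequentially c_unbounded(2)])
    thus "(\<lambda>n. 1 / real (c n)) \<longlonglongrightarrow> 0"
      by (intro tendsto_divide_0[OF tendsto_const] filterlim_at_top_imp_at_infinity)
    have "AE \<xi> in lborel. isCont (cusp_part f) (orbit_point v \<xi> (\<rho>\<^sup>2))"
      unfolding orbit_point_def using r_tendsto(2) by (intro AE_isCont_cusp_part modular) simp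
    thus "AE \<xi> in lborel. 0 < \<xi> \<longrightarrow> \<xi> < 1 \<longrightarrow> (\<forall>K. (\<forall>n. K n > 0) \<longrightarrow>
        (\<lambda>n. real (K n) * (1 / real (c n))) \<longlonglongrightarrow> \<xi> \<longrightarrow> (\<lambda>n. \<phi> n (K n)) \<longlonglongrightarrow> ?g \<xi>)"
    proof eventually_elim
      case (elim \<xi>)
      show ?case
      proof (intro impI allI)
        fix K :: "nat \<Rightarrow> nat" assume "(\<lambda>n. real (K n) * (1 / real (c n))) \<longlonglongrightarrow> \<xi>"
        hence "(\<lambda>n. orbit_point v (real (K n) * (1 / real (c n))) ((r n)\<^sup>2)) \<longlonglongrightarrow>
            orbit_point v \<xi> (\<rho>\<^sup>2)"
          unfolding orbit_point_def using r_tendsto by (intro tendsto_Complex tendsto_intros) auto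
        thus "(\<lambda>n. \<phi> n (K n)) \<longlonglongrightarrow> ?g \<xi>" unfolding \<phi>_def by (rule isCont_tendsto_compose[OF elim])
      qed
    qed
  qed (use c_unbounded(1) bound in \<open>simp_all add: \<phi>_def\<close>)
  moreover have "1 / real (c n) * (\<Sum>k | 0 < k \<and> real k * (1 / real (c n)) \<le> 1. \<phi> n k) =
      row_mean f v (c n) (r n)" for n
    unfolding unit_grid_eq[OF c_unbounded(1)] by (simp add: row_mean_def \<phi>_def)
  moreover have "(LINT \<xi>:{0<..<1}|lborel. ?g \<xi>) = (LINT \<xi>:{0<..1}|lborel. ?g \<xi>)"
    unfolding set_lebesgue_integral_def
  proof (rule integral_cong_AE)
    show "AE \<xi> in lborel. indicator {0<..<1} \<xi> *\<^sub>R ?g \<xi> = indicator {0<..1} \<xi> *\<^sub>R ?g \<xi>"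
      using AE_lborel_singleton[of 1] by eventually_elim (auto simp: indicator_def)
  qed measurable
  ultimately show ?thesis by (simp add: orbit_point_def horocycle_mean_shift_cusp_part[OF modular])
qed

lemma lattice_sum_eq_riemann_sum:
  assumes y_pos: "y > 0"
  shows "lattice_sum f (\<lambda>c. {0<..c}) v y =
    sqrt y * (\<Sum>c | 0 < c \<and> real c * sqrt y \<le> 2.
      real c * sqrt y * row_mean f v c (real c * sqrt y))"
proof -
  have "cusp_denominators y = {c. 0 < c \<and> real c * sqrt y \<le> 2}"
    using mem_cusp_denominators_sqrt[OF y_pos] by blast
  moreover have "y * (\<Sum>a\<in>{0<..c}. cusp_part f (orbit_point v (real a / real c) ((real c)\<^sup>2 * y))) =
      sqrt y * (real c * sqrt y * row_mean f v c (real c * sqrt y))" if "c > 0" for c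
  proof -
    have "y * S = sqrt y * (real c * sqrt y * (1 / real c * S))" for S
      using that y_pos by simp
    thus ?thesis using y_pos by (simp add: row_mean_def power_mult_distrib)
  qed
  ultimately show ?thesis by (simp add: lattice_sum_def sum_distrib_left)
qed

lemma lattice_sum_full_tendsto:
  fixes Y :: "nat \<Rightarrow> real"
  assumes modular: "f \<in> Cc_modular" and Y_null: "\<And>n. Y n > 0" "Y \<longlonglongrightarrow> 0"
  shows "(\<lambda>n. lattice_sum f (\<lambda>c. {0<..c}) v (Y n)) \<longlonglongrightarrow>
    (LINT r:{0<..<2}|lborel. r * horocycle_mean (cusp_part f) (1 / r\<^sup>2))"
proof -
  note [measurable] = cusp_part_measurable[OF modular]
  obtain M where bound: "\<And>w. \<bar>cusp_part f w\<bar> \<le> M" by (rule cusp_part_bounded[OF modular]) blast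
  define h where "h = (\<lambda>n. sqrt (Y n))"
  have h_null: "\<And>n. h n > 0" "h \<longlonglongrightarrow> 0"
    using Y_null(1) tendsto_real_sqrt[OF Y_null(2)] by (auto simp: h_def)
  have "(\<lambda>n. h n * (\<Sum>c | 0 < c \<and> real c * h n \<le> 2. real c * h n * row_mean f v c (real c * h n))) \<longlonglongrightarrow>
      (LINT r:{0<..<2}|lborel. r * horocycle_mean (cusp_part f) (1 / r\<^sup>2))"
  proof (rule riemann_sum_tendsto[OF h_null, where B = "2 * M"])
    show "\<bar>real c * h n * row_mean f v c (real c * h n)\<bar> \<le> 2 * M" if "real c * h n \<le> 2" for n c
      unfolding abs_mult using that h_null(1)[of n] row_mean_bounded[OF bound]
      by (intro mult_mono) (auto simp: abs_mult)
    show "AE r in lborel. 0 < r \<longrightarrow> r < 2 \<longrightarrow> (\<forall>K. (\<forall>n. K n > 0) \<longrightarrow> (\<lambda>n. real (K n) * h n) \<longlonglongrightarrow> r \<longrightarrow>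
        (\<lambda>n. real (K n) * h n * row_mean f v (K n) (real (K n) * h n)) \<longlonglongrightarrow>
            r * horocycle_mean (cusp_part f) (1 / r\<^sup>2))"
    proof (intro AE_I2 impI allI)
      fix r :: real and K :: "nat \<Rightarrow> nat"
      assume r_pos: "0 < r" and K_pos: "\<forall>n. K n > 0" and lim: "(\<lambda>n. real (K n) * h n) \<longlonglongrightarrow> r"
      have "filterlim (\<lambda>n. real (K n) * h n / h n) at_top sequentially"
        using h_null by (intro LIM_at_top_divide[OF lim r_pos]) auto
      moreover have "real (K n) * h n / h n = real (K n)" for n using h_null(1)[of n] by simp
      ultimately have "filterlim (\<lambda>n. real (K n)) at_top sequentially" by (simp only:)
      hence "filterlim K at_top sequentially"
        by (simp only: filterlim_sequentially_iff_filterlim_real)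
      thus "(\<lambda>n. real (K n) * h n * row_mean f v (K n) (real (K n) * h n)) \<longlonglongrightarrow>
          r * horocycle_mean (cusp_part f) (1 / r\<^sup>2)"
        using K_pos by (intro tendsto_mult lim row_mean_tendsto modular r_pos) auto
    qed
  qed measurable
  thus ?thesis using Y_null(1) by (simp add: lattice_sum_eq_riemann_sum h_def)
qed

lemma lattice_sum_bounded:
  assumes bound: "\<And>w. \<bar>cusp_part f w\<bar> \<le> M" and y_pos: "y > 0" and numerators: "\<And>c. R c \<subseteq> {0<..c}"
  shows "\<bar>lattice_sum f R v y\<bar> \<le> 4 * M"
proof -
  define N where "N = 2 / sqrt y"
  have "M \<ge> 0" using bound[of 0] by linarith
  have le_N: "real c \<le> N" if "c \<in> cusp_denominators y" for c
    using that y_pos by (simp add: N_def mem_cusp_denominators_sqrt pos_le_divide_eq)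
  hence "cusp_denominators y \<subseteq> {0<..nat \<lfloor>N\<rfloor>}"
    by (auto simp: le_nat_floor cusp_denominators_def)
  hence "card (cusp_denominators y) \<le> nat \<lfloor>N\<rfloor>" using card_mono[of "{0<..nat \<lfloor>N\<rfloor>}"] by simp
  moreover have "N \<ge> 0" using y_pos by (simp add: N_def)
  ultimately have card: "real (card (cusp_denominators y)) \<le> N" by linarith
  have "\<bar>\<Sum>c\<in>cusp_denominators y. \<Sum>a\<in>R c. cusp_part f (orbit_point v (real a / real c) ((real c)\<^sup>2 * y))\<bar>
      \<le> (\<Sum>c\<in>cusp_denominators y. \<Sum>a\<in>R c. M)"
    by (intro order_trans[OF sum_abs] sum_mono bound)
  also have "\<dots> \<le> (\<Sum>c\<in>cusp_denominators y. N * M)"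
  proof (rule sum_mono)
    fix c assume "c \<in> cusp_denominators y"
    moreover have "card (R c) \<le> c" using card_mono[OF _ numerators[of c]] by simp
    ultimately have "real (card (R c)) \<le> N" using le_N[of c] by linarith
    thus "(\<Sum>a\<in>R c. M) \<le> N * M" using \<open>M \<ge> 0\<close> by (simp add: mult_right_mono)
  qed
  also have "\<dots> \<le> N * (N * M)" using card \<open>M \<ge> 0\<close> \<open>N \<ge> 0\<close> by (simp add: mult_right_mono)
  finally have "\<bar>lattice_sum f R v y\<bar> \<le> y * (N * (N * M))"
    unfolding lattice_sum_def abs_mult using y_pos by (intro mult_mono) auto
  also have "\<dots> = 4 * M" using y_pos by (simp add: N_def)
  finally show ?thesis .
qed

lemma cusp_denominators_dvd_closed:
  assumes c_mem: "c \<in> cusp_denominators y" and divisor: "d dvd c" and y_pos: "y > 0"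
  shows "d \<in> cusp_denominators y"
proof -
  have "0 < d" "d \<le> c"
    using c_mem divisor by (auto simp: cusp_denominators_def dvd_imp_le intro!: Nat.gr0I)
  hence "(real d)\<^sup>2 * y \<le> (real c)\<^sup>2 * y" using y_pos by (intro mult_right_mono power_mono) auto
  thus ?thesis using c_mem \<open>0 < d\<close> by (simp add: cusp_denominators_def)
qed

lemma lattice_sum_dilates:
  assumes y_pos: "y > 0"
  shows "(\<lambda>d. lattice_sum f totatives v ((real d + 1)\<^sup>2 * y) / (real d + 1)\<^sup>2) sums
      lattice_sum f (\<lambda>c. {0<..c}) v y"
proof -
  define C where "C = cusp_denominators y"
  define G where "G = (\<lambda>c a. cusp_part f (orbit_point v (real a / real c) ((real c)\<^sup>2 * y)))"
  define T where "T = (\<lambda>d. \<Sum>c | d * c \<in> C. \<Sum>a\<in>totatives c. G (d * c) (a * d))"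
  have finite: "finite C" unfolding C_def by (rule finite_cusp_denominators[OF y_pos])
  have pos: "c > 0" if "c \<in> C" for c using that by (simp add: C_def cusp_denominators_def)
  have dvd_closed: "d \<in> C" if "c \<in> C" "d dvd c" for c d
    using that cusp_denominators_dvd_closed y_pos unfolding C_def by blast
  have dilate: "lattice_sum f totatives v ((real d)\<^sup>2 * y) / (real d)\<^sup>2 = y * T d"
    if d_pos: "d > 0" for d
  proof -
    have "cusp_denominators ((real d)\<^sup>2 * y) = {c. d * c \<in> C}"
      using d_pos by (auto simp: C_def cusp_denominators_def power_mult_distrib mult_ac)
    moreover have "cusp_part f (orbit_point v (real a / real c) ((real c)\<^sup>2 * ((real d)\<^sup>2 * y)))
        = G (d * c) (a * d)" for c a
      using d_pos by (simp add: G_def power_mult_distrib mult_ac)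
    ultimately show ?thesis using d_pos by (simp add: lattice_sum_def T_def)
  qed
  have T_eq_0: "T d = 0" if "d \<notin> C" for d
  proof -
    have "{c. d * c \<in> C} = {}" using that dvd_closed[of "d * _" d] by auto
    thus ?thesis by (simp only: T_def sum.empty)
  qed
  have image: "Suc ` {d. Suc d \<in> C} = C"
  proof (intro equalityI subsetI)
    fix c assume "c \<in> C"
    thus "c \<in> Suc ` {d. Suc d \<in> C}" using pos[of c] by (cases c) auto
  qed auto
  hence "finite {d. Suc d \<in> C}" using finite by (metis finite_imageD inj_Suc)
  hence "(\<lambda>d. y * T (Suc d)) sums (\<Sum>d | Suc d \<in> C. y * T (Suc d))"
    by (rule sums_finite) (simp add: T_eq_0)
  also have "(\<Sum>d | Suc d \<in> C. y * T (Suc d)) = y * (\<Sum>d\<in>C. T d)"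
    by (subst (2) image[symmetric]) (simp add: sum.reindex sum_distrib_left)
  also have "(\<Sum>d\<in>C. T d) = (\<Sum>c\<in>C. \<Sum>a\<in>{0<..c}. G c a)"
    unfolding T_def using finite pos dvd_closed by (intro sum_gcd_decomposition[symmetric]) auto
  also have "y * \<dots> = lattice_sum f (\<lambda>c. {0<..c}) v y" by (simp only: lattice_sum_def C_def G_def)
  finally show ?thesis using dilate[of "Suc _"] by (simp add: add.commute)
qed

lemma lattice_sum_primitive_tendsto:
  assumes modular: "f \<in> Cc_modular"
  shows "(lattice_sum f totatives v \<longlongrightarrow>
    6 / pi\<^sup>2 * (LINT r:{0<..<2}|lborel. r * horocycle_mean (cusp_part f) (1 / r\<^sup>2))) (at_right 0)"
proof -
  obtain M where bound: "\<And>w. \<bar>cusp_part f w\<bar> \<le> M" by (rule cusp_part_bounded[OF modular]) blast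
  show ?thesis
  proof (rule tendsto_of_dilated_sum)
    show "\<bar>lattice_sum f totatives v y\<bar> \<le> 4 * M" if "y > 0" for y
      using lattice_sum_bounded[OF bound that totatives_subset] .
    show "(\<lambda>d. lattice_sum f totatives v ((real d + 1)\<^sup>2 * y) / (real d + 1)\<^sup>2) sums
        lattice_sum f (\<lambda>c. {0<..c}) v y"
      if "y > 0" for y
      by (rule lattice_sum_dilates[OF that])
    show "(lattice_sum f (\<lambda>c. {0<..c}) v \<longlongrightarrow>
        (LINT r:{0<..<2}|lborel. r * horocycle_mean (cusp_part f) (1 / r\<^sup>2))) (at_right 0)"
      unfolding tendsto_at_iff_sequentially comp_def using lattice_sum_full_tendsto[OF modular]
      by auto
  qed
qed

subsection \<open>Equidistribution of long closed horocycles\<close>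

definition cusp_branch :: "(complex \<Rightarrow> real) \<Rightarrow> real \<Rightarrow> nat \<Rightarrow> int \<Rightarrow> real \<Rightarrow> real" where
  "cusp_branch f y c a s = cusp_part f (cusp_map c a (Complex s y))"

lemma cusp_branch_measurable:
  assumes "f \<in> Cc_modular"
  shows "cusp_branch f y c a \<in> borel_measurable borel"
proof -
  note [measurable] = cusp_part_measurable[OF assms]
  show ?thesis unfolding cusp_branch_def[abs_def] cusp_map_def by measurable
qed

lemma cusp_branch_eq_0:
  assumes c_pos: "c > 0" and y_bounds: "0 < y" "y < 1/5" and s_ge: "\<bar>s\<bar> \<ge> 1/2"
  shows "cusp_branch f y c a s = 0"
proof -
  have "(1/2)\<^sup>2 \<le> \<bar>s\<bar>\<^sup>2" using s_ge by (intro power_mono) auto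
  hence "1/4 \<le> s\<^sup>2 + y\<^sup>2" by (simp add: power2_eq_square add_increasing2)
  moreover have "(real c)\<^sup>2 \<ge> 1" using c_pos by (intro one_le_power) auto
  ultimately have "1 * (1/4) \<le> (real c)\<^sup>2 * (s\<^sup>2 + y\<^sup>2)" by (intro mult_mono) auto
  hence "y / ((real c)\<^sup>2 * (s\<^sup>2 + y\<^sup>2)) \<le> y / (1/4)"
    using y_bounds by (intro divide_left_mono) auto
  also have "y / (1/4) \<le> 4/5" using y_bounds by simp
  finally show ?thesis
    unfolding cusp_branch_def cusp_map_Complex[OF c_pos y_bounds(1)]
    by (intro cusp_part_eq_0_low) simp
qed

lemma cusp_branch_integrable:
  assumes modular: "f \<in> Cc_modular" and c_pos: "c > 0" and y_bounds: "0 < y" "y < 1/5"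
  shows "integrable lborel (cusp_branch f y c a)"
proof -
  obtain M where bound: "\<And>w. \<bar>cusp_part f w\<bar> \<le> M" by (rule cusp_part_bounded[OF modular]) blast
  have "set_integrable lborel {-1/2..1/2} (cusp_branch f y c a)"
    using bound
    by (intro set_integrable_lborel_bounded[where B = M] cusp_branch_measurable modular)
      (auto simp: cusp_branch_def)
  moreover have "indicator {-1/2..1/2} s *\<^sub>R cusp_branch f y c a s = cusp_branch f y c a s" for s
    using cusp_branch_eq_0[OF c_pos y_bounds, of s f a]
    by (cases "1/2 \<le> \<bar>s\<bar>") (auto simp: indicator_def)
  ultimately show ?thesis by (simp only: set_integrable_def)
qed

lemma sum_integral_unit_shifts:
  fixes G :: "real \<Rightarrow> real"
  assumes G_integrable: "integrable lborel G" and supp: "\<And>s. \<bar>s\<bar> \<ge> 1/2 \<Longrightarrow> G s = 0"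
    and \<theta>_bounds: "0 \<le> \<theta>" "\<theta> \<le> 1"
  shows "(\<Sum>k<3. LINT t:{0<..1}|lborel. G (t + (\<theta> - real k))) = integral\<^sup>L lborel G"
proof -
  define I where "I = (\<lambda>k::nat. {0 + (\<theta> - real k)<..1 + (\<theta> - real k)})"
  have integrable: "integrable lborel (\<lambda>s. indicator (I k) s *\<^sub>R G s)" for k
    using integrable_mult_indicator[OF _ G_integrable, of "I k"] by (simp add: I_def)
  have "(\<Sum>k<3. LINT t:{0<..1}|lborel. G (t + (\<theta> - real k))) =
      (\<Sum>k<3. LINT s|lborel. indicator (I k) s *\<^sub>R G s)"
    unfolding set_integral_shift_Ioc unfolding I_def set_lebesgue_integral_def ..
  also have "\<dots> = (LINT s|lborel. (\<Sum>k<3. indicator (I k) s *\<^sub>R G s))"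
    by (rule Bochner_Integration.integral_sum[symmetric]) (rule integrable)
  also have "\<dots> = integral\<^sup>L lborel G"
  proof (rule Bochner_Integration.integral_cong[OF refl])
    fix s
    show "(\<Sum>k<3. indicator (I k) s *\<^sub>R G s) = G s"
    proof (cases "\<bar>s\<bar> \<ge> 1/2")
      case False
      hence "(\<Sum>k<3. indicator (I k) s :: real) = 1"
        using \<theta>_bounds by (auto simp: eval_nat_numeral I_def indicator_def)
      thus ?thesis by (simp flip: sum_distrib_right)
    qed (simp add: supp)
  qed
  finally show ?thesis .
qed

lemma modular_inverse_cong:
  fixes D D' :: int
  assumes "c > 0" "[D = D'] (mod c)"
  shows "modular_inverse c D = modular_inverse c D'"
proof (cases "coprime D c")
  case True
  hence D'_coprime: "coprime D' c" using assms(2) by (rule cong_imp_coprime[rotated])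
  have "[D * modular_inverse c D' = D' * modular_inverse c D'] (mod c)"
    using assms(2) by (rule cong_scalar_right)
  also have "[D' * modular_inverse c D' = 1] (mod c)"
    by (rule cong_modular_inverse1[OF D'_coprime])
  finally show ?thesis
    using assms(1)
    by (intro modular_inverse_int_eqI)
      (auto simp: modular_inverse_int_nonneg modular_inverse_int_less)
next
  case False
  hence "\<not> coprime D' c" using assms(2) cong_imp_coprime cong_sym by blast
  thus ?thesis using False by simp
qed

lemma horocycle_mean_eq_sum_bottom_rows:
  assumes modular: "f \<in> Cc_modular" and y_bounds: "0 < y" "y < 1/5"
  shows "horocycle_mean f y = (\<Sum>c\<in>cusp_denominators y.
    \<Sum>D\<in>bottom_rows c.
      LINT t:{0<..1}|lborel. cusp_branch f y c (modular_inverse (int c) D) (t + of_int D / real c))"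
proof -
  let ?B = "\<lambda>c D t. cusp_branch f y c (modular_inverse (int c) D) (t + of_int D / real c)"
  have integrable: "integrable lborel (\<lambda>t. indicator {0<..1} t *\<^sub>R ?B c D t)"
    if "c \<in> cusp_denominators y" for c D
  proof -
    have "c > 0" using that by (simp add: cusp_denominators_def)
    hence "integrable lborel (\<lambda>t.
        cusp_branch f y c (modular_inverse (int c) D) (of_int D / real c + 1 * t))"
      by (intro lborel_integrable_real_affine cusp_branch_integrable modular y_bounds) simp_all
    thus ?thesis by (intro integrable_mult_indicator) (simp_all add: add.commute)
  qed
  have "horocycle_mean f y = (LINT t|lborel.
      (\<Sum>c\<in>cusp_denominators y. \<Sum>D\<in>bottom_rows c. indicator {0<..1} t *\<^sub>R ?B c D t))"
    unfolding horocycle_mean_def set_lebesgue_integral_def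
  proof (rule integral_cong_AE)
    have "AE t in lborel. t \<notin> horocycle_ties y"
      by (intro AE_not_in countable_imp_null_set_lborel countable_horocycle_ties)
    thus "AE t in lborel. indicator {0<..1} t *\<^sub>R f (Complex t y) =
        (\<Sum>c\<in>cusp_denominators y. \<Sum>D\<in>bottom_rows c. indicator {0<..1} t *\<^sub>R ?B c D t)"
    proof eventually_elim
      case (elim t)
      show ?case
        using horocycle_unfolding[OF modular y_bounds, of t] elim
        by (cases "t \<in> {0<..1}") (simp_all add: cusp_branch_def)
    qed
    show "(\<lambda>t. indicator {0<..1} t *\<^sub>R f (Complex t y)) \<in> borel_measurable lborel"
      using Cc_modular_horocycle_measurable[OF modular y_bounds(1), of 0] by simp
    show "(\<lambda>t. \<Sum>c\<in>cusp_denominators y. \<Sum>D\<in>bottom_rows c. indicator {0<..1} t *\<^sub>R ?B c D t)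
        \<in> borel_measurable lborel"
      by (intro borel_measurable_sum borel_measurable_integrable integrable)
  qed
  also have "\<dots> = (\<Sum>c\<in>cusp_denominators y. \<Sum>D\<in>bottom_rows c. LINT t:{0<..1}|lborel. ?B c D t)"
    unfolding set_lebesgue_integral_def by (intro integral_double_sum integrable)
  finally show ?thesis .
qed

text \<open>The translates of \<open>{0<..1}\<close> by the lifts of one residue class tile the support of its branch.\<close>
lemma sum_bottom_rows_eq_sum_branches:
  assumes modular: "f \<in> Cc_modular" and y_bounds: "0 < y" "y < 1/5" and c_pos: "c > 0"
  shows "(\<Sum>D\<in>bottom_rows c.
      LINT t:{0<..1}|lborel. cusp_branch f y c (modular_inverse (int c) D) (t + of_int D / real c)) =
    (\<Sum>a\<in>totatives c. integral\<^sup>L lborel (cusp_branch f y c (int a)))"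
proof -
  define J where "J = (\<lambda>D.
    LINT t:{0<..1}|lborel. cusp_branch f y c (modular_inverse (int c) D) (t + of_int D / real c))"
  have J_eq: "J (int d - int k * int c) = (LINT t:{0<..1}|lborel.
      cusp_branch f y c (modular_inverse (int c) (int d)) (t + (real d / real c - real k)))"
        for d k
  proof -
    have "modular_inverse (int c) (int d - int k * int c) = modular_inverse (int c) (int d)"
      using c_pos by (intro modular_inverse_cong) (simp_all add: cong_iff_dvd_diff)
    moreover have "of_int (int d - int k * int c) / real c = real d / real c - real k"
      using c_pos by (simp add: diff_divide_distrib)
    ultimately show ?thesis by (simp only: J_def)
  qed
  have "(\<Sum>D\<in>bottom_rows c. J D) =
      (\<Sum>d\<in>totatives c. \<Sum>k<3. J (int d - int k * int c))"
    unfolding bottom_rows_def by (subst sum_coprime_periods) (rule sum.swap)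
  also have "\<dots> = (\<Sum>d\<in>totatives c.
      integral\<^sup>L lborel (cusp_branch f y c (1 * modular_inverse (int c) (int d))))"
  proof (rule sum.cong[OF refl])
    fix d assume "d \<in> totatives c"
    hence "0 \<le> real d / real c" "real d / real c \<le> 1" using c_pos by (auto simp: in_totatives_iff)
    thus "(\<Sum>k<3. J (int d - int k * int c)) =
        integral\<^sup>L lborel (cusp_branch f y c (1 * modular_inverse (int c) (int d)))"
      unfolding J_eq mult_1
      by (intro sum_integral_unit_shifts cusp_branch_integrable modular c_pos y_bounds)
        (rule cusp_branch_eq_0[OF c_pos y_bounds])
  qed
  also have "\<dots> = (\<Sum>a\<in>totatives c. integral\<^sup>L lborel (cusp_branch f y c (int a)))"
  proof (rule sum_totatives_inverse[OF c_pos])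
    fix k l assume "[k = l] (mod int c)"
    thus "integral\<^sup>L lborel (cusp_branch f y c k) = integral\<^sup>L lborel (cusp_branch f y c l)"
      unfolding cusp_branch_def by (simp only: cusp_part_cusp_map_cong[OF modular c_pos])
  qed simp
  finally show ?thesis by (simp only: J_def)
qed

lemma horocycle_mean_eq_sum_branches:
  assumes modular: "f \<in> Cc_modular" and y_bounds: "0 < y" "y < 1/5"
  shows "horocycle_mean f y =
    (\<Sum>c\<in>cusp_denominators y. \<Sum>a\<in>totatives c. integral\<^sup>L lborel (cusp_branch f y c (int a)))"
  unfolding horocycle_mean_eq_sum_bottom_rows[OF modular y_bounds]
  by (intro sum.cong refl sum_bottom_rows_eq_sum_branches modular y_bounds)
    (simp add: cusp_denominators_def)

lemma lattice_sum_eq_sum_branches: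
  assumes y_pos: "y > 0"
  shows "lattice_sum f totatives u (y * (1 + u\<^sup>2)) / (1 + u\<^sup>2) =
    (\<Sum>c\<in>cusp_denominators y. \<Sum>a\<in>totatives c. y * cusp_branch f y c (int a) (y * u))"
proof -
  have factor_pos: "1 + u\<^sup>2 > 0" by (simp add: add_pos_nonneg)
  define Y where "Y = y * (1 + u\<^sup>2)"
  let ?K = "\<lambda>c a. cusp_part f (orbit_point u (real a / real c) ((real c)\<^sup>2 * Y))"
  have branch: "cusp_branch f y c (int a) (y * u) = ?K c a" if "c > 0" for c a
  proof -
    have "(y * u)\<^sup>2 + y\<^sup>2 = y * Y" by (simp add: Y_def power2_eq_square algebra_simps)
    hence "y * u / ((real c)\<^sup>2 * ((y * u)\<^sup>2 + y\<^sup>2)) = u / ((real c)\<^sup>2 * Y)"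
      "y / ((real c)\<^sup>2 * ((y * u)\<^sup>2 + y\<^sup>2)) = 1 / ((real c)\<^sup>2 * Y)" using y_pos by simp_all
    thus ?thesis
      unfolding cusp_branch_def cusp_map_Complex[OF that y_pos] orbit_point_def by simp
  qed
  have "lattice_sum f totatives u Y / (1 + u\<^sup>2) =
      y * (\<Sum>c\<in>cusp_denominators Y. \<Sum>a\<in>totatives c. ?K c a)"
    using factor_pos by (simp add: lattice_sum_def Y_def)
  also have "(\<Sum>c\<in>cusp_denominators Y. \<Sum>a\<in>totatives c. ?K c a) =
      (\<Sum>c\<in>cusp_denominators y. \<Sum>a\<in>totatives c. ?K c a)"
  proof (rule sum.mono_neutral_left)
    show "finite (cusp_denominators y)" by (rule finite_cusp_denominators[OF y_pos])
    have "(real c)\<^sup>2 * y \<le> (real c)\<^sup>2 * Y" for c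
      using y_pos by (intro mult_left_mono) (auto simp: Y_def)
    thus "cusp_denominators Y \<subseteq> cusp_denominators y"
      by (auto simp: cusp_denominators_def intro: order_trans)
    show "\<forall>c\<in>cusp_denominators y - cusp_denominators Y. (\<Sum>a\<in>totatives c. ?K c a) = 0"
    proof
      fix c assume "c \<in> cusp_denominators y - cusp_denominators Y"
      hence "(real c)\<^sup>2 * Y > 4" by (auto simp: cusp_denominators_def)
      hence "1 / ((real c)\<^sup>2 * Y) \<le> 1 / 4" by (intro divide_left_mono) auto
      hence "?K c a = 0" for a by (intro cusp_part_eq_0_low) (simp add: orbit_point_def)
      thus "(\<Sum>a\<in>totatives c. ?K c a) = 0" by simp
    qed
  qed
  also have "\<dots> = (\<Sum>c\<in>cusp_denominators y. \<Sum>a\<in>totatives c. cusp_branch f y c (int a) (y * u))"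
    by (intro sum.cong refl) (simp add: branch cusp_denominators_def)
  finally show ?thesis by (simp only: Y_def sum_distrib_left)
qed

lemma horocycle_mean_eq_integral_lattice_sum:
  assumes modular: "f \<in> Cc_modular" and y_bounds: "0 < y" "y < 1/5"
  shows "horocycle_mean f y =
      (LINT u|lborel. lattice_sum f totatives u (y * (1 + u\<^sup>2)) / (1 + u\<^sup>2))"
proof -
  have integrable: "integrable lborel (\<lambda>u. y * cusp_branch f y c a (y * u))"
    if "c \<in> cusp_denominators y" for c a
    using that lborel_integrable_real_affine[OF cusp_branch_integrable[OF modular _ y_bounds], of
        c y a 0] y_bounds(1)
    by (intro integrable_mult_right) (simp add: cusp_denominators_def)
  have "integral\<^sup>L lborel (cusp_branch f y c a) =
      (LINT u|lborel. y * cusp_branch f y c a (y * u))" for c a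
    using y_bounds(1) by (subst lborel_integral_real_affine[of y _ 0]) auto
  hence "horocycle_mean f y =
      (\<Sum>c\<in>cusp_denominators y. \<Sum>a\<in>totatives c.
        LINT u|lborel. y * cusp_branch f y c (int a) (y * u))"
    by (simp only: horocycle_mean_eq_sum_branches[OF modular y_bounds])
  also have "\<dots> = (LINT u|lborel.
      (\<Sum>c\<in>cusp_denominators y. \<Sum>a\<in>totatives c. y * cusp_branch f y c (int a) (y * u)))"
    by (intro integral_double_sum[symmetric] integrable)
  finally show ?thesis by (simp only: lattice_sum_eq_sum_branches[OF y_bounds(1)])
qed

lemma lattice_sum_rescaled_tendsto:
  assumes modular: "f \<in> Cc_modular" and X_null: "\<And>n. X n > 0" "X \<longlonglongrightarrow> 0"
  shows "(\<lambda>n. lattice_sum f totatives u (X n * (1 + u\<^sup>2))) \<longlonglongrightarrow>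
    6 / pi\<^sup>2 * (LINT r:{0<..<2}|lborel. r * horocycle_mean (cusp_part f) (1 / r\<^sup>2))"
proof (rule filterlim_compose[OF lattice_sum_primitive_tendsto[OF modular]])
  have "(\<lambda>n. X n * (1 + u\<^sup>2)) \<longlonglongrightarrow> 0 * (1 + u\<^sup>2)" by (intro tendsto_mult X_null(2) tendsto_const)
  moreover have "X n * (1 + u\<^sup>2) > 0" for n using X_null(1) by (simp add: add_pos_nonneg)
  ultimately show "filterlim (\<lambda>n. X n * (1 + u\<^sup>2)) (at_right 0) sequentially"
    by (intro tendsto_imp_filterlim_at_right always_eventually) auto
qed

lemma integral_lattice_sum_tendsto:
  assumes modular: "f \<in> Cc_modular" and X_null: "\<And>n. X n > 0" "X \<longlonglongrightarrow> 0"
  shows "(\<lambda>n. LINT u|lborel. lattice_sum f totatives u (X n * (1 + u\<^sup>2)) / (1 + u\<^sup>2)) \<longlonglongrightarrow>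
      mu_M_integral f"
proof -
  obtain M where bound: "\<And>w. \<bar>cusp_part f w\<bar> \<le> M" by (rule cusp_part_bounded[OF modular]) blast
  define L where "L =
    6 / pi\<^sup>2 * (LINT r:{0<..<2}|lborel. r * horocycle_mean (cusp_part f) (1 / r\<^sup>2))"
  have pos: "1 + u\<^sup>2 > 0" for u :: real by (simp add: add_pos_nonneg)
  have "(\<lambda>n. LINT u|lborel. lattice_sum f totatives u (X n * (1 + u\<^sup>2)) / (1 + u\<^sup>2)) \<longlonglongrightarrow>
      (LINT u|lborel. L * (1 / (1 + u\<^sup>2)))"
  proof (rule integral_dominated_convergence[where w = "\<lambda>u. 4 * M * (1 / (1 + u\<^sup>2))"])
    note [measurable] = cusp_branch_measurable[OF modular]
    show "(\<lambda>u. lattice_sum f totatives u (X n * (1 + u\<^sup>2)) / (1 + u\<^sup>2)) \<in> borel_measurable lborel"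
      for n
      unfolding lattice_sum_eq_sum_branches[OF X_null(1)] by measurable
    show "integrable lborel (\<lambda>u. 4 * M * (1 / (1 + u\<^sup>2)))"
      by (intro integrable_mult_right integral_inverse_1_plus_square_real)
    show "AE u in lborel. norm (lattice_sum f totatives u (X n * (1 + u\<^sup>2)) / (1 + u\<^sup>2)) \<le>
        4 * M * (1 / (1 + u\<^sup>2))" for n
      using pos X_null(1) lattice_sum_bounded[OF bound _ totatives_subset]
      by (intro AE_I2) (simp add: abs_divide divide_right_mono)
    show "AE u in lborel. (\<lambda>n. lattice_sum f totatives u (X n * (1 + u\<^sup>2)) / (1 + u\<^sup>2)) \<longlonglongrightarrow>
        L * (1 / (1 + u\<^sup>2))"
    proof (rule AE_I2)
      fix u :: real
      have "(\<lambda>n. lattice_sum f totatives u (X n * (1 + u\<^sup>2))) \<longlonglongrightarrow> L"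
        unfolding L_def by (rule lattice_sum_rescaled_tendsto[OF modular X_null])
      from tendsto_divide[OF this tendsto_const[of "1 + u\<^sup>2"]] pos[of u]
      show "(\<lambda>n. lattice_sum f totatives u (X n * (1 + u\<^sup>2)) / (1 + u\<^sup>2)) \<longlonglongrightarrow> L * (1 / (1 + u\<^sup>2))"
        by simp
    qed
  qed measurable
  also have "(LINT u|lborel. L * (1 / (1 + u\<^sup>2))) = L * pi"
    by (subst integral_mult_right_zero) (simp only: integral_inverse_1_plus_square_real)
  also have "L * pi = mu_M_integral f"
    unfolding L_def integral_horocycle_mean_cusp_part[OF modular] mu_M_integral_def
    by (simp add: power2_eq_square)
  finally show ?thesis .
qed

lemma long_horocycles_equidistribute:
  assumes modular: "f \<in> Cc_modular"
  shows "(horocycle_mean f \<longlongrightarrow> mu_M_integral f) (at_right 0)"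
  unfolding tendsto_at_iff_sequentially comp_def
proof (intro allI impI)
  fix X :: "nat \<Rightarrow> real" assume "\<forall>i. X i \<in> {0<..} - {0}" and lim: "X \<longlonglongrightarrow> 0"
  hence X_pos: "X n > 0" for n by simp
  have "eventually (\<lambda>n. X n < 1/5) sequentially" using lim by (rule order_tendstoD) simp
  hence "eventually (\<lambda>n.
      (LINT u|lborel. lattice_sum f totatives u (X n * (1 + u\<^sup>2)) / (1 + u\<^sup>2)) =
      horocycle_mean f (X n)) sequentially"
    by eventually_elim (simp add: horocycle_mean_eq_integral_lattice_sum[OF modular X_pos])
  with integral_lattice_sum_tendsto[OF modular X_pos lim] show "(\<lambda>n. horocycle_mean f (X n)) \<longlonglongrightarrow>
      mu_M_integral f"
    by (rule Lim_transform_eventually)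
qed

subsection \<open>Equidistribution of dense primitive points\<close>

lemma Cc_modular_fraction_cong:
  assumes modular: "f \<in> Cc_modular" and y_pos: "y > 0" and m_pos: "m > 0"
    and cong: "[k = l] (mod int m)"
  shows "f (Complex (x + of_int k / real m) y) = f (Complex (x + of_int l / real m) y)"
proof -
  obtain n where "k = l + int m * n" using cong_sym[OF cong] unfolding cong_iff_lin by (elim exE)
  hence "x + of_int k / real m = (x + of_int l / real m) + of_int n"
    using m_pos by (simp add: add_divide_distrib)
  thus ?thesis by (simp only: Cc_modular_Complex_add_int[OF modular y_pos])
qed

lemma delta_integral_eq:
  assumes modular: "f \<in> Cc_modular" and y_pos: "y > 0" and n_pos: "n > 0"
  shows "delta_integral n x y f = (\<Sum>j\<in>{0<..n}. f (Complex (x + real j / real n) y)) / real n"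
proof -
  have "f (Complex (x + real 0 / real n) y) = f (Complex (x + real n / real n) y)"
    using Cc_modular_fraction_cong[OF modular y_pos n_pos, of 0 "int n" x] by (simp add: cong_def)
  from sum_residues_zero_to_modulus[OF n_pos this, of "\<lambda>_. True"]
  have "(\<Sum>j\<in>{..<n}. f (Complex (x + real j / real n) y)) =
      (\<Sum>j\<in>{0<..n}. f (Complex (x + real j / real n) y))"
    by (simp only: simp_thms Collect_mem_eq lessThan_def)
  thus ?thesis by (simp add: delta_integral_def)
qed

lemma delta_pr_integral_eq:
  assumes modular: "f \<in> Cc_modular" and y_pos: "y > 0" and m_pos: "m > 0"
  shows "delta_pr_integral m x y f =
      (\<Sum>j\<in>totatives m. f (Complex (x + real j / real m) y)) / real (totient m)"
proof -
  have "f (Complex (x + real 0 / real m) y) = f (Complex (x + real m / real m) y)"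
    using Cc_modular_fraction_cong[OF modular y_pos m_pos, of 0 "int m" x] by (simp add: cong_def)
  from sum_residues_zero_to_modulus[OF m_pos this, of "\<lambda>j. coprime j m"] show ?thesis
    by (simp add: delta_pr_integral_def totatives_def)
qed

lemma delta_pr_integral_bounded:
  assumes modular: "f \<in> Cc_modular" and bound: "\<And>z. Im z > 0 \<Longrightarrow> \<bar>f z\<bar> \<le> M" and y_pos: "y > 0"
    and m_pos: "m > 0"
  shows "\<bar>delta_pr_integral m x y f\<bar> \<le> M"
proof -
  have "\<bar>\<Sum>j\<in>totatives m. f (Complex (x + real j / real m) y)\<bar> \<le> (\<Sum>j\<in>totatives m. M)"
    using y_pos by (intro order_trans[OF sum_abs] sum_mono bound) simp
  also have "\<dots> = real (totient m) * M" by (simp add: totient_def)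
  finally show ?thesis using m_pos
    by (simp add: delta_pr_integral_eq[OF modular y_pos m_pos] abs_divide
        pos_divide_le_eq mult.commute)
qed

lemma delta_pr_integral_error_le:
  assumes modular: "f \<in> Cc_modular" and bound: "\<And>z. Im z > 0 \<Longrightarrow> \<bar>f z\<bar> \<le> M" and y_pos: "y > 0"
    and m_pos: "m > 0" and N_pos: "N > 0"
    and osc: "\<And>t t'. \<bar>t - t'\<bar> \<le> 1 / real N \<Longrightarrow> \<bar>f (Complex t y) - f (Complex t' y)\<bar> \<le> e"
  shows "\<bar>delta_pr_integral m x y f - horocycle_mean f y\<bar> \<le>
    2 * e + real N * real (divisor_count m) * M / real (totient m)"
proof -
  define F where "F = (\<lambda>t. f (Complex (x + t) y))"
  define w where "w = real (totient m)"
  have w_pos: "w > 0" using m_pos by (simp add: w_def)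
  have F_bounded: "F \<in> borel_measurable borel" "\<And>t. \<bar>F t\<bar> \<le> M"
    unfolding F_def using Cc_modular_horocycle_measurable[OF modular y_pos] bound y_pos
    by simp_all
  have "\<bar>F t - F t'\<bar> \<le> e" if "\<bar>t - t'\<bar> \<le> 1 / real N" for t t'
    unfolding F_def using that by (intro osc) simp
  from sum_totatives_error_le[OF F_bounded m_pos N_pos this]
  have "\<bar>(\<Sum>j\<in>totatives m. F (real j / real m)) - w * horocycle_mean f y\<bar>
      \<le> 2 * e * w + real N * real (divisor_count m) * M"
    using horocycle_mean_shift_Cc_modular[OF modular y_pos, of x]
    by (simp add: F_def w_def add.commute)
  moreover have "delta_pr_integral m x y f - horocycle_mean f y =
      ((\<Sum>j\<in>totatives m. F (real j / real m)) - w * horocycle_mean f y) / w"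
    using w_pos
    by (simp add: delta_pr_integral_eq[OF modular y_pos m_pos] F_def w_def diff_divide_distrib)
  ultimately show ?thesis
    using w_pos by (simp add: abs_divide pos_divide_le_eq distrib_right flip: w_def)
qed

lemma exists_fine_grid:
  fixes a \<delta> y :: real
  assumes \<delta>_pos: "\<delta> > 0" and a_pos: "a > 0" and m_pos: "m > 0" and y_ge: "real m powr (-a) \<le> y"
  obtains N :: nat where "N > 0" "1 / real N \<le> \<delta> * y" "real N \<le> (1 / \<delta> + 1) * real m powr a"
proof -
  have powr_pos: "real m powr (-a) > 0" using m_pos by simp
  hence "y > 0" using y_ge by linarith
  define N where "N = nat \<lceil>1 / (\<delta> * y)\<rceil>"
  have "1 / (\<delta> * y) > 0" using \<delta>_pos \<open>y > 0\<close> by simp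
  hence grid: "N > 0" "1 / (\<delta> * y) \<le> real N" "real N \<le> 1 / (\<delta> * y) + 1"
    unfolding N_def by linarith+
  have "1 / real N \<le> \<delta> * y" using grid(1,2) \<delta>_pos \<open>y > 0\<close> by (simp add: field_simps)
  moreover have "1 / y \<le> 1 / real m powr (-a)"
    using powr_pos y_ge \<open>y > 0\<close> by (intro divide_left_mono) auto
  hence "1 / \<delta> * (1 / y) \<le> 1 / \<delta> * real m powr a"
    using \<delta>_pos by (intro mult_left_mono) (simp_all add: powr_minus_divide)
  moreover have "1 \<le> real m powr a" using m_pos a_pos by (intro ge_one_powr_ge_zero) auto
  ultimately show thesis using grid(1,3) by (intro that[of N]) (simp_all add: distrib_right)
qed

lemma primitive_points_near_horocycle_mean:
  fixes a :: real
  assumes modular: "f \<in> Cc_modular" and a_bounds: "0 < a" "a < 1" and \<epsilon>_pos: "\<epsilon> > 0"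
  obtains m0 :: nat where "\<And>m x y. m \<ge> m0 \<Longrightarrow> real m powr (-a) \<le> y \<Longrightarrow>
    \<bar>delta_pr_integral m x y f - horocycle_mean f y\<bar> \<le> \<epsilon>"
proof -
  obtain M where bound: "M > 0" "\<And>z. Im z > 0 \<Longrightarrow> \<bar>f z\<bar> \<le> M"
    by (rule Cc_modular_bounded[OF modular]) blast
  have "\<epsilon> / 4 > 0" using \<epsilon>_pos by simp
  then obtain \<delta> where modulus: "\<delta> > 0"
    "\<And>t t' y. y > 0 \<Longrightarrow> \<bar>t - t'\<bar> \<le> \<delta> * y \<Longrightarrow> \<bar>f (Complex t y) - f (Complex t' y)\<bar> < \<epsilon> / 4"
    using Cc_modular_horocycle_uniformly_continuous[OF modular] by metis
  define K where "K = (1 / \<delta> + 1) * M"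
  have "(\<lambda>m. K * (real m powr a * real (divisor_count m) / real (totient m))) \<longlonglongrightarrow> K * 0"
    by (intro tendsto_mult tendsto_const powr_mult_divisor_count_over_totient_tendsto_0 a_bounds)
  moreover have "K * 0 < \<epsilon> / 2" using \<epsilon>_pos by simp
  ultimately have "eventually (\<lambda>m.
      K * (real m powr a * real (divisor_count m) / real (totient m)) < \<epsilon> / 2) sequentially"
    by (rule order_tendstoD)
  then obtain m1 where main_term_small: "\<And>m. m \<ge> m1 \<Longrightarrow>
      K * (real m powr a * real (divisor_count m) / real (totient m)) < \<epsilon> / 2"
    by (auto simp: eventually_sequentially)
  show thesis
  proof (rule that[of "max 1 m1"])
    fix m :: nat and x y :: real
    assume "m \<ge> max 1 m1" and y_ge: "real m powr (-a) \<le> y"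
    hence m_large: "m > 0" "m \<ge> m1" by auto
    have "real m powr (-a) > 0" using m_large by simp
    hence y_pos: "y > 0" using y_ge by linarith
    obtain N where grid: "N > 0" "1 / real N \<le> \<delta> * y" "real N \<le> (1 / \<delta> + 1) * real m powr a"
      by (rule exists_fine_grid[OF modulus(1) a_bounds(1) m_large(1) y_ge])
    have osc: "\<bar>f (Complex t y) - f (Complex t' y)\<bar> \<le> \<epsilon> / 4" if "\<bar>t - t'\<bar> \<le> 1 / real N" for t t'
      by (rule less_imp_le[OF modulus(2)[OF y_pos order_trans[OF that grid(2)]]])
    have "real N * (real (divisor_count m) * M / real (totient m)) \<le>
        (1 / \<delta> + 1) * real m powr a * (real (divisor_count m) * M / real (totient m))"
      using grid(3) bound(1) by (intro mult_right_mono) auto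
    also have "\<dots> = K * (real m powr a * real (divisor_count m) / real (totient m))"
      by (simp add: K_def)
    also have "\<dots> < \<epsilon> / 2" by (rule main_term_small[OF m_large(2)])
    finally have "real N * real (divisor_count m) * M / real (totient m) < \<epsilon> / 2" by simp
    with delta_pr_integral_error_le[OF modular bound(2) y_pos m_large(1) grid(1) osc, of x]
    show "\<bar>delta_pr_integral m x y f - horocycle_mean f y\<bar> \<le> \<epsilon>" by linarith
  qed
qed

lemma primitive_equidistribution:
  fixes a :: real
  assumes modular: "f \<in> Cc_modular" and a_bounds: "0 < a" "a < 1" and \<epsilon>_pos: "\<epsilon> > 0"
  obtains m0 :: nat and y0 :: real where "y0 > 0"
    "\<And>m x y. m \<ge> m0 \<Longrightarrow> real m powr (-a) \<le> y \<Longrightarrow> y \<le> y0 \<Longrightarrow>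
        \<bar>delta_pr_integral m x y f - mu_M_integral f\<bar> \<le> \<epsilon>"
proof -
  have half_pos: "\<epsilon> / 2 > 0" using \<epsilon>_pos by simp
  obtain m0 where near_mean: "\<And>m x y. m \<ge> m0 \<Longrightarrow> real m powr (-a) \<le> y \<Longrightarrow>
      \<bar>delta_pr_integral m x y f - horocycle_mean f y\<bar> \<le> \<epsilon> / 2"
    using primitive_points_near_horocycle_mean[OF modular a_bounds half_pos] by blast
  have "eventually (\<lambda>y. dist (horocycle_mean f y) (mu_M_integral f) < \<epsilon> / 2) (at_right 0)"
    by (rule tendstoD[OF long_horocycles_equidistribute[OF modular] half_pos])
  then obtain b where near_limit: "b > 0"
    "\<And>y. 0 < y \<Longrightarrow> y < b \<Longrightarrow> \<bar>horocycle_mean f y - mu_M_integral f\<bar> < \<epsilon> / 2"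
    by (auto simp: eventually_at_right_field dist_real_def)
  show thesis
  proof (rule that[of "b / 2" "max 1 m0"])
    fix m :: nat and x y :: real
    assume m_large: "m \<ge> max 1 m0" and y_bounds: "real m powr (-a) \<le> y" "y \<le> b / 2"
    have "real m powr (-a) > 0" using m_large by simp
    hence "0 < y" "y < b" using y_bounds near_limit(1) by linarith+
    hence "\<bar>horocycle_mean f y - mu_M_integral f\<bar> < \<epsilon> / 2" by (rule near_limit(2))
    moreover have "\<bar>delta_pr_integral m x y f - horocycle_mean f y\<bar> \<le> \<epsilon> / 2"
      using m_large y_bounds(1) by (intro near_mean) auto
    ultimately show "\<bar>delta_pr_integral m x y f - mu_M_integral f\<bar> \<le> \<epsilon>" by linarith
  qed (use near_limit in simp)
qed

subsection \<open>The duality of heights\<close>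

lemma Cc_modular_inversion:
  assumes modular: "f \<in> Cc_modular" and r_pos: "r > 0" and y_pos: "y > 0"
    and inverse: "[N * a = 1] (mod int r)"
  shows "f (Complex (of_int N / real r) y) =
      f (Complex (- of_int a / real r) (1 / ((real r)\<^sup>2 * y)))"
proof -
  have "int r dvd N * a - 1" using inverse by (simp only: cong_iff_dvd_diff)
  then obtain B where "N * a - 1 = int r * B" by (rule dvdE)
  hence det: "(- a) * (- N) - B * int r = 1" by (simp add: mult.commute)
  have Im_pos: "Im (Complex (of_int N / real r) y) > 0" using y_pos by simp
  have "Complex (of_int N / real r) y + of_int (- N) / of_nat r = Complex 0 y"
    by (simp add: complex_eq_iff)
  hence "sl2_act (- a) B (int r) (- N) (Complex (of_int N / real r) y) =
      cusp_map r (- a) (Complex 0 y)"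
    using sl2_act_eq_cusp_map[OF r_pos Im_pos det] by simp
  also have "\<dots> = Complex (- of_int a / real r) (1 / ((real r)\<^sup>2 * y))"
    using y_pos by (simp add: cusp_map_Complex[OF r_pos y_pos] power2_eq_square)
  finally show ?thesis using Cc_modular_act[OF modular det Im_pos] by simp
qed

definition dual_height :: "nat \<Rightarrow> nat \<Rightarrow> real \<Rightarrow> real" where
  "dual_height q m y = 1 / ((real q)\<^sup>2 * (real m)\<^sup>2 * y)"

lemma crt_inverse:
  fixes p q m j j' s u :: int
  assumes moduli_coprime: "coprime q m" and inverse_q: "[m * m * p * s = 1] (mod q)"
    and inverse_m: "[q * q * u = 1] (mod m)"
    and inverse_j: "[j * j' = 1] (mod m)"
  shows "[(p * m + j * q) * (m * s + q * u * j') = 1] (mod (q * m))"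
proof (rule coprime_cong_mult[OF _ _ moduli_coprime])
  have "(p * m + j * q) * (m * s + q * u * j') =
      m * m * p * s + q * (p * m * u * j' + j * (m * s + q * u * j'))"
    by (simp add: algebra_simps)
  thus "[(p * m + j * q) * (m * s + q * u * j') = 1] (mod q)"
    using inverse_q by (simp add: cong_def)
  have "(p * m + j * q) * (m * s + q * u * j') =
      (q * q * u) * (j * j') + m * (p * (m * s + q * u * j') + j * q * s)"
    by (simp add: algebra_simps)
  moreover have "[(q * q * u) * (j * j') = 1 * 1] (mod m)"
    by (rule cong_mult[OF inverse_m inverse_j])
  ultimately show "[(p * m + j * q) * (m * s + q * u * j') = 1] (mod m)" by (simp add: cong_def)
qed

lemma Cc_modular_dual_point:
  fixes p s u j' :: int and j q m :: nat
  assumes modular: "f \<in> Cc_modular" and q_pos: "q > 0" and m_pos: "m > 0" and y_pos: "y > 0"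
    and inverse:
      "[(p * int m + int j * int q) * (int m * s + int q * u * j') = 1] (mod (int q * int m))"
  shows "f (Complex (of_int p / real q + real j / real m) y) =
    f (Complex (- of_int s / real q + of_int (- u * j') / real m) (dual_height q m y))"
proof -
  have base_eq: "of_int p / real q + real j / real m =
      of_int (p * int m + int j * int q) / real (q * m)"
    using q_pos m_pos by (simp add: add_frac_eq)
  have image_eq: "- of_int s / real q + of_int (- u * j') / real m =
      - of_int (int m * s + int q * u * j') / real (q * m)"
    using q_pos m_pos by (simp add: field_simps)
  have height_eq: "dual_height q m y = 1 / ((real (q * m))\<^sup>2 * y)"
    by (simp add: dual_height_def power_mult_distrib)
  have "f (Complex (of_int (p * int m + int j * int q) / real (q * m)) y) =
      f (Complex (- of_int (int m * s + int q * u * j') / real (q * m)) (1 / ((real (q * m))\<^sup>2 * y)))"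
  proof (rule Cc_modular_inversion[OF modular _ y_pos])
    show "[(p * int m + int j * int q) * (int m * s + int q * u * j') = 1] (mod int (q * m))"
      using inverse by (simp only: of_nat_mult)
  qed (use q_pos m_pos in simp)
  thus ?thesis by (simp only: base_eq image_eq height_eq)
qed

text \<open>By the Chinese remainder theorem the inverse of \<open>p m + j q\<close> modulo \<open>q m\<close> is \<open>m s + q u j'\<close>, where
  \<open>j'\<close> is the inverse of \<open>j\<close> modulo \<open>m\<close> and \<open>s\<close>, \<open>u\<close> do not depend on \<open>j\<close>.\<close>
lemma modular_duality:
  fixes p :: int and q m :: nat
  assumes modular: "f \<in> Cc_modular" and q_pos: "q > 0" and m_pos: "m > 0"
    and moduli_coprime: "coprime q m" and reduced: "coprime p (int q)"
  obtains x where "\<And>y. y > 0 \<Longrightarrow>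
    delta_pr_integral m (of_int p / real q) y f = delta_pr_integral m x (dual_height q m y) f"
proof -
  define s where "s = modular_inverse (int q) (int m * int m * p)"
  define u where "u = modular_inverse (int m) (int q * int q)"
  let ?inv = "\<lambda>j. modular_inverse (int m) (int j)"
  have int_moduli_coprime: "coprime (int q) (int m)" "coprime (int m) (int q)"
    using moduli_coprime by (simp_all add: coprime_commute)
  have "[int m * int m * p * s = 1] (mod int q)" "[int q * int q * u = 1] (mod int m)"
    unfolding s_def u_def using int_moduli_coprime reduced by (auto intro!: cong_modular_inverse1)
  hence inverse:
    "[(p * int m + int j * int q) * (int m * s + int q * u * ?inv j) = 1] (mod (int q * int m))"
    if "j \<in> totatives m" for j
    using that
    by (intro crt_inverse int_moduli_coprime cong_modular_inverse1) (auto simp: in_totatives_iff)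
  show thesis
  proof (rule that[of "- of_int s / real q"])
    fix y :: real assume y_pos: "y > 0"
    have dual_height_pos: "dual_height q m y > 0"
      using y_pos q_pos m_pos by (simp add: dual_height_def)
    let ?h = "\<lambda>k::int. f (Complex (- of_int s / real q + of_int k / real m) (dual_height q m y))"
    have "(\<Sum>j\<in>totatives m. f (Complex (of_int p / real q + real j / real m) y)) =
        (\<Sum>j\<in>totatives m. ?h (- u * ?inv j))"
      by (intro sum.cong refl Cc_modular_dual_point modular q_pos m_pos y_pos inverse)
    also have "\<dots> = (\<Sum>j\<in>totatives m. ?h (int j))"
    proof (rule sum_totatives_inverse[OF m_pos])
      show "coprime (- u) (int m)" unfolding u_def using int_moduli_coprime by simp
    qed (rule Cc_modular_fraction_cong[OF modular dual_height_pos m_pos])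
    finally show "delta_pr_integral m (of_int p / real q) y f =
        delta_pr_integral m (- of_int s / real q) (dual_height q m y) f"
      using m_pos by (simp add: delta_pr_integral_eq[OF modular] y_pos dual_height_pos)
  qed
qed

subsection \<open>From primitive to all rational points\<close>

lemma delta_integral_eq_sum_divisors:
  assumes modular: "f \<in> Cc_modular" and y_pos: "y > 0" and n_pos: "n > 0"
  shows "delta_integral n x y f =
      (\<Sum>m | m dvd n. real (totient m) * delta_pr_integral m x y f) / real n"
proof -
  let ?h = "\<lambda>t. f (Complex (x + t) y)"
  have "(\<Sum>j\<in>{0<..n}. ?h (real j / real n)) =
      (\<Sum>d | d dvd n. \<Sum>k\<in>totatives (n div d). ?h (real (k * d) / real n))"
    by (rule sum_by_gcd[OF n_pos])
  also have "\<dots> = (\<Sum>d | d dvd n. real (totient (n div d)) * delta_pr_integral (n div d) x y f)"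
  proof (rule sum.cong[OF refl])
    fix d assume "d \<in> {d. d dvd n}"
    then obtain m where n_eq: "n = d * m" by (auto simp: dvd_def)
    hence "d > 0" "m > 0" using n_pos by auto
    thus "(\<Sum>k\<in>totatives (n div d). ?h (real (k * d) / real n)) =
        real (totient (n div d)) * delta_pr_integral (n div d) x y f"
      by (simp add: n_eq delta_pr_integral_eq[OF modular y_pos])
  qed
  also have "\<dots> = (\<Sum>m | m dvd n. real (totient m) * delta_pr_integral m x y f)"
    using n_pos
    by (intro sum.reindex_bij_witness[where i = "\<lambda>m. n div m" and j = "\<lambda>m. n div m"]) auto
  finally show ?thesis by (simp add: delta_integral_eq[OF modular y_pos n_pos])
qed

lemma sum_totient_divisors: "(\<Sum>m | m dvd n. real (totient m)) = real n"
  using totient_divisor_sum[of n] by (metis of_nat_sum)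

lemma delta_integral_error_eq:
  assumes modular: "f \<in> Cc_modular" and y_pos: "y > 0" and n_pos: "n > 0"
  shows "delta_integral n x y f - L =
    (\<Sum>m | m dvd n. real (totient m) * (delta_pr_integral m x y f - L)) / real n"
proof -
  have "(\<Sum>m | m dvd n. real (totient m) * (delta_pr_integral m x y f - L)) =
      (\<Sum>m | m dvd n. real (totient m) * delta_pr_integral m x y f) - real n * L"
    by (simp add: right_diff_distrib sum_subtractf sum_totient_divisors flip: sum_distrib_right)
  thus ?thesis
    using n_pos
    by (simp add: delta_integral_eq_sum_divisors[OF modular y_pos n_pos] diff_divide_distrib)
qed

lemma delta_integral_shift:
  assumes modular: "f \<in> Cc_modular" and n_pos: "n > 0" and y_pos: "y > 0"
  shows "delta_integral n (x + of_int k / real n) y f = delta_integral n x y f"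
proof -
  let ?h = "\<lambda>l::int. f (Complex (x + of_int l / real n) y)"
  have "(\<Sum>j\<in>{0<..n}. ?h (k + int j)) = (\<Sum>j\<in>{0<..n}. ?h (int j))"
  proof (rule sum_periodic_reindex)
    show "?h l = ?h l'" if "[l = l'] (mod int n)" for l l'
      by (rule Cc_modular_fraction_cong[OF modular y_pos n_pos that])
    show "\<exists>i\<in>{0<..n}. [k + int j = int i] (mod int n)" for j
      using exists_pos_residue[OF n_pos] by blast
    fix i j assume "i \<in> {0<..n}" "j \<in> {0<..n}" "[k + int i = k + int j] (mod int n)"
    thus "i = j" by (intro pos_residue_unique) (simp_all only: cong_add_lcancel)
  qed simp
  thus ?thesis
    by (simp add: delta_integral_eq[OF modular y_pos n_pos] add_divide_distrib add.assoc)
qed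

lemma exists_coprime_denominator:
  fixes p :: int and q n :: nat
  assumes q_pos: "q > 0" and reduced: "coprime p (int q)" and n_mem: "n \<in> N_q q"
  obtains p' k :: int and q' :: nat where "0 < q'" "q' \<le> q" "coprime q' n" "coprime p' (int q')"
    "of_int p / real q = of_int p' / real q' + of_int k / real n"
proof -
  have "n > 0" and dvd: "gcd (n\<^sup>2) q dvd n" using n_mem by (auto simp: N_q_def)
  define q1 where "q1 = gcd (n\<^sup>2) q"
  define q2 where "q2 = q div q1"
  have q1_pos: "q1 > 0" using q_pos by (simp add: q1_def)
  have q_eq: "q = q1 * q2" by (simp add: q2_def q1_def)
  have q2_bounds: "q2 > 0" "q2 \<le> q" using q_pos q_eq q1_pos by (auto intro!: Nat.gr0I)
  obtain l where n_eq: "n = q1 * l" using dvd unfolding q1_def by (rule dvdE)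
  have "coprime (n\<^sup>2 div q1) q2" unfolding q1_def q2_def
    using q_pos by (intro div_gcd_coprime) auto
  moreover have "n\<^sup>2 div q1 = n * l" using q1_pos n_eq by (simp add: power2_eq_square)
  ultimately have coprime_n: "coprime q2 n" by (simp add: coprime_commute)
  hence "coprime (int q2) (int q1)" by (simp add: n_eq)
  then obtain u v where "u * int q2 + v * int q1 = 1"
    using bezout_int[of "int q2" "int q1"] by auto
  hence p_eq: "p = (p * u) * int q2 + (p * v) * int q1"
    by (metis distrib_left mult.assoc mult.right_neutral)
  have coprime_p: "coprime (p * v) (int q2)"
  proof (rule coprimeI)
    fix d assume common_divisor: "d dvd p * v" "d dvd int q2"
    hence "d dvd (p * u) * int q2 + (p * v) * int q1" by (intro dvd_add) auto
    hence "d dvd p" using p_eq by simp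
    moreover have "d dvd int q" using common_divisor(2) unfolding q_eq by simp
    ultimately show "is_unit d" using reduced by (metis coprime_common_divisor)
  qed
  have "real_of_int p = of_int (p * u) * real q2 + of_int (p * v) * real q1"
    using p_eq by (metis of_int_add of_int_mult of_int_of_nat_eq)
  hence "of_int p / real q = of_int (p * v) / real q2 + of_int (p * u) / real q1"
    using q1_pos q2_bounds by (simp add: q_eq add_frac_eq mult.commute add.commute)
  also have "of_int (p * u) / real q1 = of_int (p * u * int l) / real n"
    using q1_pos \<open>n > 0\<close> unfolding n_eq by simp
  finally show thesis by (rule that[OF q2_bounds coprime_n coprime_p])
qed

lemma powr_mult_divisor_count_over_self_tendsto_0:
  fixes a :: real
  assumes "a < 1"
  shows "(\<lambda>n. real n powr a * real (divisor_count n) / real n) \<longlonglongrightarrow> 0"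
proof (rule Lim_null_comparison[OF _ powr_mult_divisor_count_over_totient_tendsto_0[OF assms]])
  have ratio_le: "real n powr a * real (divisor_count n) / real n \<le>
      real n powr a * real (divisor_count n) / real (totient n)"
    if "n > 0" for n
    using that totient_le[of n] by (intro divide_left_mono) auto
  show "\<forall>\<^sub>F n in sequentially. norm (real n powr a * real (divisor_count n) / real n) \<le>
      real n powr a * real (divisor_count n) / real (totient n)"
    using eventually_gt_at_top[of 0] by eventually_elim (use ratio_le in simp)
qed

lemma totient_weighted_divisor_sum_le:
  fixes D :: "nat \<Rightarrow> real"
  assumes bound: "\<And>m. m dvd n \<Longrightarrow> \<bar>D m\<bar> \<le> K" and \<eta>_nonneg: "\<eta> \<ge> 0"
    and large: "\<And>m. m dvd n \<Longrightarrow> real m \<ge> X \<Longrightarrow> \<bar>D m\<bar> \<le> \<eta>" and X_nonneg: "X \<ge> 0"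
  shows "\<bar>\<Sum>m | m dvd n. real (totient m) * D m\<bar> \<le> \<eta> * real n + real (divisor_count n) * (X * K)"
proof -
  have "K \<ge> 0" using bound[of 1] by simp
  have "\<bar>real (totient m) * D m\<bar> \<le> \<eta> * real (totient m) + X * K" if divisor: "m dvd n" for m
  proof (cases "real m \<ge> X")
    case True
    hence "\<bar>D m\<bar> * real (totient m) \<le> \<eta> * real (totient m)"
      using large[OF divisor] by (intro mult_right_mono) auto
    moreover have "X * K \<ge> 0" using X_nonneg \<open>K \<ge> 0\<close> by simp
    ultimately show ?thesis by (simp add: abs_mult mult.commute)
  next
    case False
    hence "real (totient m) \<le> X" using totient_le[of m] by linarith
    hence "real (totient m) * \<bar>D m\<bar> \<le> X * K"
      using bound[OF divisor] X_nonneg by (intro mult_mono) auto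
    moreover have "\<eta> * real (totient m) \<ge> 0" using \<eta>_nonneg by simp
    ultimately show ?thesis by (simp add: abs_mult)
  qed
  hence "\<bar>\<Sum>m | m dvd n. real (totient m) * D m\<bar> \<le> (\<Sum>m | m dvd n. \<eta> * real (totient m) + X * K)"
    by (intro order_trans[OF sum_abs] sum_mono) simp
  also have "\<dots> = \<eta> * (\<Sum>m | m dvd n. real (totient m)) + real (divisor_count n) * (X * K)"
    by (simp add: sum.distrib sum_distrib_left divisor_count_def)
  also have "(\<Sum>m | m dvd n. real (totient m)) = real n"
    by (rule sum_totient_divisors)
  finally show ?thesis .
qed

lemma eventually_le_powr:
  fixes b C :: real
  assumes "b > 0"
  shows "eventually (\<lambda>n. C \<le> real n powr b) sequentially"
proof -
  have "filterlim (\<lambda>n. real n powr b) at_top sequentially" using assms by real_asymp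
  thus ?thesis by (simp add: filterlim_at_top)
qed

locale dense_rational_points =
  fixes f :: "complex \<Rightarrow> real" and q :: nat and y :: "nat \<Rightarrow> real" and \<alpha> c1 c2 :: real
  assumes modular: "f \<in> Cc_modular" and q_pos: "q > 0" and \<alpha>_bounds: "1 < \<alpha>" "\<alpha> < 2"
    and c_pos: "c1 > 0" "c2 > 0"
    and y_bounds: "\<And>n. n \<ge> 1 \<Longrightarrow> c1 * real n powr (-\<alpha>) \<le> y n \<and> y n \<le> c2 * real n powr (-\<alpha>)"
begin

lemma y_pos:
  assumes "n \<ge> 1"
  shows "y n > 0"
proof -
  have "0 < c1 * real n powr (-\<alpha>)" using c_pos(1) assms by simp
  thus ?thesis using y_bounds[OF assms] by linarith
qed

definition gap :: real where "gap = min (2 - \<alpha>) (\<alpha> - 1) / 4"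

lemma gap_bounds: "0 < gap" "gap < 1" "2 * gap < 2 - \<alpha>" "2 - \<alpha> < (1 - gap)\<^sup>2"
proof -
  have "4 * gap \<le> 2 - \<alpha>" "4 * gap \<le> \<alpha> - 1" by (simp_all add: gap_def)
  moreover show "0 < gap" using \<alpha>_bounds by (simp add: gap_def)
  ultimately show "gap < 1" "2 * gap < 2 - \<alpha>" using \<alpha>_bounds by linarith+
  have "2 - \<alpha> < 1 - 2 * gap" using \<open>4 * gap \<le> \<alpha> - 1\<close> \<open>0 < gap\<close> \<alpha>_bounds by linarith
  also have "\<dots> \<le> (1 - gap)\<^sup>2" by (simp add: power2_eq_square algebra_simps)
  finally show "2 - \<alpha> < (1 - gap)\<^sup>2" .
qed

lemma dual_height_ge:
  "eventually (\<lambda>n. \<forall>m q'. m > 0 \<longrightarrow> m \<le> n \<longrightarrow> real n powr (1 - gap) \<le> real m \<longrightarrow> 0 < q' \<longrightarrow> q' \<le> q \<longrightarrow>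
     real m powr (-(1 - gap)) \<le> dual_height q' m (y n)) sequentially"
proof -
  have "eventually (\<lambda>n. (real q)\<^sup>2 * c2 \<le> real n powr ((1 - gap)\<^sup>2 - (2 - \<alpha>))) sequentially"
    using gap_bounds(4) by (intro eventually_le_powr) simp
  with eventually_ge_at_top[of 1] show ?thesis
  proof eventually_elim
    case (elim n)
    show ?case
    proof (intro allI impI)
      fix m q' assume m_bounds: "m > 0" "m \<le> n" "real n powr (1 - gap) \<le> real m"
        and q'_bounds: "0 < q'" "q' \<le> q"
      have n_ge: "real n \<ge> 1" using elim by simp
      have "(real q')\<^sup>2 * (real m)\<^sup>2 * y n \<le> (real q)\<^sup>2 * (real n)\<^sup>2 * (c2 * real n powr (-\<alpha>))"
        using m_bounds(2) q'_bounds(2) y_bounds y_pos elim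
        by (intro mult_mono power_mono) (auto intro: less_imp_le)
      also have "\<dots> = ((real q)\<^sup>2 * c2) * real n powr (2 - \<alpha>)"
        using n_ge by (simp add: powr_diff powr_minus_divide)
      also have "\<dots> \<le> real n powr ((1 - gap)\<^sup>2 - (2 - \<alpha>)) * real n powr (2 - \<alpha>)"
        using elim by (intro mult_right_mono) auto
      also have "\<dots> = (real n powr (1 - gap)) powr (1 - gap)"
        by (simp add: powr_powr power2_eq_square flip: powr_add)
      also have "\<dots> \<le> real m powr (1 - gap)"
        using m_bounds(3) gap_bounds(2) by (intro powr_mono2) auto
      finally have "1 / real m powr (1 - gap) \<le> dual_height q' m (y n)"
        unfolding dual_height_def using m_bounds(1) q'_bounds(1) y_pos elim
        by (intro divide_left_mono) auto
      thus "real m powr (-(1 - gap)) \<le> dual_height q' m (y n)" by (simp only: powr_minus_divide)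
    qed
  qed
qed

lemma dual_height_le:
  assumes y0_pos: "y0 > 0"
  shows "eventually (\<lambda>n. \<forall>m q'. m > 0 \<longrightarrow> real n powr (1 - gap) \<le> real m \<longrightarrow> 0 < q' \<longrightarrow>
      dual_height q' m (y n) \<le> y0) sequentially"
proof -
  have "eventually (\<lambda>n. 1 / (y0 * c1) \<le> real n powr (2 - \<alpha> - 2 * gap)) sequentially"
    using gap_bounds(3) by (intro eventually_le_powr) simp
  with eventually_ge_at_top[of 1] show ?thesis
  proof eventually_elim
    case (elim n)
    show ?case
    proof (intro allI impI)
      fix m q' :: nat assume m_large: "m > 0" "real n powr (1 - gap) \<le> real m"
        and q'_pos: "0 < q'"
      have "1 / y0 \<le> c1 * real n powr (2 - \<alpha> - 2 * gap)"
        using elim y0_pos c_pos(1) by (simp add: field_simps)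
      also have "\<dots> = 1 * (real n powr (1 - gap))\<^sup>2 * (c1 * real n powr (-\<alpha>))"
        by (simp add: power2_eq_square algebra_simps flip: powr_add)
      also have "\<dots> \<le> (real q')\<^sup>2 * (real m)\<^sup>2 * y n"
        using m_large(2) q'_pos y_bounds elim c_pos(1)
        by (intro mult_mono power_mono one_le_power) auto
      finally have "1 / ((real q')\<^sup>2 * (real m)\<^sup>2 * y n) \<le> 1 / (1 / y0)"
        using y0_pos m_large(1) q'_pos y_pos elim by (intro divide_left_mono) auto
      thus "dual_height q' m (y n) \<le> y0" by (simp add: dual_height_def)
    qed
  qed
qed

lemma large_denominators_equidistribute:
  assumes \<epsilon>_pos: "\<epsilon> > 0"
  shows "eventually (\<lambda>n. \<forall>m p' q'. m \<le> n \<longrightarrow> real n powr (1 - gap) \<le> real m \<longrightarrow>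
    0 < q' \<longrightarrow> q' \<le> q \<longrightarrow> coprime q' m \<longrightarrow> coprime p' (int q') \<longrightarrow>
    \<bar>delta_pr_integral m (of_int p' / real q') (y n) f - mu_M_integral f\<bar> \<le> \<epsilon>) sequentially"
proof -
  have "0 < 1 - gap" "1 - gap < 1" using gap_bounds by simp_all
  then obtain m0 y0 where y0_pos: "y0 > 0"
    and equi: "\<And>m x y. m \<ge> m0 \<Longrightarrow> real m powr (-(1 - gap)) \<le> y \<Longrightarrow> y \<le> y0 \<Longrightarrow>
      \<bar>delta_pr_integral m x y f - mu_M_integral f\<bar> \<le> \<epsilon>"
    using primitive_equidistribution[OF modular _ _ \<epsilon>_pos, of "1 - gap"] by metis
  have "eventually (\<lambda>n. real (max 1 m0) \<le> real n powr (1 - gap)) sequentially"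
    using gap_bounds(2) by (intro eventually_le_powr) simp
  with eventually_ge_at_top[of 1] dual_height_ge dual_height_le[OF y0_pos] show ?thesis
  proof eventually_elim
    case (elim n)
    show ?case
    proof (intro allI impI)
      fix m :: nat and p' :: int and q' :: nat
      assume m_bounds: "m \<le> n" "real n powr (1 - gap) \<le> real m"
        and reduced: "0 < q'" "q' \<le> q" "coprime q' m" "coprime p' (int q')"
      have "real (max 1 m0) \<le> real m" using elim m_bounds(2) by linarith
      hence m_ge: "m > 0" "m \<ge> m0" by simp_all
      obtain x where "delta_pr_integral m (of_int p' / real q') (y n) f =
          delta_pr_integral m x (dual_height q' m (y n)) f"
        using modular_duality[OF modular reduced(1) m_ge(1) reduced(3,4)] y_pos elim by metis
      thus "\<bar>delta_pr_integral m (of_int p' / real q') (y n) f - mu_M_integral f\<bar> \<le> \<epsilon>"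
        using equi[of m "dual_height q' m (y n)" x] m_bounds m_ge reduced elim by simp
    qed
  qed
qed

lemma delta_pr_integral_tendsto:
  assumes reduced: "coprime p (int q)"
  shows "((\<lambda>n. delta_pr_integral n (of_int p / real q) (y n) f) \<longlongrightarrow> mu_M_integral f)
    (inf sequentially (principal (N_q_pr q)))"
  unfolding tendsto_iff eventually_inf_principal
proof (intro allI impI)
  fix \<epsilon> :: real assume "\<epsilon> > 0"
  hence "\<epsilon> / 2 > 0" by simp
  with eventually_ge_at_top[of 1] large_denominators_equidistribute
  have "eventually (\<lambda>n. 1 \<le> n \<and> (\<forall>m p' q'. m \<le> n \<longrightarrow> real n powr (1 - gap) \<le> real m \<longrightarrow>
    0 < q' \<longrightarrow> q' \<le> q \<longrightarrow> coprime q' m \<longrightarrow> coprime p' (int q') \<longrightarrow>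
    \<bar>delta_pr_integral m (of_int p' / real q') (y n) f - mu_M_integral f\<bar> \<le> \<epsilon> / 2)) sequentially"
    by (intro eventually_conj)
  thus "\<forall>\<^sub>F n in sequentially. n \<in> N_q_pr q \<longrightarrow>
      dist (delta_pr_integral n (of_int p / real q) (y n) f) (mu_M_integral f) < \<epsilon>"
  proof eventually_elim
    case (elim n)
    have "real n powr (1 - gap) \<le> real n powr 1" using elim gap_bounds by (intro powr_mono) auto
    hence "\<bar>delta_pr_integral n (of_int p / real q) (y n) f - mu_M_integral f\<bar> \<le> \<epsilon> / 2"
      if "n \<in> N_q_pr q"
      using that elim q_pos reduced by (auto simp: N_q_pr_def coprime_commute)
    thus ?case using \<open>\<epsilon> > 0\<close> by (auto simp: dist_real_def)
  qed
qed

lemma delta_integral_error_le: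
  assumes reduced: "coprime p (int q)" and n_mem: "n \<in> N_q q"
    and bound: "\<And>z. Im z > 0 \<Longrightarrow> \<bar>f z\<bar> \<le> M" and \<eta>_nonneg: "\<eta> \<ge> 0"
    and large: "\<And>m p' q'. m \<le> n \<Longrightarrow> real n powr (1 - gap) \<le> real m \<Longrightarrow> 0 < q' \<Longrightarrow> q' \<le> q \<Longrightarrow>
      coprime q' m \<Longrightarrow> coprime p' (int q') \<Longrightarrow>
      \<bar>delta_pr_integral m (of_int p' / real q') (y n) f - mu_M_integral f\<bar> \<le> \<eta>"
  shows "\<bar>delta_integral n (of_int p / real q) (y n) f - mu_M_integral f\<bar> \<le>
    \<eta> + (M + \<bar>mu_M_integral f\<bar>) * (real n powr (1 - gap) * real (divisor_count n) / real n)"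
proof -
  have n_pos: "n > 0" using n_mem by (simp add: N_q_def)
  have height_pos: "y n > 0" using y_pos n_pos by simp
  obtain p' k q' where reduced': "0 < q'" "q' \<le> q" "coprime q' n" "coprime p' (int q')"
    and split: "of_int p / real q = of_int p' / real q' + of_int k / real n"
    by (rule exists_coprime_denominator[OF q_pos reduced n_mem])
  have shift_eq: "delta_integral n (of_int p / real q) (y n) f =
      delta_integral n (of_int p' / real q') (y n) f"
    unfolding split by (rule delta_integral_shift[OF modular n_pos height_pos])
  define D where "D = (\<lambda>m. delta_pr_integral m (of_int p' / real q') (y n) f - mu_M_integral f)"
  have error_eq: "delta_integral n (of_int p / real q) (y n) f - mu_M_integral f =
      (\<Sum>m | m dvd n. real (totient m) * D m) / real n"
    unfolding shift_eq D_def by (rule delta_integral_error_eq[OF modular height_pos n_pos])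
  have "\<bar>\<Sum>m | m dvd n. real (totient m) * D m\<bar> \<le>
      \<eta> * real n + real (divisor_count n) * (real n powr (1 - gap) * (M + \<bar>mu_M_integral f\<bar>))"
  proof (rule totient_weighted_divisor_sum_le[OF _ \<eta>_nonneg])
    fix m assume divisor: "m dvd n"
    hence "m > 0" using n_pos by (auto intro!: Nat.gr0I)
    from delta_pr_integral_bounded[OF modular bound height_pos this]
    show "\<bar>D m\<bar> \<le> M + \<bar>mu_M_integral f\<bar>"
      unfolding D_def by (metis add.commute abs_triangle_ineq4 add_mono order_refl order_trans)
    assume "real n powr (1 - gap) \<le> real m"
    moreover have "m \<le> n" using divisor n_pos by (rule dvd_imp_le)
    moreover have "coprime q' m" using reduced'(3) divisor by (metis coprime_divisors dvd_refl)
    ultimately show "\<bar>D m\<bar> \<le> \<eta>" unfolding D_def using reduced' by (intro large)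
  qed simp
  hence "\<bar>delta_integral n (of_int p / real q) (y n) f - mu_M_integral f\<bar> \<le>
      (\<eta> * real n + real (divisor_count n) * (real n powr (1 - gap) * (M + \<bar>mu_M_integral f\<bar>))) /
        real n"
    unfolding error_eq by (simp add: abs_divide divide_right_mono)
  also have "\<dots> =
      \<eta> + (M + \<bar>mu_M_integral f\<bar>) * (real n powr (1 - gap) * real (divisor_count n) / real n)"
    using n_pos by (simp add: add_divide_distrib mult_ac)
  finally show ?thesis .
qed

lemma delta_integral_tendsto:
  assumes reduced: "coprime p (int q)"
  shows "((\<lambda>n. delta_integral n (of_int p / real q) (y n) f) \<longlongrightarrow> mu_M_integral f)
    (inf sequentially (principal (N_q q)))"
  unfolding tendsto_iff eventually_inf_principal
proof (intro allI impI)
  fix \<epsilon> :: real assume \<epsilon>_pos: "\<epsilon> > 0"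
  obtain M where bound: "\<And>z. Im z > 0 \<Longrightarrow> \<bar>f z\<bar> \<le> M" by (rule Cc_modular_bounded[OF modular]) blast
  let ?K = "M + \<bar>mu_M_integral f\<bar>"
  have "(\<lambda>n. ?K * (real n powr (1 - gap) * real (divisor_count n) / real n)) \<longlonglongrightarrow> ?K * 0"
    using gap_bounds(1)
    by (intro tendsto_mult tendsto_const powr_mult_divisor_count_over_self_tendsto_0) simp
  moreover have "?K * 0 < \<epsilon> / 2" using \<epsilon>_pos by simp
  ultimately have small: "eventually (\<lambda>n.
      ?K * (real n powr (1 - gap) * real (divisor_count n) / real n) < \<epsilon> / 2) sequentially"
    by (rule order_tendstoD)
  have "\<epsilon> / 2 > 0" using \<epsilon>_pos by simp
  from large_denominators_equidistribute[OF this] small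
  show "\<forall>\<^sub>F n in sequentially. n \<in> N_q q \<longrightarrow>
      dist (delta_integral n (of_int p / real q) (y n) f) (mu_M_integral f) < \<epsilon>"
  proof eventually_elim
    case (elim n)
    show ?case
    proof
      assume n_mem: "n \<in> N_q q"
      have "\<bar>delta_integral n (of_int p / real q) (y n) f - mu_M_integral f\<bar> \<le>
          \<epsilon> / 2 + ?K * (real n powr (1 - gap) * real (divisor_count n) / real n)"
        using elim \<epsilon>_pos by (intro delta_integral_error_le reduced n_mem bound) auto
      thus "dist (delta_integral n (of_int p / real q) (y n) f) (mu_M_integral f) < \<epsilon>"
        unfolding dist_real_def using elim(2) by linarith
    qed
  qed
qed

end

theorem theorem1p2:
  fixes p :: int and q :: nat and y :: "nat \<Rightarrow> real" and \<alpha> \<theta> :: real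
  assumes "q \<ge> 1" and "coprime p (int q)"
    and "\<theta> = 7/64"
    and "2 / (1 + 2 * \<theta>) \<le> \<alpha>" and "\<alpha> < 2"
    and "\<And>n. n \<ge> 1 \<Longrightarrow> y n > 0"
    and "\<exists>c1 c2. c1 > 0 \<and> c2 > 0 \<and>
           (\<forall>n\<ge>1. c1 * real n powr (-\<alpha>) \<le> y n \<and> y n \<le> c2 * real n powr (-\<alpha>))"
  shows "\<forall>f\<in>Cc_modular.
           ((\<lambda>n. delta_integral n (of_int p / real q) (y n) f) \<longlongrightarrow> mu_M_integral f)
              (inf sequentially (principal (N_q q))) \<and>
           ((\<lambda>n. delta_pr_integral n (of_int p / real q) (y n) f) \<longlongrightarrow> mu_M_integral f)
              (inf sequentially (principal (N_q_pr q)))"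
proof
  fix f assume modular: "f \<in> Cc_modular"
  obtain c1 c2 where c_pos: "c1 > 0" "c2 > 0"
    and y_bounds: "\<And>n. n \<ge> 1 \<Longrightarrow> c1 * real n powr (-\<alpha>) \<le> y n \<and> y n \<le> c2 * real n powr (-\<alpha>)"
    using assms(7) by blast
  have "1 < \<alpha>" using assms(4) unfolding assms(3) by simp
  then interpret dense_rational_points f q y \<alpha> c1 c2
    using modular assms(1,5) c_pos y_bounds by unfold_locales auto
  show "((\<lambda>n. delta_integral n (of_int p / real q) (y n) f) \<longlongrightarrow> mu_M_integral f)
              (inf sequentially (principal (N_q q))) \<and>
           ((\<lambda>n. delta_pr_integral n (of_int p / real q) (y n) f) \<longlongrightarrow> mu_M_integral f)
              (inf sequentially (principal (N_q_pr q)))"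
    using delta_integral_tendsto delta_pr_integral_tendsto assms(2) by blast
qed

end
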